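(* Let $A$ be a $C^*$-Segal algebra in the $C^*$-algebra $C$, and let $u\in A_+$ be strictly positive. Put $v=u^{1/2}\in C_+$. Then the following conditions are equivalent: (a) $(A,u)$ is an order unit $C^*$-Segal algebra; (b) there exists a self-adjoint $C$-subbimodule $D$ of $M(C)$ containing $C$ and $1$ such that $A=vDv$ and $\|vdv\|=\|d\|_C$ for all $d\in D_h$. In particular, $E_A=vCv$ and $M_C(A)=vM(C)v$ whenever $(A,u)$ is an order unit $C^*$-Segal algebra.
   Context: Algebras are complex; ideals are two-sided. A Banach algebra $A$ with norm $\|\cdot\|$ is a $C^*$-Segal algebra (in the $C^*$-algebra $C$) if there is a continuous injective homomorphism $\iota:A\to C$ whose image is a dense ideal of $C$; $A$ is identified with $\iota(A)\subseteq C$. It is self-adjoint if $\iota(A)$ is closed under the involution of $C$. Standing convention: whenever $A$ is self-adjoint, the norm $\|\cdot\|$ is assumed to satisfy $\|a^*\|=\|a\|$ for all $a\in A$ (which can be achieved by an equivalent renorming). $\|\cdot\|_C$ denotes the norm of $C$ and of its multiplier algebra $M(C)$, and $1$ is the identity of $M(C)$. For a subset $S$ of $M(C)$, $S_h$ denotes its set of self-adjoint elements. $A_+:=A\cap C_+$, and for $x,y\in A_h$, $x\le y$ means $y-x\in A_+$. An element $u\in A_+$ is strictly positive if $\omega(u)>0$ for every nonzero positive functional $\omega$ on $A$ (a linear functional nonnegative on $A_+$); by density of $A$ in $C$ such $u$ is then a strictly positive element of $C$. An element $u\in A_+$ is an order unit of $A$ if for each $x\in A_h$ there is $l>0$ with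 $x\le lu$. An order unit $C^*$-Segal algebra is a pair $(A,u)$ where $A$ is a self-adjoint $C^*$-Segal algebra and $u$ is an order unit of $A$ such that $\|a\|=\inf\{l>0:\ -lu\le a\le lu\}$ for all $a\in A_h$. The multiplier norm on $A$ is $\|a\|_M=\sup_{\|b\|\le1}\{\|ab\|,\|ba\|\}$; $\widetilde A_M$ is the completion of $(A,\|\cdot\|_M)$, in which $A$ is an ideal; the approximate ideal is $E_A:=A\widetilde A_M=\{ax: a\in A,\ x\in\widetilde A_M\}$. (For a $C^*$-Segal algebra, $\|\cdot\|_M$ and $\|\cdot\|_C$ are equivalent on $A$, so $\widetilde A_M$ is $C$ up to equivalent renorming and $E_A=\{ac:a\in A,\ c\in C\}$.) $M_C(A)$ is the set of $C$-multipliers of $A$: pairs $m=(m_l,m_r)$ of maps $C\to A$ with $m_l(xy)=m_l(x)y$, $m_r(xy)=xm_r(y)$, $xm_l(y)=m_r(x)y$ for all $x,y\in C$. Since $A\subseteq C$, $M_C(A)$ is regarded as a subset of $M(C)$ (those multipliers of $C$ mapping $C$ into $A$ from both sides); $a\in A$ corresponds to the pair $x\mapsto ax$, $x\mapsto xa$. For $S\subseteq M(C)$, $vSv=\{vsv: s\in S\}$. A $C$-subbimodule $D$ of $M(C)$ is a linear subspace with $CD\subseteq D$ and $DC\subseteq D$; it is self-adjoint if $D^*=D$. *)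

theory Defs
  imports "HOL-Analysis.Analysis"
begin

section \<open>Complex Banach algebras and C*-algebras\<close>

class complex_vector = real_vector +
  fixes scaleC :: "complex \<Rightarrow> 'a \<Rightarrow> 'a"
  assumes scaleC_add_right: "scaleC c (x + y) = scaleC c x + scaleC c y"
    and scaleC_add_left: "scaleC (c + d) x = scaleC c x + scaleC d x"
    and scaleC_scaleC: "scaleC c (scaleC d x) = scaleC (c * d) x"
    and scaleC_of_real: "scaleC (complex_of_real r) x = scaleR r x"

class complex_algebra = complex_vector + ring +
  assumes mult_scaleC_left: "scaleC c x * y = scaleC c (x * y)"
    and mult_scaleC_right: "x * scaleC c y = scaleC c (x * y)"

text \<open>No unit is assumed; the norm is complete and submultiplicative.\<close>

class complex_banach_algebra = complex_algebra + real_normed_algebra + banach +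
  assumes norm_scaleC: "norm (scaleC c x) = cmod c * norm x"

class involutive =
  fixes star :: "'a \<Rightarrow> 'a"

class cstar_algebra = complex_banach_algebra + involutive +
  assumes star_star: "star (star x) = x"
    and star_add: "star (x + y) = star x + star y"
    and star_scaleC: "star (scaleC c x) = scaleC (cnj c) (star x)"
    and star_mult: "star (x * y) = star y * star x"
    and norm_star_mult_self: "norm (star x * x) = (norm x)\<^sup>2"

definition hermitian :: "'a::involutive \<Rightarrow> bool" where
  "hermitian x \<longleftrightarrow> star x = x"

definition cstar_pos :: "'c::cstar_algebra set" where
  "cstar_pos = {x. \<exists>y. x = star y * y}"

definition pos_sqrt :: "'c::cstar_algebra \<Rightarrow> 'c" where
  "pos_sqrt x = (THE y. y \<in> cstar_pos \<and> y * y = x)"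


section \<open>The multiplier algebra\<close>

text \<open>Linearity and boundedness of the two components of a multiplier of a C*-algebra
  are automatic, so they are not required.\<close>

definition is_multiplier :: "('c::cstar_algebra \<Rightarrow> 'c) \<times> ('c \<Rightarrow> 'c) \<Rightarrow> bool" where
  "is_multiplier m \<longleftrightarrow>
     (\<forall>x y. fst m (x * y) = fst m x * y) \<and>
     (\<forall>x y. snd m (x * y) = x * snd m y) \<and>
     (\<forall>x y. x * fst m y = snd m x * y)"

lemma cstar_cancel_left:
  fixes a b :: "'c::cstar_algebra"
  assumes "\<And>x. x * a = x * b"
  shows "a = b"
proof -
  have "star (a - b) * (a - b) = 0"
    using assms by (simp add: right_diff_distrib)
  then have "(norm (a - b))\<^sup>2 = 0"
    by (metis norm_star_mult_self norm_zero)
  then show ?thesis by simp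
qed

lemma cstar_cancel_right:
  fixes a b :: "'c::cstar_algebra"
  assumes "\<And>x. a * x = b * x"
  shows "a = b"
proof -
  have "x * star a = x * star b" for x
    by (metis assms star_mult star_star)
  then have "star a = star b" by (rule cstar_cancel_left)
  then show ?thesis by (metis star_star)
qed

lemma is_multiplier_add:
  assumes "is_multiplier m"
  shows "fst m (x + y) = fst m x + fst m y" and "snd m (x + y) = snd m x + snd m y"
proof -
  have m: "z * fst m w = snd m z * w" for z w
    using assms by (simp add: is_multiplier_def)
  show "fst m (x + y) = fst m x + fst m y"
    by (rule cstar_cancel_left) (simp add: m distrib_left)
  show "snd m (x + y) = snd m x + snd m y"
    by (rule cstar_cancel_right) (simp add: m[symmetric] distrib_right)
qed

lemma is_multiplier_scaleC:
  assumes "is_multiplier m"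
  shows "fst m (scaleC c x) = scaleC c (fst m x)" and "snd m (scaleC c x) = scaleC c (snd m x)"
proof -
  have m: "z * fst m w = snd m z * w" for z w
    using assms by (simp add: is_multiplier_def)
  show "fst m (scaleC c x) = scaleC c (fst m x)"
    by (rule cstar_cancel_left) (simp add: m mult_scaleC_right)
  show "snd m (scaleC c x) = scaleC c (snd m x)"
    by (rule cstar_cancel_right) (simp add: m[symmetric] mult_scaleC_left)
qed

typedef (overloaded) 'c multiplier =
  "{m :: ('c::cstar_algebra \<Rightarrow> 'c) \<times> ('c \<Rightarrow> 'c). is_multiplier m}"
proof
  show "(\<lambda>x. x, \<lambda>x. x) \<in> {m. is_multiplier m}"
    by (simp add: is_multiplier_def)
qed

setup_lifting type_definition_multiplier

lift_definition lmult :: "'c::cstar_algebra multiplier \<Rightarrow> 'c \<Rightarrow> 'c" is fst .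
lift_definition rmult :: "'c::cstar_algebra multiplier \<Rightarrow> 'c \<Rightarrow> 'c" is snd .

lift_definition mult_emb :: "'c::cstar_algebra \<Rightarrow> 'c multiplier"
  is "\<lambda>c. (\<lambda>x. c * x, \<lambda>x. x * c)"
  by (simp add: is_multiplier_def mult.assoc)

text \<open>The class \<open>ring_1\<close> is out of reach: the zero algebra is not excluded, and there
  \<open>0 = 1\<close> in the multiplier algebra.\<close>

instantiation multiplier :: (cstar_algebra) complex_algebra
begin

lift_definition zero_multiplier :: "'a multiplier" is "(\<lambda>x. 0, \<lambda>x. 0)"
  by (simp add: is_multiplier_def)

lift_definition plus_multiplier :: "'a multiplier \<Rightarrow> 'a multiplier \<Rightarrow> 'a multiplier"
  is "\<lambda>m n. (\<lambda>x. fst m x + fst n x, \<lambda>x. snd m x + snd n x)"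
  by (simp add: is_multiplier_def algebra_simps)

lift_definition minus_multiplier :: "'a multiplier \<Rightarrow> 'a multiplier \<Rightarrow> 'a multiplier"
  is "\<lambda>m n. (\<lambda>x. fst m x - fst n x, \<lambda>x. snd m x - snd n x)"
  by (simp add: is_multiplier_def algebra_simps)

lift_definition uminus_multiplier :: "'a multiplier \<Rightarrow> 'a multiplier"
  is "\<lambda>m. (\<lambda>x. - fst m x, \<lambda>x. - snd m x)"
  by (simp add: is_multiplier_def)

lift_definition times_multiplier :: "'a multiplier \<Rightarrow> 'a multiplier \<Rightarrow> 'a multiplier"
  is "\<lambda>m n. (\<lambda>x. fst m (fst n x), \<lambda>x. snd n (snd m x))"
  by (simp add: is_multiplier_def)

lift_definition scaleR_multiplier :: "real \<Rightarrow> 'a multiplier \<Rightarrow> 'a multiplier"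
  is "\<lambda>r m. (\<lambda>x. r *\<^sub>R fst m x, \<lambda>x. r *\<^sub>R snd m x)"
  by (simp add: is_multiplier_def)

lift_definition scaleC_multiplier :: "complex \<Rightarrow> 'a multiplier \<Rightarrow> 'a multiplier"
  is "\<lambda>c m. (\<lambda>x. scaleC c (fst m x), \<lambda>x. scaleC c (snd m x))"
  by (simp add: is_multiplier_def mult_scaleC_left mult_scaleC_right)

instance
proof
  fix k l m :: "'a multiplier" and r s :: real and c d :: complex
  show "k + l + m = k + (l + m)" "k + l = l + k" "0 + k = k" "- k + k = 0" "k - l = k + - l"
    by (transfer; simp add: algebra_simps)+
  show "r *\<^sub>R (k + l) = r *\<^sub>R k + r *\<^sub>R l" "(r + s) *\<^sub>R k = r *\<^sub>R k + s *\<^sub>R k"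
    "r *\<^sub>R s *\<^sub>R k = (r * s) *\<^sub>R k" "1 *\<^sub>R k = k"
    by (transfer; simp add: algebra_simps)+
  show "scaleC c (k + l) = scaleC c k + scaleC c l"
    "scaleC (c + d) k = scaleC c k + scaleC d k"
    "scaleC c (scaleC d k) = scaleC (c * d) k" "scaleC (complex_of_real r) k = r *\<^sub>R k"
    by (transfer; simp add: scaleC_add_right scaleC_add_left scaleC_scaleC scaleC_of_real)+
  show "k * l * m = k * (l * m)"
    by (transfer; simp)
  show "(k + l) * m = k * m + l * m" "k * (l + m) = k * l + k * m"
    by (transfer; simp add: is_multiplier_add)+
  show "scaleC c k * l = scaleC c (k * l)" "k * scaleC c l = scaleC c (k * l)"
    by (transfer; simp add: is_multiplier_scaleC)+
qed

end

instantiation multiplier :: (cstar_algebra) monoid_mult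
begin

lift_definition one_multiplier :: "'a multiplier" is "(\<lambda>x. x, \<lambda>x. x)"
  by (simp add: is_multiplier_def)

instance by standard (transfer; simp)+

end

instantiation multiplier :: (cstar_algebra) involutive
begin

lift_definition star_multiplier :: "'a multiplier \<Rightarrow> 'a multiplier"
  is "\<lambda>m. (\<lambda>x. star (snd m (star x)), \<lambda>x. star (fst m (star x)))"
  unfolding is_multiplier_def fst_conv snd_conv
  by (metis star_mult star_star)

instance ..

end

text \<open>The norm of a multiplier is the operator norm of its left component, which equals that
  of its right component.\<close>

definition norm_MC :: "'c::cstar_algebra multiplier \<Rightarrow> real" where
  "norm_MC m = onorm (lmult m)"


section \<open>C*-Segal algebras\<close>

text \<open>A C*-Segal algebra in \<open>'c\<close> is given by its embedding \<open>\<iota>\<close>, a homomorphism of complex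
  algebras; \<open>'a\<close> carries the Banach algebra norm.\<close>

definition cstar_segal :: "('a::complex_banach_algebra \<Rightarrow> 'c::cstar_algebra) \<Rightarrow> bool" where
  "cstar_segal \<iota> \<longleftrightarrow>
     Vector_Spaces.linear scaleC scaleC \<iota> \<and>
     (\<forall>a b. \<iota> (a * b) = \<iota> a * \<iota> b) \<and>
     inj \<iota> \<and> continuous_on UNIV \<iota> \<and>
     closure (range \<iota>) = UNIV \<and>
     (\<forall>a c. \<iota> a * c \<in> range \<iota> \<and> c * \<iota> a \<in> range \<iota>)"

definition segal_self_adjoint :: "('a \<Rightarrow> 'c::cstar_algebra) \<Rightarrow> bool" where
  "segal_self_adjoint \<iota> \<longleftrightarrow> star ` range \<iota> \<subseteq> range \<iota>"

definition star_isometric :: "('a::complex_banach_algebra \<Rightarrow> 'c::cstar_algebra) \<Rightarrow> bool" where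
  "star_isometric \<iota> \<longleftrightarrow> (\<forall>a b. \<iota> b = star (\<iota> a) \<longrightarrow> norm b = norm a)"

definition segal_pos :: "('a \<Rightarrow> 'c::cstar_algebra) \<Rightarrow> 'a set" where
  "segal_pos \<iota> = {a. \<iota> a \<in> cstar_pos}"

definition segal_le :: "('a::complex_banach_algebra \<Rightarrow> 'c::cstar_algebra) \<Rightarrow> 'a \<Rightarrow> 'a \<Rightarrow> bool" where
  "segal_le \<iota> x y \<longleftrightarrow> y - x \<in> segal_pos \<iota>"

text \<open>Functionals are complex linear and not assumed continuous.\<close>

definition positive_functional ::
  "('a::complex_banach_algebra \<Rightarrow> 'c::cstar_algebra) \<Rightarrow> ('a \<Rightarrow> complex) \<Rightarrow> bool" where
  "positive_functional \<iota> \<omega> \<longleftrightarrow>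
     Vector_Spaces.linear scaleC (*) \<omega> \<and> (\<forall>a\<in>segal_pos \<iota>. \<omega> a \<in> \<real>\<^sub>\<ge>\<^sub>0)"

definition strictly_positive ::
  "('a::complex_banach_algebra \<Rightarrow> 'c::cstar_algebra) \<Rightarrow> 'a \<Rightarrow> bool" where
  "strictly_positive \<iota> u \<longleftrightarrow> u \<in> segal_pos \<iota> \<and>
     (\<forall>\<omega>. positive_functional \<iota> \<omega> \<and> (\<exists>a. \<omega> a \<noteq> 0) \<longrightarrow> \<omega> u \<in> \<real> \<and> Re (\<omega> u) > 0)"

definition order_unit ::
  "('a::complex_banach_algebra \<Rightarrow> 'c::cstar_algebra) \<Rightarrow> 'a \<Rightarrow> bool" where
  "order_unit \<iota> u \<longleftrightarrow> u \<in> segal_pos \<iota> \<and>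
     (\<forall>x. hermitian (\<iota> x) \<longrightarrow> (\<exists>l>0. segal_le \<iota> x (l *\<^sub>R u)))"

definition order_unit_cstar_segal ::
  "('a::complex_banach_algebra \<Rightarrow> 'c::cstar_algebra) \<Rightarrow> 'a \<Rightarrow> bool" where
  "order_unit_cstar_segal \<iota> u \<longleftrightarrow>
     cstar_segal \<iota> \<and> segal_self_adjoint \<iota> \<and> order_unit \<iota> u \<and>
     (\<forall>a. hermitian (\<iota> a) \<longrightarrow>
        norm a = Inf {l. l > 0 \<and> segal_le \<iota> (- (l *\<^sub>R u)) a \<and> segal_le \<iota> a (l *\<^sub>R u)})"

definition norm_M :: "'a::complex_banach_algebra \<Rightarrow> real" where
  "norm_M a = (SUP b\<in>{b. norm b \<le> 1}. max (norm (a * b)) (norm (b * a)))"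

text \<open>The approximate ideal \<open>E\<^sub>A\<close>, the set of products \<open>a x\<close> with \<open>a\<close> in \<open>A\<close> and \<open>x\<close> in the
  completion of \<open>A\<close> for \<open>norm_M\<close>. The element \<open>x\<close> is represented by a \<open>norm_M\<close>-Cauchy
  sequence \<open>X\<close> in \<open>A\<close>, so \<open>a x\<close> is the class of the sequence \<open>a X\<^sub>n\<close>; it lies in \<open>A\<close>,
  an ideal of its completion, and equals \<open>y\<close> iff \<open>a X\<^sub>n\<close> tends to \<open>y\<close> in \<open>norm_M\<close>.\<close>

definition mult_Cauchy :: "(nat \<Rightarrow> 'a::complex_banach_algebra) \<Rightarrow> bool" where
  "mult_Cauchy X \<longleftrightarrow> (\<forall>e>0. \<exists>N. \<forall>m\<ge>N. \<forall>n\<ge>N. norm_M (X m - X n) < e)"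

definition approximate_ideal :: "'a::complex_banach_algebra set" where
  "approximate_ideal =
     {y. \<exists>a X. mult_Cauchy X \<and> (\<lambda>n. norm_M (a * X n - y)) \<longlonglongrightarrow> 0}"

definition C_multipliers :: "('a \<Rightarrow> 'c::cstar_algebra) \<Rightarrow> 'c multiplier set" where
  "C_multipliers \<iota> = {m. range (lmult m) \<subseteq> range \<iota> \<and> range (rmult m) \<subseteq> range \<iota>}"

definition C_subbimodule :: "'c::cstar_algebra multiplier set \<Rightarrow> bool" where
  "C_subbimodule D \<longleftrightarrow> module.subspace scaleC D \<and>
     (\<forall>c. \<forall>d\<in>D. mult_emb c * d \<in> D \<and> d * mult_emb c \<in> D)"

end

theory Submission
  imports Defs
begin

text \<open>Strict positivity of \<open>u\<close> forces \<open>u C\<close>, hence \<open>v C\<close>, to be dense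
  in \<open>C\<close>: otherwise the Hahn-Banach theorem for
  \<open>p c = inf {t \<ge> 0. Re c \<le> t + n u for some n \<ge> 0}\<close> yields a nonzero positive functional killing \<open>u\<close>.
  By density, \<open>m \<ge> 0\<close> iff \<open>v m v \<ge> 0\<close> for hermitian multipliers \<open>m\<close>, so the order norm of
  \<open>v d v\<close> is the C*-norm of \<open>d\<close>; this is (b) to (a) and the norm formula in (b).
  Conversely, if \<open>u\<close> is an order unit, then \<open>c u c\<^sup>* \<le> K u\<close> uniformly on the unit ball by Baire's
  theorem, so \<open>C\<close> acts boundedly on \<open>A\<close> by multiplication. Hence \<open>{c. c a \<in> v C v}\<close> is closed in \<open>C\<close>,
  and it contains a dense set, first for \<open>a = u\<close>, which gives \<open>C v = v C\<close>, and then for every \<open>a\<close> in \<open>A\<close>.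
  So \<open>C A = v C v\<close>, and any \<open>m\<close> mapping \<open>C\<close> into \<open>A\<close> can be divided by \<open>v\<close> on both sides within \<open>M(C)\<close>.\<close>

section \<open>Baire category and the Hahn-Banach theorem\<close>

text \<open>C need not have a unit, but the order arguments use one. So M(C) is made into a unital
  C*-algebra and the order of C is read there; roots of elements of C stay in C because the
  coefficients of sqrt (1 - z) sum to 0. The whole order theory rests on this series and on
  unitaries s + i w. Positivity of a hermitian p is encoded as norm (t 1 - p) \<le> t, which makes
  sums easy and moves the difficulty to \<open>star y * y\<close>. Closedness of the set of
  multipliers c with c a in vCv needs two estimates between different norms: multiplication by C is
  bounded into the norm of A, and the norm of A controls the middle factor e of v e v. The second is
  the order unit formula, which speaks of hermitian elements only; splitting into real and imaginary
  parts costs a factor 2. The equation C v = v C replaces an inverse of v: although v need not be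
  invertible, the formal conjugates of c by v are elements of C.\<close>

lemma Baire_ball:
  fixes B :: "nat \<Rightarrow> 'a::complete_space set"
  assumes closed: "\<And>n. closed (B n)" and cover: "(\<Union>n. B n) = UNIV"
  obtains n x e where "e > 0" "ball x e \<subseteq> B n"
proof -
  have "Met_TC.mcomplete TYPE('a)"
    by (simp add: complete_UNIV)
  have "\<exists>n. interior (B n) \<noteq> {}"
  proof (rule ccontr)
    assume "\<not> ?thesis"
    then have "euclidean interior_of \<Union>(range B) = {}"
      using Met_TC.metric_Baire_category_alt[OF \<open>Met_TC.mcomplete TYPE('a)\<close>, of "range B"] closed
      by auto
    then show False by (simp add: cover)
  qed
  then obtain n x where "x \<in> interior (B n)" by blast
  then obtain e where "e > 0" "ball x e \<subseteq> B n"
    by (auto simp: mem_interior)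
  then show thesis by (rule that)
qed

definition sublinear :: "('a::real_vector \<Rightarrow> real) \<Rightarrow> bool" where
  "sublinear p \<longleftrightarrow> (\<forall>x y. p (x + y) \<le> p x + p y) \<and> (\<forall>t\<ge>0. \<forall>x. p (t *\<^sub>R x) = t * p x)"

lemma sublinearI:
  assumes "\<And>x y. p (x + y) \<le> p x + p y" and "p 0 = 0"
    and "\<And>t x. t > 0 \<Longrightarrow> p (t *\<^sub>R x) \<le> t * p x"
  shows "sublinear p"
proof -
  have "p (t *\<^sub>R x) = t * p x" if "t > 0" for t x
  proof (rule antisym)
    have "p ((1 / t) *\<^sub>R (t *\<^sub>R x)) \<le> (1 / t) * p (t *\<^sub>R x)"
      using that by (intro assms(3)) simp
    then show "t * p x \<le> p (t *\<^sub>R x)" using that by (simp add: field_simps)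
  qed (use that assms(3) in auto)
  then show ?thesis
    unfolding sublinear_def using assms(1,2) by (metis less_eq_real_def mult_zero_left scaleR_zero_left)
qed

lemma sublinear_zero: "sublinear p \<Longrightarrow> p 0 = 0"
  unfolding sublinear_def by (metis mult_zero_left order_refl scaleR_zero_left)

lemma sublinear_neg_le: "sublinear p \<Longrightarrow> - p (- x) \<le> p x"
proof -
  assume p: "sublinear p"
  then have "p (x + - x) \<le> p x + p (- x)" unfolding sublinear_def by blast
  then show ?thesis using sublinear_zero[OF p] by simp
qed

text \<open>The infimum of p (x + t y) - t p y over t \<ge> 0 lowers p in the direction y: at t = 0
  it is p x, and for x = -y, t = 1 it is - p y. If p is minimal, nothing can be lowered, and t = 1
  is the missing half of additivity.\<close>

lemma sublinear_below:
  fixes p :: "'a::real_vector \<Rightarrow> real"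
  assumes p: "sublinear p"
  obtains q where "sublinear q" "\<And>x. q x \<le> p x" "\<And>x t. t \<ge> 0 \<Longrightarrow> q x \<le> p (x + t *\<^sub>R y) - t * p y"
proof -
  define q where "q x = (INF t\<in>{0..}. p (x + t *\<^sub>R y) - t * p y)" for x
  have add: "p (x + z) \<le> p x + p z" for x z using p by (simp add: sublinear_def)
  have sc: "t \<ge> 0 \<Longrightarrow> p (t *\<^sub>R x) = t * p x" for t x using p by (simp add: sublinear_def)
  have lower: "- p (- x) \<le> p (x + t *\<^sub>R y) - t * p y" if "t \<ge> 0" for x t
  proof -
    have "p (t *\<^sub>R y) \<le> p (x + t *\<^sub>R y) + p (- x)"
      using add[of "x + t *\<^sub>R y" "- x"] by simp
    then show ?thesis using sc[OF that] by simp
  qed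
  have bdd: "bdd_below ((\<lambda>t. p (x + t *\<^sub>R y) - t * p y) ` {0..})" for x
    using lower by (intro bdd_belowI[of _ "- p (- x)"]) auto
  have up: "q x \<le> p (x + t *\<^sub>R y) - t * p y" if "t \<ge> 0" for x t
    unfolding q_def by (intro cINF_lower bdd) (use that in auto)
  have le: "q x \<le> p x" for x using up[of 0 x] by simp
  have glb: "c \<le> q x" if "\<And>t. t \<ge> 0 \<Longrightarrow> c \<le> p (x + t *\<^sub>R y) - t * p y" for c x
    unfolding q_def by (intro cINF_greatest) (use that in auto)
  have "sublinear q"
  proof (rule sublinearI)
    fix x z
    have "q (x + z) - (p (x + t *\<^sub>R y) - t * p y) \<le> q z" if "t \<ge> 0" for t
    proof (rule glb)
      fix s :: real assume "s \<ge> 0"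
      have "q (x + z) \<le> p ((x + z) + (t + s) *\<^sub>R y) - (t + s) * p y"
        using up \<open>s \<ge> 0\<close> that by simp
      also have "(x + z) + (t + s) *\<^sub>R y = (x + t *\<^sub>R y) + (z + s *\<^sub>R y)"
        by (simp add: algebra_simps)
      also have "p \<dots> \<le> p (x + t *\<^sub>R y) + p (z + s *\<^sub>R y)" by (rule add)
      finally show "q (x + z) - (p (x + t *\<^sub>R y) - t * p y) \<le> p (z + s *\<^sub>R y) - s * p y"
        by (simp add: algebra_simps)
    qed
    then have "q (x + z) - q z \<le> q x"
      by (intro glb) (smt (verit))
    then show "q (x + z) \<le> q x + q z" by simp
  next
    show "q 0 = 0"
      using le[of 0] sublinear_zero[OF p] glb[of 0 0] sc by simp
  next
    fix t :: real and x assume t: "t > 0"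
    have "q (t *\<^sub>R x) / t \<le> q x"
    proof (rule glb)
      fix s :: real assume "s \<ge> 0"
      have "q (t *\<^sub>R x) \<le> p (t *\<^sub>R x + (t * s) *\<^sub>R y) - (t * s) * p y"
        using up t \<open>s \<ge> 0\<close> by simp
      also have "t *\<^sub>R x + (t * s) *\<^sub>R y = t *\<^sub>R (x + s *\<^sub>R y)" by (simp add: algebra_simps)
      also have "p \<dots> = t * p (x + s *\<^sub>R y)" using sc t by simp
      finally show "q (t *\<^sub>R x) / t \<le> p (x + s *\<^sub>R y) - s * p y"
        using t by (simp add: field_simps)
    qed
    then show "q (t *\<^sub>R x) \<le> t * q x" using t by (simp add: field_simps)
  qed
  with le up show thesis using that by blast
qed

text \<open>A pointwise minimal sublinear functional is additive: otherwise
  \<open>sublinear_below\<close> would make it smaller.\<close>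

lemma Hahn_Banach_sublinear:
  fixes p :: "'a::real_vector \<Rightarrow> real"
  assumes p: "sublinear p"
  obtains f where "linear f" "\<And>x. f x \<le> p x" "f x0 = p x0"
proof -
  \<comment> \<open>Minimizing below p0 instead of p pins the value at x0: t = 1 at the point -x0
    gives \<open>p0 (- x0) \<le> - p x0\<close>, hence \<open>f x0 \<ge> p x0\<close> for every
    linear f below p0.\<close>
  obtain p0 where p0: "sublinear p0" "\<And>x. p0 x \<le> p x"
    and p0_le: "\<And>x t. t \<ge> 0 \<Longrightarrow> p0 x \<le> p (x + t *\<^sub>R x0) - t * p x0"
    using sublinear_below[OF p] by metis
  define A where "A = {q. sublinear q \<and> q \<le> p0}"
  have "\<exists>m\<in>A. \<forall>a\<in>A. m \<ge> a \<longrightarrow> a = m"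
  proof (rule predicate_Zorn)
    show "partial_order_on A (relation_of (\<ge>) A)"
      by (auto simp: partial_order_on_def preorder_on_def refl_on_def trans_def antisym_def relation_of_def)
  next
    fix C assume C: "C \<in> Chains (relation_of (\<ge>) A)"
    then have CA: "C \<subseteq> A" and chain: "\<And>a b. a \<in> C \<Longrightarrow> b \<in> C \<Longrightarrow> a \<le> b \<or> b \<le> a"
      by (auto simp: Chains_def relation_of_def)
    show "\<exists>l\<in>A. \<forall>a\<in>C. l \<le> a"
    proof (cases "C = {}")
      case True
      then show ?thesis using p0(1) by (auto simp: A_def)
    next
      case False
      define l where "l x = (INF q\<in>C. q x)" for x
      have sub: "sublinear q" "\<And>x. q x \<le> p0 x" if "q \<in> C" for q
        using that CA by (auto simp: A_def le_fun_def)
      \<comment> \<open>A lower bound independent of q, so that the infimum over the chain is finite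
        at every point.\<close>
      have "- p0 (- x) \<le> q x" if "q \<in> C" for q x
        using sublinear_neg_le[OF sub(1)[OF that], of x] sub(2)[OF that, of "- x"] by linarith
      then have bdd: "bdd_below ((\<lambda>q. q x) ` C)" for x
        by (intro bdd_belowI[of _ "- p0 (- x)"]) auto
      have low: "l x \<le> q x" if "q \<in> C" for q x
        unfolding l_def by (intro cINF_lower bdd that)
      have glb: "c \<le> l x" if "\<And>q. q \<in> C \<Longrightarrow> c \<le> q x" for c x
        unfolding l_def using False by (intro cINF_greatest) (use that in auto)
      have "sublinear l"
      proof (rule sublinearI)
        fix x y
        have *: "l (x + y) \<le> q x + r y" if q: "q \<in> C" and r: "r \<in> C" for q r
        proof -
          obtain s where s: "s \<in> C" "s \<le> q" "s \<le> r" using chain[OF q r] q r by blast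
          have "l (x + y) \<le> s (x + y)" using low s by blast
          also have "\<dots> \<le> s x + s y" using sub(1)[OF s(1)] by (simp add: sublinear_def)
          also have "\<dots> \<le> q x + r y" using s by (simp add: le_fun_def add_mono)
          finally show ?thesis .
        qed
        have "l (x + y) - q x \<le> l y" if "q \<in> C" for q
          by (rule glb) (use *[OF that] in \<open>simp add: algebra_simps\<close>)
        then have "l (x + y) - l y \<le> l x"
          by (intro glb) (smt (verit))
        then show "l (x + y) \<le> l x + l y" by simp
      next
        have "q 0 = 0" if "q \<in> C" for q using sublinear_zero sub(1) that by blast
        then have "(\<lambda>q. q 0) ` C = {0}" using False by force
        then show "l 0 = 0" by (simp add: l_def)
      next
        fix t :: real and x assume t: "t > 0"
        have "l (t *\<^sub>R x) / t \<le> l x"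
        proof (rule glb)
          fix q assume "q \<in> C"
          then show "l (t *\<^sub>R x) / t \<le> q x"
            using low[of q "t *\<^sub>R x"] sub(1)[of q] t by (simp add: sublinear_def field_simps)
        qed
        then show "l (t *\<^sub>R x) \<le> t * l x" using t by (simp add: field_simps)
      qed
      moreover have "l \<le> p0"
        using False low sub(2) by (metis all_not_in_conv le_fun_def order_trans)
      ultimately have "l \<in> A" by (simp add: A_def)
      then show ?thesis using low by (auto simp: le_fun_def)
    qed
  qed
  then obtain f where fA: "f \<in> A" and f_min: "\<And>q. q \<in> A \<Longrightarrow> q \<le> f \<Longrightarrow> q = f" by blast
  have f: "sublinear f" "f \<le> p0" using fA by (auto simp: A_def)
  have min: "q = f" if "sublinear q" "q \<le> f" for q
  proof (rule f_min)
    show "q \<in> A" using that f(2) order_trans[of q f p0] by (simp add: A_def)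
  qed (rule that)
  have add: "f (x + y) = f x + f y" for x y
  proof (rule antisym)
    show "f (x + y) \<le> f x + f y" using f by (simp add: sublinear_def)
    obtain q where q: "sublinear q" "\<And>x. q x \<le> f x"
      "\<And>x t. t \<ge> 0 \<Longrightarrow> q x \<le> f (x + t *\<^sub>R y) - t * f y"
      using sublinear_below[OF f(1)] by metis
    have "q = f" using min q(1,2) by (simp add: le_fun_def)
    then show "f x + f y \<le> f (x + y)" using q(3)[of 1 x] by simp
  qed
  have f0: "f 0 = 0" using f(1) sublinear_zero by blast
  have minus: "f (- x) = - f x" for x using add[of x "- x"] f0 by simp
  have "f (t *\<^sub>R x) = t * f x" for t x
  proof (cases "t \<ge> 0")
    case True then show ?thesis using f(1) by (simp add: sublinear_def)
  next
    case False
    then have "f ((- t) *\<^sub>R x) = (- t) * f x" using f(1) False unfolding sublinear_def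
      by (metis neg_0_le_iff_le nle_le)
    then show ?thesis using minus[of "t *\<^sub>R x"] by simp
  qed
  then have lin: "linear f" by (intro linearI) (simp_all add: add)
  have le: "f x \<le> p x" for x using le_funD[OF f(2), of x] p0(2)[of x] by linarith
  have "f (- x0) \<le> p0 (- x0)" using f(2) by (simp add: le_fun_def)
  also have "\<dots> \<le> - p x0" using p0_le[of 1 "- x0"] sublinear_zero[OF p] by simp
  finally have "f x0 = p x0" using le[of x0] minus[of x0] by simp
  with lin le show thesis by (rule that)
qed

section \<open>C*-algebras\<close>

lemma scaleC_minus1: "scaleC (-1) x = - (x :: 'a::complex_vector)"
  using scaleC_of_real[of "-1" x] by (simp del: scaleC_of_real)

lemma star_zero [simp]: "star (0 :: 'c::cstar_algebra) = 0"
  using star_add[of "0 :: 'c" 0] by simp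

lemma star_scaleR: "star (r *\<^sub>R (x :: 'c::cstar_algebra)) = r *\<^sub>R star x"
  by (simp add: star_scaleC flip: scaleC_of_real)

lemma star_minus: "star (- (x :: 'c::cstar_algebra)) = - star x"
  using star_scaleR[of "-1" x] by simp

lemma star_diff: "star (x - (y :: 'c::cstar_algebra)) = star x - star y"
  using star_add[of x "- y"] by (simp add: star_minus)

lemma norm_star [simp]: "norm (star (x :: 'c::cstar_algebra)) = norm x"
proof -
  have "norm z \<le> norm (star z)" for z :: 'c
  proof (cases "z = 0")
    case False
    have "norm z * norm z \<le> norm (star z) * norm z"
      using norm_star_mult_self[of z] norm_mult_ineq[of "star z" z] by (simp add: power2_eq_square)
    then show ?thesis using False by simp
  qed simp
  from this[of x] this[of "star x"] show ?thesis by (simp add: star_star)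
qed

lemma norm_mult_star: "norm (x * star x) = (norm (x :: 'c::cstar_algebra))\<^sup>2"
  using norm_star_mult_self[of "star x"] by (simp add: star_star)

lemma star_mult_self_eq_0 [simp]: "star x * x = 0 \<longleftrightarrow> (x :: 'c::cstar_algebra) = 0"
  using norm_star_mult_self[of x] by auto

context
  fixes x y :: "'c::cstar_algebra"
  assumes x: "hermitian x"
begin

lemma hermitian_square_eq_0: "x * x = 0 \<Longrightarrow> x = 0"
  using x star_mult_self_eq_0[of x] by (simp add: hermitian_def)

lemma hermitian_add: "hermitian y \<Longrightarrow> hermitian (x + y)"
  using x by (simp add: hermitian_def star_add)

lemma hermitian_diff: "hermitian y \<Longrightarrow> hermitian (x - y)"
  using x by (simp add: hermitian_def star_diff)

lemma hermitian_minus: "hermitian (- x)"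
  using x by (simp add: hermitian_def star_minus)

lemma hermitian_scaleR: "hermitian (r *\<^sub>R x)"
  using x by (simp add: hermitian_def star_scaleR)

lemma hermitian_mult: "hermitian y \<Longrightarrow> x * y = y * x \<Longrightarrow> hermitian (x * y)"
  using x by (simp add: hermitian_def star_mult)

lemma hermitian_conj: "hermitian (star y * x * y)"
  using x by (simp add: hermitian_def star_mult star_star mult.assoc)

end

lemma hermitian_zero: "hermitian (0 :: 'c::cstar_algebra)"
  by (simp add: hermitian_def)

lemma hermitian_star_mult: "hermitian (star y * (y :: 'c::cstar_algebra))"
  by (simp add: hermitian_def star_mult star_star)

lemma bounded_linear_star: "bounded_linear (star :: 'c::cstar_algebra \<Rightarrow> 'c)"
  by (rule bounded_linear_intro[where K = 1]) (simp_all add: star_add star_scaleR)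

lemmas tendsto_star = bounded_linear.tendsto[OF bounded_linear_star]

lemma closed_hermitian: "closed {x :: 'c::cstar_algebra. hermitian x}"
  unfolding hermitian_def
  by (intro closed_Collect_eq continuous_on_id linear_continuous_on bounded_linear_star)

definition re_part :: "'c::cstar_algebra \<Rightarrow> 'c" where
  "re_part x = (1/2) *\<^sub>R (x + star x)"

definition im_part :: "'c::cstar_algebra \<Rightarrow> 'c" where
  "im_part x = re_part (scaleC (- \<i>) x)"

lemma hermitian_re_part: "hermitian (re_part x)"
  by (simp add: re_part_def hermitian_def star_scaleR star_add star_star add.commute)

lemma hermitian_im_part: "hermitian (im_part x)"
  by (simp add: im_part_def hermitian_re_part)

lemma scaleC_minus_right: "scaleC c (- x) = - scaleC c (x :: 'a::complex_vector)"
  by (simp add: scaleC_scaleC flip: scaleC_minus1)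

lemma scaleC_diff_right: "scaleC c (x - y) = scaleC c x - scaleC c (y :: 'a::complex_vector)"
  using scaleC_add_right[of c x "- y"] by (simp add: scaleC_minus_right)

lemma scaleC_minus_left: "scaleC (- c) x = - scaleC c (x :: 'a::complex_vector)"
  by (simp add: scaleC_scaleC flip: scaleC_minus1)

lemma scaleC_scaleR: "scaleC c (r *\<^sub>R x) = r *\<^sub>R scaleC c (x :: 'a::complex_vector)"
  by (simp add: scaleC_scaleC mult.commute flip: scaleC_of_real)

lemma scaleC_one: "scaleC 1 x = (x :: 'a::complex_vector)"
  using scaleC_of_real[of 1 x] by simp

lemma re_im_decomp: "x = re_part x + scaleC \<i> (im_part x)"
proof -
  have "scaleC \<i> (im_part x) = (1/2) *\<^sub>R (x - star x)"
    by (simp add: im_part_def re_part_def scaleC_scaleR scaleC_add_right star_scaleC scaleC_scaleC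
        scaleC_minus_left scaleC_one star_minus scaleC_minus_right scaleC_diff_right)
  then have "re_part x + scaleC \<i> (im_part x) = (1/2) *\<^sub>R x + (1/2) *\<^sub>R x"
    by (simp add: re_part_def scaleR_add_right scaleR_diff_right)
  also have "\<dots> = x" by (simp flip: scaleR_left.add)
  finally show ?thesis by simp
qed

section \<open>Positive elements of a unital C*-algebra\<close>

text \<open>The Taylor coefficients of \<open>z \<mapsto> sqrt (1 - z)\<close>.\<close>

definition sqrt_coeff :: "nat \<Rightarrow> real" where
  "sqrt_coeff n = ((1/2) gchoose n) * (-1) ^ n"

lemma sqrt_coeff_0 [simp]: "sqrt_coeff 0 = 1"
  by (simp add: sqrt_coeff_def)

lemma sqrt_coeff_Suc: "sqrt_coeff (Suc n) = sqrt_coeff n * (real n - 1/2) / (real n + 1)"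
proof -
  have "((1/2::real) gchoose Suc n) = ((1/2) gchoose n) * (1/2 - real n) / (real n + 1)"
    by (simp add: gbinomial_prod_rev field_simps)
  then have "sqrt_coeff (Suc n) = - (((1/2) gchoose n) * (1/2 - real n) / (real n + 1) * (-1) ^ n)"
    by (simp only: sqrt_coeff_def power_Suc mult_minus_left mult_minus_right mult_1)
  then show ?thesis by (simp add: sqrt_coeff_def algebra_simps diff_divide_distrib add_divide_distrib)
qed

text \<open>After the first ratio, which is -1/2, all ratios of consecutive coefficients are
  nonnegative. The fixed sign turns convergence at z = 1 into boundedness of monotone partial
  sums.\<close>

lemma sqrt_coeff_nonpos: "sqrt_coeff (Suc n) \<le> 0"
proof (induction n)
  case 0
  show ?case by (simp add: sqrt_coeff_Suc)
next
  case (Suc n)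
  have "sqrt_coeff (Suc n) * ((real (Suc n) - 1/2) / (real (Suc n) + 1)) \<le> 0"
    using Suc by (intro mult_nonpos_nonneg) auto
  then show ?case by (simp add: sqrt_coeff_Suc[of "Suc n"])
qed

lemma sqrt_coeff_sums: "0 \<le> z \<Longrightarrow> z < 1 \<Longrightarrow> (\<lambda>n. sqrt_coeff n * z ^ n) sums sqrt (1 - z)"
  using gen_binomial_real[of "- z" "1/2"] power_minus[of z]
  by (simp add: sqrt_coeff_def powr_half_sqrt mult.assoc)

lemma sqrt_coeff_tail_sums:
  assumes "0 \<le> z" "z < 1"
  shows "(\<lambda>n. - sqrt_coeff (Suc n) * z ^ Suc n) sums (1 - sqrt (1 - z))"
proof -
  have "(\<lambda>n. sqrt_coeff (Suc n) * z ^ Suc n) sums (sqrt (1 - z) - 1)"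
    using sqrt_coeff_sums[OF assms] by (subst sums_Suc_iff) simp
  from sums_minus[OF this] show ?thesis by simp
qed

text \<open>The boundary case z = 1, by letting z tend to 1 from the left: partial sums inherit the
  bound 1, and the full sum dominates 1 - sqrt (1 - z) for every z < 1. The boundary matters because
  1 - p / t may have norm exactly 1.\<close>

lemma sqrt_coeff_tail_sums_1: "(\<lambda>n. - sqrt_coeff (Suc n)) sums 1"
proof -
  let ?c = "\<lambda>n. - sqrt_coeff (Suc n)"
  have nonneg: "?c n \<ge> 0" for n using sqrt_coeff_nonpos[of n] by simp
  have partial: "(\<Sum>n<N. ?c n) \<le> 1" for N
  proof (rule tendsto_le[where F = "at_left (1::real)"])
    show "((\<lambda>z. \<Sum>n<N. ?c n * z ^ Suc n) \<longlongrightarrow> (\<Sum>n<N. ?c n)) (at_left 1)"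
    proof -
      have "((\<lambda>z. \<Sum>n<N. ?c n * z ^ Suc n) \<longlongrightarrow> (\<Sum>n<N. ?c n * 1 ^ Suc n)) (at_left 1)"
        by (intro tendsto_intros)
      then show ?thesis by simp
    qed
    show "\<forall>\<^sub>F z in at_left 1. (\<Sum>n<N. ?c n * z ^ Suc n) \<le> 1"
    proof (rule eventually_at_leftI[of 0])
      fix z :: real assume z: "z \<in> {0<..<1}"
      then have s: "(\<lambda>n. ?c n * z ^ Suc n) sums (1 - sqrt (1 - z))"
        by (intro sqrt_coeff_tail_sums) auto
      have "(\<Sum>n<N. ?c n * z ^ Suc n) \<le> (\<Sum>n. ?c n * z ^ Suc n)"
        using s z nonneg by (intro sum_le_suminf mult_nonneg_nonneg) (auto simp: sums_iff)
      also have "\<dots> \<le> 1" using s z by (simp add: sums_iff)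
      finally show "(\<Sum>n<N. ?c n * z ^ Suc n) \<le> 1" .
    qed simp
  qed auto
  have summ: "summable ?c"
    by (rule summableI_nonneg_bounded[OF nonneg partial])
  have "suminf ?c \<le> 1" using suminf_le_const[OF summ] partial by blast
  moreover have "1 \<le> suminf ?c"
  proof (rule tendsto_upperbound[where F = "at_left (1::real)"])
    have "((\<lambda>z. 1 - sqrt (1 - z)) \<longlongrightarrow> 1 - sqrt (1 - 1)) (at_left (1::real))"
      by (intro tendsto_intros)
    then show "((\<lambda>z. 1 - sqrt (1 - z)) \<longlongrightarrow> 1) (at_left (1::real))" by simp
    show "\<forall>\<^sub>F z in at_left 1. 1 - sqrt (1 - z) \<le> suminf ?c"
    proof (rule eventually_at_leftI[of 0])
      fix z :: real assume z: "z \<in> {0<..<1}"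
      then have s: "(\<lambda>n. ?c n * z ^ Suc n) sums (1 - sqrt (1 - z))"
        by (intro sqrt_coeff_tail_sums) auto
      have "?c n * z ^ Suc n \<le> ?c n" for n
        using nonneg[of n] z by (intro mult_left_le power_le_one) auto
      then show "1 - sqrt (1 - z) \<le> suminf ?c"
        using s summ by (intro sums_le[OF _ s summable_sums[OF summ]]) auto
    qed simp
  qed simp
  ultimately show ?thesis using summ by (simp add: sums_iff)
qed

lemma summable_norm_sqrt_coeff: "summable (\<lambda>n. \<bar>sqrt_coeff n\<bar>)"
proof -
  have "(\<lambda>n. \<bar>sqrt_coeff (Suc n)\<bar>) = (\<lambda>n. - sqrt_coeff (Suc n))"
    using sqrt_coeff_nonpos by auto
  then have "summable (\<lambda>n. \<bar>sqrt_coeff (Suc n)\<bar>)"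
    using sqrt_coeff_tail_sums_1 by (simp add: sums_iff)
  then show ?thesis using summable_Suc_iff[of "\<lambda>n. \<bar>sqrt_coeff n\<bar>"] by blast
qed

lemma sqrt_coeff_sums_0: "sqrt_coeff sums 0"
  using sums_minus[OF sqrt_coeff_tail_sums_1] by (simp add: sums_Suc_iff)

text \<open>Vandermonde's identity for 1/2 + 1/2 = 1: the square of the series is 1 - z.\<close>

lemma sqrt_coeff_convolution:
  "(\<Sum>i\<le>n. sqrt_coeff i * sqrt_coeff (n - i)) = (if n = 0 then 1 else if n = 1 then -1 else 0)"
proof -
  have "(\<Sum>i\<le>n. sqrt_coeff i * sqrt_coeff (n - i))
      = (\<Sum>i\<in>{0..n}. ((1/2) gchoose i) * ((1/2) gchoose (n - i)) * (-1) ^ n)"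
    unfolding sqrt_coeff_def atMost_atLeast0
    by (intro sum.cong refl) (simp add: mult.assoc mult.left_commute flip: power_add)
  also have "\<dots> = ((1/2 + 1/2) gchoose n) * (-1) ^ n"
    by (simp only: gbinomial_Vandermonde flip: sum_distrib_right)
  also have "\<dots> = (real (1 choose n)) * (-1) ^ n"
    by (simp add: binomial_gbinomial)
  finally show ?thesis by (auto simp: not_less_eq)
qed

section \<open>Square roots of 1 - x for x in the closed unit ball\<close>

class cstar_algebra_1 = cstar_algebra + monoid_mult
begin

lemma star_one [simp]: "star 1 = 1"
  by (metis mult_1_left mult_1_right star_mult star_star)

end

lemma norm_one_le: "norm (1 :: 'm::cstar_algebra_1) \<le> 1"
proof (rule ccontr)
  assume "\<not> ?thesis"
  then have "1 < norm (1::'m)" by linarith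
  then have "norm (1::'m) * 1 < norm (1::'m) * norm (1::'m)" by (intro mult_strict_left_mono) linarith+
  then have "norm (1::'m) < (norm (1::'m))\<^sup>2" by (simp add: power2_eq_square)
  moreover have "(norm (1::'m))\<^sup>2 = norm (1::'m)"
    using norm_star_mult_self[of "1::'m"] by simp
  ultimately show False by simp
qed

lemma hermitian_one: "hermitian (1 :: 'm::cstar_algebra_1)"
  by (simp add: hermitian_def)

lemma norm_power_le_one: "norm (x :: 'm::cstar_algebra_1) \<le> 1 \<Longrightarrow> norm (x ^ n) \<le> 1"
proof (induction n)
  case (Suc n)
  have "norm (x ^ Suc n) \<le> norm x * norm (x ^ n)" by (simp add: norm_mult_ineq)
  also have "\<dots> \<le> 1 * 1" using Suc by (intro mult_mono) auto
  finally show ?case by simp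
qed (simp add: norm_one_le)

definition sqrt_one_minus :: "'m::cstar_algebra_1 \<Rightarrow> 'm" where
  "sqrt_one_minus x = (\<Sum>n. sqrt_coeff n *\<^sub>R x ^ n)"

context
  fixes x :: "'m::cstar_algebra_1"
  assumes x: "norm x \<le> 1"
begin

lemma summable_norm_sqrt: "summable (\<lambda>n. norm (sqrt_coeff n *\<^sub>R x ^ n))"
  by (rule summable_comparison_test'[OF summable_norm_sqrt_coeff, of 0])
    (simp add: mult_left_le norm_power_le_one[OF x])

lemma sqrt_one_minus_sums: "(\<lambda>n. sqrt_coeff n *\<^sub>R x ^ n) sums sqrt_one_minus x"
  unfolding sqrt_one_minus_def by (rule summable_sums[OF summable_norm_cancel[OF summable_norm_sqrt]])

lemma sqrt_one_minus_square: "sqrt_one_minus x * sqrt_one_minus x = 1 - x"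
proof -
  have "(\<Sum>i\<le>n. (sqrt_coeff i *\<^sub>R x ^ i) * (sqrt_coeff (n - i) *\<^sub>R x ^ (n - i)))
      = (if n = 0 then 1 else if n = 1 then -1 else 0) *\<^sub>R x ^ n" for n
  proof -
    have "(\<Sum>i\<le>n. (sqrt_coeff i *\<^sub>R x ^ i) * (sqrt_coeff (n - i) *\<^sub>R x ^ (n - i)))
        = (\<Sum>i\<le>n. (sqrt_coeff i * sqrt_coeff (n - i)) *\<^sub>R x ^ n)"
      by (intro sum.cong refl) (simp flip: power_add)
    then show ?thesis by (simp only: sqrt_coeff_convolution flip: scaleR_left.sum)
  qed
  then have "(\<lambda>n. (if n = 0 then 1 else if n = 1 then -1 else 0) *\<^sub>R x ^ n)
      sums (sqrt_one_minus x * sqrt_one_minus x)"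
    using Cauchy_product_sums[OF summable_norm_sqrt summable_norm_sqrt]
    by (simp add: sqrt_one_minus_def)
  moreover have "(\<lambda>n. (if n = 0 then 1 else if n = 1 then -1 else 0) *\<^sub>R x ^ n) sums
      (\<Sum>n\<in>{0,1}. (if n = 0 then 1 else if n = 1 then -1 else 0) *\<^sub>R x ^ n)"
    by (rule sums_finite) auto
  ultimately show ?thesis by (auto dest: sums_unique2)
qed

text \<open>The numbers \<open>- sqrt_coeff (Suc n)\<close> are nonnegative weights with sum 1, so
  the triangle inequality suffices. This bound is what makes the root positive again in the sense of
  \<open>norm_pos\<close>.\<close>

lemma norm_one_minus_sqrt: "norm (1 - sqrt_one_minus x) \<le> 1"
proof -
  have s: "(\<lambda>n. (- sqrt_coeff (Suc n)) *\<^sub>R x ^ Suc n) sums (1 - sqrt_one_minus x)"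
    using sums_minus[OF sums_split_initial_segment[OF sqrt_one_minus_sums, of 1]] by simp
  have le: "norm ((- sqrt_coeff (Suc n)) *\<^sub>R x ^ Suc n) \<le> - sqrt_coeff (Suc n)" for n
  proof -
    have "norm ((- sqrt_coeff (Suc n)) *\<^sub>R x ^ Suc n) = - sqrt_coeff (Suc n) * norm (x ^ Suc n)"
      using sqrt_coeff_nonpos[of n] by simp
    also have "\<dots> \<le> - sqrt_coeff (Suc n)"
      using norm_power_le_one[OF x, of "Suc n"] sqrt_coeff_nonpos[of n] by (intro mult_left_le) auto
    finally show ?thesis .
  qed
  have "norm (1 - sqrt_one_minus x) = norm (\<Sum>n. (- sqrt_coeff (Suc n)) *\<^sub>R x ^ Suc n)"
    using s by (simp add: sums_iff)
  also have "\<dots> \<le> (\<Sum>n. - sqrt_coeff (Suc n))"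
    using le sqrt_coeff_tail_sums_1 by (intro norm_suminf_le) (auto simp: sums_iff)
  also have "\<dots> = 1" using sqrt_coeff_tail_sums_1 by (simp add: sums_iff)
  finally show ?thesis .
qed

lemma hermitian_sqrt_one_minus:
  assumes "hermitian x"
  shows "hermitian (sqrt_one_minus x)"
proof -
  have "hermitian (x ^ n)" for n
  proof (induction n)
    case (Suc n)
    then have "hermitian (x * x ^ n)" by (intro hermitian_mult assms) (simp_all add: power_commutes)
    then show ?case by simp
  qed (simp add: hermitian_one)
  then have *: "star (sqrt_coeff n *\<^sub>R x ^ n) = sqrt_coeff n *\<^sub>R x ^ n" for n
    by (simp add: hermitian_def star_scaleR)
  have "(\<lambda>n. sqrt_coeff n *\<^sub>R x ^ n) sums star (sqrt_one_minus x)"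
    using bounded_linear.sums[OF bounded_linear_star sqrt_one_minus_sums] by (simp only: *)
  then have "star (sqrt_one_minus x) = sqrt_one_minus x"
    by (rule sums_unique2[OF _ sqrt_one_minus_sums])
  then show ?thesis by (simp add: hermitian_def)
qed

text \<open>Since the coefficients sum up to 0, the constant term can be distributed over the series.\<close>

lemma sqrt_one_minus_in_closed:
  assumes "closed I" "0 \<in> I" "\<And>y z. y \<in> I \<Longrightarrow> z \<in> I \<Longrightarrow> y + z \<in> I"
    and "\<And>y r. y \<in> I \<Longrightarrow> r *\<^sub>R y \<in> I" and "\<And>n. x ^ n - 1 \<in> I"
  shows "sqrt_one_minus x \<in> I"
proof -
  have "(\<lambda>n. sqrt_coeff n *\<^sub>R (1::'m)) sums (0 *\<^sub>R 1)"
    by (rule bounded_linear.sums[OF bounded_linear_scaleR_left sqrt_coeff_sums_0])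
  from sums_diff[OF sqrt_one_minus_sums this]
  have "(\<lambda>N. \<Sum>n<N. sqrt_coeff n *\<^sub>R (x ^ n - 1)) \<longlonglongrightarrow> sqrt_one_minus x"
    by (simp add: sums_def scaleR_diff_right)
  moreover have "(\<Sum>n<N. sqrt_coeff n *\<^sub>R (x ^ n - 1)) \<in> I" for N
    by (induction N) (use assms in auto)
  ultimately show ?thesis
    by (rule closed_sequentially[OF assms(1), rotated])
qed

end

text \<open>Two elements x and z instead of one: with x = z this is commutation of roots, and with x
  \<noteq> z it carries the root of a function of \<open>star y * y\<close> to that of
  \<open>y * star y\<close> in \<open>norm_pos_swap_neg\<close>.\<close>

lemma sqrt_one_minus_intertwine:
  fixes x z :: "'m::cstar_algebra_1"
  assumes "norm x \<le> 1" "norm z \<le> 1" and comm: "x * y = y * z"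
  shows "sqrt_one_minus x * y = y * sqrt_one_minus z"
proof -
  have pow: "x ^ n * y = y * z ^ n" for n
  proof (induction n)
    case (Suc n)
    then show ?case by (metis power_Suc mult.assoc comm)
  qed simp
  have "(\<lambda>n. (sqrt_coeff n *\<^sub>R x ^ n) * y) sums (sqrt_one_minus x * y)"
    by (rule bounded_linear.sums[OF bounded_linear_mult_left sqrt_one_minus_sums[OF assms(1)]])
  moreover have "(\<lambda>n. y * (sqrt_coeff n *\<^sub>R z ^ n)) sums (y * sqrt_one_minus z)"
    by (rule bounded_linear.sums[OF bounded_linear_mult_right sqrt_one_minus_sums[OF assms(2)]])
  ultimately show ?thesis by (simp add: pow sums_unique2)
qed

text \<open>The norm characterization of positivity, which makes the cone properties evident.\<close>

definition norm_pos :: "'m::cstar_algebra_1 \<Rightarrow> bool" where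
  "norm_pos p \<longleftrightarrow> hermitian p \<and> (\<exists>t\<ge>0. norm (t *\<^sub>R 1 - p) \<le> t)"

text \<open>The root of p as sqrt t times the root of 1 - (1 - p / t). The scale t stays an explicit
  argument so that two elements can be given the same one, as intertwining requires.\<close>

definition sqrt_at :: "real \<Rightarrow> 'm::cstar_algebra_1 \<Rightarrow> 'm" where
  "sqrt_at t p = sqrt t *\<^sub>R sqrt_one_minus (1 - (1 / t) *\<^sub>R p)"

lemma norm_one_minus_scale:
  assumes "t > 0" "norm (t *\<^sub>R 1 - (p :: 'm::cstar_algebra_1)) \<le> t"
  shows "norm (1 - (1 / t) *\<^sub>R p) \<le> 1"
proof -
  have "1 - (1 / t) *\<^sub>R p = (1 / t) *\<^sub>R (t *\<^sub>R 1 - p)"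
    using assms(1) by (simp add: scaleR_diff_right)
  then have "norm (1 - (1 / t) *\<^sub>R p) = (1 / t) * norm (t *\<^sub>R 1 - p)"
    using assms(1) by simp
  also have "\<dots> \<le> (1 / t) * t" using assms by (intro mult_left_mono) auto
  finally show ?thesis using assms(1) by simp
qed

lemma sqrt_at_square:
  assumes "t > 0" "norm (t *\<^sub>R 1 - p) \<le> t"
  shows "sqrt_at t p * sqrt_at t p = (p :: 'm::cstar_algebra_1)"
  using assms sqrt_one_minus_square[OF norm_one_minus_scale[OF assms]]
  by (simp add: sqrt_at_def)

lemma norm_pos_sqrt_at:
  assumes "t > 0" "norm (t *\<^sub>R 1 - p) \<le> t" "hermitian (p :: 'm::cstar_algebra_1)"
  shows "norm_pos (sqrt_at t p)"
proof -
  have le: "norm (1 - (1 / t) *\<^sub>R p) \<le> 1" by (rule norm_one_minus_scale) fact+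
  have "hermitian (sqrt_at t p)"
    unfolding sqrt_at_def
    by (intro hermitian_scaleR hermitian_sqrt_one_minus le hermitian_diff hermitian_one assms(3))
  moreover have "norm (sqrt t *\<^sub>R 1 - sqrt_at t p) = sqrt t * norm (1 - sqrt_one_minus (1 - (1 / t) *\<^sub>R p))"
    unfolding sqrt_at_def using assms(1) by (simp flip: scaleR_diff_right)
  then have "norm (sqrt t *\<^sub>R 1 - sqrt_at t p) \<le> sqrt t"
    using norm_one_minus_sqrt[OF le] assms(1) by (simp add: mult_left_le)
  moreover have "sqrt t \<ge> 0" using assms(1) by simp
  ultimately show ?thesis unfolding norm_pos_def by blast
qed

lemma sqrt_at_intertwine:
  assumes "t > 0" "norm (t *\<^sub>R 1 - p) \<le> t" "norm (t *\<^sub>R 1 - q) \<le> t"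
    and "p * y = y * (q :: 'm::cstar_algebra_1)"
  shows "sqrt_at t p * y = y * sqrt_at t q"
proof -
  have "sqrt_one_minus (1 - (1 / t) *\<^sub>R p) * y = y * sqrt_one_minus (1 - (1 / t) *\<^sub>R q)"
    using assms by (intro sqrt_one_minus_intertwine norm_one_minus_scale)
      (auto simp: left_diff_distrib right_diff_distrib)
  then show ?thesis by (simp add: sqrt_at_def)
qed

text \<open>The element \<open>s + \<i> w\<close> is unitary.\<close>

lemma norm_le_one_of_unit_circle:
  fixes s w :: "'m::cstar_algebra_1"
  assumes "hermitian s" "hermitian w" "s * w = w * s" "s * s + w * w = 1"
  shows "norm w \<le> 1"
proof -
  define U where "U = s + scaleC \<i> w"
  have U: "star U = s - scaleC \<i> w"
    using assms by (simp add: U_def hermitian_def star_add star_scaleC scaleC_minus_left)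
  have "star U * U = s * s + w * w"
    using assms(3) unfolding U unfolding U_def
    by (simp add: algebra_simps mult_scaleC_left mult_scaleC_right scaleC_add_right scaleC_diff_right
        scaleC_scaleC scaleC_minus1)
  then have "(norm U)\<^sup>2 = norm (1::'m)"
    using norm_star_mult_self[of U] assms(4) by simp
  then have "(norm U)\<^sup>2 \<le> 1\<^sup>2" using norm_one_le[where 'm = 'm] by simp
  then have "norm U \<le> 1" by (rule power2_le_imp_le) simp
  have "2 *\<^sub>R scaleC \<i> w = U - star U"
    unfolding U by (simp add: U_def scaleR_2)
  then have "2 * norm w = norm (U - star U)"
    by (metis norm_scaleC norm_scaleR norm_ii mult_1 abs_numeral)
  also have "\<dots> \<le> 2" using norm_triangle_ineq4[of U "star U"] \<open>norm U \<le> 1\<close> by simp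
  finally show ?thesis by simp
qed

text \<open>The element 1 - s s is the square of its root w, and s + i w is unitary, which bounds w
  by 1.\<close>

lemma norm_one_minus_square:
  fixes s :: "'m::cstar_algebra_1"
  assumes s: "hermitian s" "norm s \<le> 1"
  shows "norm (1 - s * s) \<le> 1"
proof -
  have "norm (s * s) \<le> 1"
    using norm_power_le_one[OF s(2), of 2] by (simp add: power2_eq_square)
  define w where "w = sqrt_one_minus (s * s)"
  have h: "hermitian (s * s)" using s(1) by (simp add: hermitian_mult)
  have w: "hermitian w" "w * w = 1 - s * s" "s * w = w * s"
    unfolding w_def using \<open>norm (s * s) \<le> 1\<close>
    by (simp_all add: hermitian_sqrt_one_minus sqrt_one_minus_square h)
      (rule sqrt_one_minus_intertwine[symmetric], simp_all add: mult.assoc)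
  have "norm w \<le> 1" using s(1) w by (intro norm_le_one_of_unit_circle[of s]) auto
  then have "norm w * norm w \<le> 1 * 1" by (intro mult_mono) auto
  then show ?thesis using norm_mult_ineq[of w w] w(2) by simp
qed

lemma hermitian_norm_square: "hermitian s \<Longrightarrow> norm (s * s) = (norm (s :: 'c::cstar_algebra))\<^sup>2"
  using norm_star_mult_self[of s] by (simp add: hermitian_def)

lemma norm_scale_minus_square:
  fixes s :: "'m::cstar_algebra_1"
  assumes s: "hermitian s" "norm (s * s) \<le> t"
  shows "norm (t *\<^sub>R 1 - s * s) \<le> t"
proof (cases "t = 0")
  case True
  then show ?thesis using s by simp
next
  case False
  moreover have "0 \<le> t" using s(2) norm_ge_zero order_trans by blast
  ultimately have t: "t > 0" by simp
  define r where "r = (1 / sqrt t) *\<^sub>R s"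
  have "(norm s)\<^sup>2 \<le> (sqrt t)\<^sup>2" using s t by (simp add: hermitian_norm_square)
  then have "norm s \<le> sqrt t" by (rule power2_le_imp_le) (use t in simp)
  then have "norm (1 - r * r) \<le> 1"
    using s(1) t unfolding r_def by (intro norm_one_minus_square hermitian_scaleR) auto
  moreover have "t *\<^sub>R 1 - s * s = t *\<^sub>R (1 - r * r)"
    using t by (simp add: r_def scaleR_diff_right)
  ultimately show ?thesis using t by (simp add: mult_left_le)
qed

section \<open>The cone of norm-positive elements and its square roots\<close>

lemma norm_pos_square: "hermitian s \<Longrightarrow> norm_pos (s * s)"
  unfolding norm_pos_def
  by (intro conjI hermitian_mult exI[of _ "norm (s * s)"] norm_scale_minus_square) auto

lemma norm_pos_hermitian: "norm_pos p \<Longrightarrow> hermitian p"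
  by (simp add: norm_pos_def)

lemma norm_pos_E:
  assumes "norm_pos p"
  obtains t where "t > 0" "norm (t *\<^sub>R 1 - p) \<le> t"
proof -
  obtain t where t: "t \<ge> 0" "norm (t *\<^sub>R 1 - p) \<le> t" using assms by (auto simp: norm_pos_def)
  have "norm ((t + 1) *\<^sub>R 1 - p) \<le> norm (t *\<^sub>R 1 - p) + norm (1::'a)"
    using norm_triangle_ineq[of "t *\<^sub>R 1 - p" 1] by (simp add: algebra_simps)
  also have "\<dots> \<le> t + 1" using t norm_one_le[where 'm = 'a] by linarith
  finally show thesis using t that[of "t + 1"] by simp
qed

lemma norm_pos_sqrt:
  assumes "norm_pos (p :: 'm::cstar_algebra_1)"
  obtains s where "norm_pos s" "s * s = p" "\<And>y. p * y = y * p \<Longrightarrow> s * y = y * s"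
proof -
  obtain t where t: "t > 0" "norm (t *\<^sub>R 1 - p) \<le> t" by (rule norm_pos_E[OF assms])
  show thesis
  proof (rule that)
    show "norm_pos (sqrt_at t p)" by (rule norm_pos_sqrt_at[OF t norm_pos_hermitian[OF assms]])
    show "sqrt_at t p * sqrt_at t p = p" by (rule sqrt_at_square[OF t])
    show "sqrt_at t p * y = y * sqrt_at t p" if "p * y = y * p" for y
      by (rule sqrt_at_intertwine[OF t t(2) that])
  qed
qed

text \<open>As p is a square, the witness t in \<open>norm_pos\<close> may be any bound of the norm
  of p. This uniform choice is behind \<open>closed_norm_pos\<close> and
  \<open>norm_pos_antisym\<close>.\<close>

lemma norm_pos_norm:
  assumes "norm_pos p" "norm p \<le> t"
  shows "norm (t *\<^sub>R 1 - p) \<le> t"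
  using assms by (metis norm_pos_sqrt norm_pos_hermitian norm_scale_minus_square)

lemma norm_pos_add:
  assumes "norm_pos p" "norm_pos q"
  shows "norm_pos (p + q)"
proof -
  obtain t where t: "t > 0" "norm (t *\<^sub>R 1 - p) \<le> t" by (rule norm_pos_E[OF assms(1)])
  obtain s where s: "s > 0" "norm (s *\<^sub>R 1 - q) \<le> s" by (rule norm_pos_E[OF assms(2)])
  have "norm ((t + s) *\<^sub>R 1 - (p + q)) \<le> t + s"
    using norm_triangle_ineq[of "t *\<^sub>R 1 - p" "s *\<^sub>R 1 - q"] t s by (simp add: algebra_simps)
  then show ?thesis unfolding norm_pos_def
    using assms t s by (intro conjI exI[of _ "t + s"] hermitian_add norm_pos_hermitian) auto
qed

lemma norm_pos_0: "norm_pos 0"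
  unfolding norm_pos_def by (auto intro: exI[of _ 0] simp: hermitian_zero)

lemma norm_pos_one_scale: "t \<ge> 0 \<Longrightarrow> norm_pos (t *\<^sub>R 1)"
  unfolding norm_pos_def by (auto intro: exI[of _ t] simp: hermitian_scaleR hermitian_one)

lemma norm_pos_scaleR:
  assumes "norm_pos p" "r \<ge> 0"
  shows "norm_pos (r *\<^sub>R p)"
proof -
  obtain s where s: "norm_pos s" "s * s = p" using norm_pos_sqrt[OF assms(1)] by metis
  have "norm_pos ((sqrt r *\<^sub>R s) * (sqrt r *\<^sub>R s))"
    using s by (intro norm_pos_square hermitian_scaleR norm_pos_hermitian)
  then show ?thesis using s assms(2) by simp
qed

text \<open>A root of p commutes with whatever commutes with p. So the roots s of p and r of q
  commute, and p q is the square of the hermitian element s r.\<close>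

lemma norm_pos_commuting_mult:
  assumes "norm_pos p" "norm_pos q" "p * q = q * p"
  shows "norm_pos (p * q)"
proof -
  obtain s where s: "norm_pos s" "s * s = p" and sc: "\<And>y. p * y = y * p \<Longrightarrow> s * y = y * s"
    using norm_pos_sqrt[OF assms(1)] by metis
  have sq: "q * s = s * q" using sc assms(3) by simp
  obtain r where r: "norm_pos r" "r * r = q" and rc: "\<And>y. q * y = y * q \<Longrightarrow> r * y = y * r"
    using norm_pos_sqrt[OF assms(2)] by metis
  have rs: "r * s = s * r" by (rule rc[OF sq])
  have "(s * r) * (s * r) = p * q"
    unfolding s(2)[symmetric] r(2)[symmetric] by (metis mult.assoc rs)
  moreover have "hermitian (s * r)" using s r rs by (simp add: hermitian_mult norm_pos_hermitian)
  ultimately show ?thesis using norm_pos_square by metis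
qed

lemma closed_norm_pos: "closed {p :: 'm::cstar_algebra_1. norm_pos p}"
proof (unfold closed_sequential_limits, intro allI impI, elim conjE)
  fix X and p :: 'm
  assume X: "\<forall>n. X n \<in> {p. norm_pos p}" and lim: "X \<longlonglongrightarrow> p"
  obtain t where t: "\<And>n. norm (X n) \<le> t"
    using Bseq_def convergent_imp_Bseq lim unfolding convergent_def by metis
  have "norm (t *\<^sub>R 1 - p) \<le> t"
  proof (rule tendsto_upperbound)
    show "(\<lambda>n. norm (t *\<^sub>R 1 - X n)) \<longlonglongrightarrow> norm (t *\<^sub>R 1 - p)"
      by (intro tendsto_intros lim)
    show "\<forall>\<^sub>F n in sequentially. norm (t *\<^sub>R 1 - X n) \<le> t"
      using X t by (intro always_eventually allI norm_pos_norm) auto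
  qed simp
  moreover have "hermitian p"
    using closed_sequentially[OF closed_hermitian, of X p] X lim by (auto simp: norm_pos_hermitian)
  moreover have "t \<ge> 0" using t[of 0] norm_ge_zero order_trans by blast
  ultimately show "p \<in> {p. norm_pos p}" by (auto simp: norm_pos_def)
qed

text \<open>With t the norm of p, both t + p and t - p have norm at most t. Then 4 t p, the
  difference of their squares, has norm at most 2 t t, whereas it equals 4 t t.\<close>

lemma norm_pos_antisym:
  assumes "norm_pos p" "norm_pos (- p)"
  shows "p = 0"
proof (rule ccontr)
  assume "p \<noteq> 0"
  define t where "t = norm p"
  have t: "t > 0" using \<open>p \<noteq> 0\<close> by (simp add: t_def)
  have 1: "norm (t *\<^sub>R 1 - p) \<le> t" "norm (t *\<^sub>R 1 + p) \<le> t"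
    using norm_pos_norm[OF assms(1), of t] norm_pos_norm[OF assms(2), of t] by (simp_all add: t_def)
  have "(4 * t) *\<^sub>R p = (t *\<^sub>R 1 + p) * (t *\<^sub>R 1 + p) - (t *\<^sub>R 1 - p) * (t *\<^sub>R 1 - p)"
    by (simp add: algebra_simps flip: scaleR_2 scaleR_add_left)
  then have "4 * t * t = norm ((t *\<^sub>R 1 + p) * (t *\<^sub>R 1 + p) - (t *\<^sub>R 1 - p) * (t *\<^sub>R 1 - p))"
    using t by (metis abs_of_pos mult_pos_pos norm_scaleR t_def zero_less_numeral)
  also have "\<dots> \<le> norm (t *\<^sub>R 1 + p) * norm (t *\<^sub>R 1 + p) + norm (t *\<^sub>R 1 - p) * norm (t *\<^sub>R 1 - p)"
    by (rule order_trans[OF norm_triangle_ineq4]) (intro add_mono norm_mult_ineq)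
  also have "\<dots> \<le> t * t + t * t" using 1 t by (intro add_mono mult_mono) auto
  finally show False using t by (simp add: not_le)
qed

text \<open>Both roots are compared with a third one, y, which commutes with everything that
  commutes with the common square. For a root z and d = z - y, the positive elements z d d and y d d
  have sum 0, so both vanish, and so does their difference d d d.\<close>

lemma norm_pos_sqrt_unique:
  assumes r: "norm_pos r" and s: "norm_pos s" and eq: "r * r = s * s"
  shows "r = s"
proof -
  have unique: "z = y" if z: "norm_pos z" and y: "norm_pos y" "y * y = z * z"
    and comm: "\<And>x. (z * z) * x = x * (z * z) \<Longrightarrow> y * x = x * y" for z y :: 'a
  proof -
    have yz: "y * z = z * y" using comm[of z] by (simp add: mult.assoc)
    define d where "d = z - y"
    have hd: "hermitian d" using z y by (simp add: d_def hermitian_diff norm_pos_hermitian)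
    have dz: "d * z = z * d" and dy: "d * y = y * d" by (simp_all add: d_def algebra_simps yz)
    have pz: "norm_pos (z * (d * d))" and py: "norm_pos (y * (d * d))"
      using z y dz dy hd
      by (auto intro!: norm_pos_commuting_mult norm_pos_square) (metis mult.assoc)+
    have "(z + y) * d = 0" using y(2) by (simp add: d_def algebra_simps yz)
    then have sum0: "z * (d * d) + y * (d * d) = 0" by (metis distrib_right mult.assoc mult_zero_left)
    have "z * (d * d) = 0"
      using norm_pos_antisym[OF pz] py sum0 by (metis minus_unique)
    with sum0 have "y * (d * d) = 0" by simp
    with \<open>z * (d * d) = 0\<close> have "d * (d * d) = 0" by (simp add: d_def left_diff_distrib)
    then have "(d * d) * (d * d) = 0" by (simp add: mult.assoc)
    then have "d * d = 0" by (rule hermitian_square_eq_0[OF hermitian_mult[OF hd hd refl]])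
    then have "d = 0" by (rule hermitian_square_eq_0[OF hd])
    then show ?thesis by (simp add: d_def)
  qed
  obtain y where y: "norm_pos y" "y * y = r * r" "\<And>x. (r * r) * x = x * (r * r) \<Longrightarrow> y * x = x * y"
    using norm_pos_sqrt[OF norm_pos_square[OF norm_pos_hermitian[OF r]]] by metis
  have "r = y" by (rule unique[OF r y])
  moreover have "s = y" by (rule unique[OF s y[unfolded eq]])
  ultimately show ?thesis by simp
qed

text \<open>If \<open>y\<^sup>* y \<le> 0\<close>, then \<open>\<bar>y y\<^sup>*\<bar> y = y \<bar>y\<^sup>* y\<bar> = - y y\<^sup>* y\<close>.\<close>

lemma norm_pos_swap_neg:
  fixes y :: "'m::cstar_algebra_1"
  assumes "norm_pos (- (star y * y))"
  shows "norm_pos (- (y * star y))"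
proof -
  define h where "h = star y * y"
  define k where "k = y * star y"
  \<comment> \<open>One common scale for \<open>h * h\<close> and \<open>k * k\<close>, as
    \<open>sqrt_at_intertwine\<close> demands; the 1 keeps it positive.\<close>
  define t where "t = max 1 (max (norm (h * h)) (norm (k * k)))"
  have hk: "hermitian h" "hermitian k"
    using hermitian_star_mult[of y] hermitian_star_mult[of "star y"] by (simp_all add: h_def k_def star_star)
  have t: "t > 0" "norm (h * h) \<le> t" "norm (k * k) \<le> t" by (simp_all add: t_def less_max_iff_disj le_max_iff_disj)
  have th: "norm (t *\<^sub>R 1 - h * h) \<le> t" and tk: "norm (t *\<^sub>R 1 - k * k) \<le> t"
    by (rule norm_scale_minus_square[OF hk(1) t(2)], rule norm_scale_minus_square[OF hk(2) t(3)])
  define a where "a = sqrt_at t (k * k)"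
  have a: "norm_pos a" "a * a = k * k"
    unfolding a_def
    by (rule norm_pos_sqrt_at[OF t(1) tk hermitian_mult[OF hk(2) hk(2) refl]],
        rule sqrt_at_square[OF t(1) tk])
  have ak: "a * k = k * a"
    unfolding a_def by (rule sqrt_at_intertwine[OF t(1) tk tk]) (simp add: mult.assoc)
  have "sqrt_at t (h * h) = - h"
  proof (rule norm_pos_sqrt_unique)
    show "norm_pos (sqrt_at t (h * h))"
      by (rule norm_pos_sqrt_at[OF t(1) th hermitian_mult[OF hk(1) hk(1) refl]])
    show "norm_pos (- h)" using assms by (simp add: h_def)
    show "sqrt_at t (h * h) * sqrt_at t (h * h) = - h * - h"
      using sqrt_at_square[OF t(1) th] by simp
  qed
  moreover have "a * y = y * sqrt_at t (h * h)"
    unfolding a_def by (rule sqrt_at_intertwine[OF t(1) tk th]) (simp add: h_def k_def mult.assoc)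
  ultimately have "(a + k) * y = 0"
    by (simp add: distrib_right h_def k_def mult.assoc)
  then have "(a + k) * k = 0" by (simp add: k_def flip: mult.assoc)
  \<comment> \<open>Since a a = k k and a commutes with k, the square of a + k is twice (a + k)
    k.\<close>
  then have "(a + k) * (a + k) = 0"
    using a(2) ak by (simp add: algebra_simps)
  then have "a + k = 0"
    by (rule hermitian_square_eq_0[OF hermitian_add[OF norm_pos_hermitian[OF a(1)] hk(2)]])
  then have "- (y * star y) = a" by (simp add: k_def minus_unique add.commute)
  then show ?thesis using a(1) by simp
qed

text \<open>The sum of \<open>star y * y\<close> and \<open>y * star y\<close> is twice the sum of
  the squares of the real and imaginary parts, hence positive. The second summand is negative by
  \<open>norm_pos_swap_neg\<close>, so the first is positive as well as negative.\<close>

lemma norm_pos_star_mult_nonpos: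
  fixes y :: "'m::cstar_algebra_1"
  assumes neg: "norm_pos (- (star y * y))"
  shows "y = 0"
proof -
  define a where "a = re_part y"
  define b where "b = im_part y"
  have ab: "hermitian a" "hermitian b" by (simp_all add: a_def b_def hermitian_re_part hermitian_im_part)
  have y: "y = a + scaleC \<i> b" unfolding a_def b_def by (rule re_im_decomp)
  have sy: "star y = a - scaleC \<i> b"
    using ab by (simp add: y hermitian_def star_add star_scaleC scaleC_minus_left)
  have "star y * y + y * star y = 2 *\<^sub>R (a * a + b * b)"
    unfolding sy unfolding y
    by (simp add: algebra_simps mult_scaleC_left mult_scaleC_right scaleC_scaleC scaleC_minus1 scaleR_2
        scaleC_add_right scaleC_diff_right)
  moreover have "norm_pos (2 *\<^sub>R (a * a + b * b))"
    by (intro norm_pos_scaleR norm_pos_add norm_pos_square ab) simp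
  ultimately have "norm_pos ((star y * y + y * star y) + - (y * star y))"
    using norm_pos_swap_neg[OF neg] norm_pos_add by metis
  then have "norm_pos (star y * y)" by simp
  then have "star y * y = 0" using neg norm_pos_antisym by blast
  then show ?thesis by simp
qed

text \<open>With a the root of h h, that is, the absolute value of h, the parts are half of a + h
  and of a - h. The last clause gives p explicitly for every admissible scale t; from it
  \<open>hermitian_eq_diff_squares\<close> reads off that p stays in C when h comes from C.\<close>

lemma norm_pos_parts:
  assumes "hermitian (h :: 'm::cstar_algebra_1)"
  obtains p n where "norm_pos p" "norm_pos n" "h = p - n" "p * n = 0" "n * p = 0"
    "\<And>t. t > 0 \<Longrightarrow> norm (h * h) \<le> t \<Longrightarrow> p = (1/2) *\<^sub>R (sqrt_at t (h * h) + h)"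
proof -
  define a where "a = sqrt_at (max 1 (norm (h * h))) (h * h)"
  have *: "norm_pos (sqrt_at t (h * h))" "sqrt_at t (h * h) * sqrt_at t (h * h) = h * h"
    "sqrt_at t (h * h) * h = h * sqrt_at t (h * h)"
    if "t > 0" "norm (h * h) \<le> t" for t
    using norm_scale_minus_square[OF assms that(2)] assms that
    by (auto intro!: norm_pos_sqrt_at sqrt_at_square sqrt_at_intertwine hermitian_mult simp: mult.assoc)
  have a: "norm_pos a" "a * a = h * h" "a * h = h * a"
    unfolding a_def by (intro *; simp)+
  have t_indep: "a = sqrt_at t (h * h)" if "t > 0" "norm (h * h) \<le> t" for t
    using norm_pos_sqrt_unique[OF a(1) *(1)[OF that]] a(2) *(2)[OF that] by simp
  define p where "p = (1/2) *\<^sub>R (a + h)"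
  define n where "n = (1/2) *\<^sub>R (a - h)"
  have ha: "hermitian a" using a(1) by (rule norm_pos_hermitian)
  have pn: "p * n = 0" "n * p = 0" unfolding p_def n_def by (simp_all add: algebra_simps a)
  have h: "h = p - n" by (simp add: p_def n_def scaleR_diff_right scaleR_add_right flip: scaleR_left.add)
  have apn: "a = p + n" by (simp add: p_def n_def scaleR_diff_right scaleR_add_right flip: scaleR_left.add)
  have "hermitian p" "hermitian n"
    unfolding p_def n_def by (intro hermitian_scaleR hermitian_add hermitian_diff ha assms)+
  text \<open>The square roots \<open>s\<close> of \<open>p\<^sup>2\<close> and \<open>q\<close> of \<open>n\<^sup>2\<close> coincide with \<open>p\<close> and \<open>n\<close>, as \<open>s + q = a = p + n\<close>.\<close>
  obtain s where s: "norm_pos s" "s * s = p * p" "\<And>y. (p * p) * y = y * (p * p) \<Longrightarrow> s * y = y * s"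
    using norm_pos_sqrt[OF norm_pos_square[OF \<open>hermitian p\<close>]] by metis
  obtain q where q: "norm_pos q" "q * q = n * n" "\<And>y. (n * n) * y = y * (n * n) \<Longrightarrow> q * y = y * q"
    using norm_pos_sqrt[OF norm_pos_square[OF \<open>hermitian n\<close>]] by metis
  have ppn: "(p * p) * n = 0" "n * (p * p) = 0" "(n * n) * p = 0" "p * (n * n) = 0"
    using pn by (simp_all add: mult.assoc) (simp_all add: pn flip: mult.assoc)
  have sn: "s * n = n * s" using s(3) ppn by simp
  have qs: "q * s = s * q" by (rule q(3)) (metis sn mult.assoc)
  have "(s * n) * (s * n) = 0"
    by (metis sn mult.assoc s(2) ppn(1) mult_zero_left mult_zero_right)
  then have "s * n = 0"
    using hermitian_square_eq_0 hermitian_mult s(1) \<open>hermitian n\<close> sn norm_pos_hermitian by metis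
  then have "(s * q) * (s * q) = 0"
    by (metis qs q(2) mult.assoc mult_zero_left mult_zero_right)
  then have sq0: "s * q = 0"
    using hermitian_square_eq_0 hermitian_mult s(1) q(1) qs norm_pos_hermitian by metis
  have "(s + q) * (s + q) = (p + n) * (p + n)"
    using sq0 qs s(2) q(2) pn by (simp add: algebra_simps)
  then have sq: "s + q = p + n"
    using norm_pos_sqrt_unique[OF norm_pos_add[OF s(1) q(1)] a(1)] by (simp add: apn)
  define d where "d = s - p"
  have d: "d = n - q" using sq by (simp add: d_def algebra_simps)
  have ps: "p * s = s * p" using s(3)[of p] by (simp add: mult.assoc)
  have qp: "q * p = p * q" using q(3) ppn by simp
  have "(p * q) * (p * q) = 0"
    by (metis qp q(2) mult.assoc ppn(4) mult_zero_left mult_zero_right)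
  then have pq0: "p * q = 0"
    using hermitian_square_eq_0 hermitian_mult q(1) \<open>hermitian p\<close> qp norm_pos_hermitian by metis
  \<comment> \<open>With one factor written as s - p and the other as n - q, all four products
    vanish.\<close>
  have "d * d = (s - p) * (n - q)" using d by (simp add: d_def)
  also have "\<dots> = 0" using \<open>s * n = 0\<close> sq0 pn pq0 by (simp add: algebra_simps)
  finally have "d = 0"
    using hermitian_square_eq_0 hermitian_diff s(1) \<open>hermitian p\<close> norm_pos_hermitian d_def by metis
  then have "norm_pos p" "norm_pos n" using s(1) q(1) d by (simp_all add: d_def)
  then show thesis using that[of p n] pn h t_indep unfolding p_def by metis
qed

text \<open>The negative part of \<open>h = y\<^sup>* y\<close> vanishes, since \<open>(y h\<^sub>-)\<^sup>* (y h\<^sub>-) = - h\<^sub>-\<^sup>3\<close>.\<close>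

lemma norm_pos_star_mult: "norm_pos (star y * (y :: 'm::cstar_algebra_1))"
proof -
  define h where "h = star y * y"
  obtain p n where pn: "norm_pos p" "norm_pos n" "h = p - n" "p * n = 0" "n * p = 0"
    using norm_pos_parts[OF hermitian_star_mult[of y]] h_def by metis
  have "star (y * n) * (y * n) = n * h * n"
    using norm_pos_hermitian[OF pn(2)] by (simp add: hermitian_def star_mult h_def mult.assoc)
  also have "\<dots> = - (n * (n * n))" unfolding pn(3) by (simp add: algebra_simps pn(4,5))
  finally have "norm_pos (- (star (y * n) * (y * n)))"
    using pn(2) by (auto intro!: norm_pos_commuting_mult norm_pos_square norm_pos_hermitian simp: mult.assoc)
  then have "y * n = 0" by (rule norm_pos_star_mult_nonpos)
  then have "h * n = 0" by (simp add: h_def mult.assoc)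
  then have "n * n = 0" using pn by (simp add: left_diff_distrib)
  then have "n = 0" by (rule hermitian_square_eq_0[OF norm_pos_hermitian[OF pn(2)]])
  then show ?thesis using pn(1,3) by (simp add: h_def)
qed

section \<open>Agreement of the two cones, and norm bounds from order bounds\<close>

lemma cstar_pos_iff_norm_pos: "(p :: 'm::cstar_algebra_1) \<in> cstar_pos \<longleftrightarrow> norm_pos p"
proof
  assume "norm_pos p"
  then obtain s where "norm_pos s" "s * s = p" by (metis norm_pos_sqrt)
  then have "p = star s * s" using norm_pos_hermitian[of s] by (simp add: hermitian_def)
  then show "p \<in> cstar_pos" by (auto simp: cstar_pos_def)
qed (auto simp: cstar_pos_def norm_pos_star_mult)

lemma cstar_posI: "star y * y \<in> cstar_pos"
  by (auto simp: cstar_pos_def)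

lemma cstar_pos_hermitian: "x \<in> cstar_pos \<Longrightarrow> hermitian x"
  by (auto simp: cstar_pos_def hermitian_star_mult)

lemma cstar_pos_square: "hermitian s \<Longrightarrow> s * s \<in> cstar_pos"
  using cstar_posI[of s] by (simp add: hermitian_def)

lemma cstar_pos_conj: "x \<in> cstar_pos \<Longrightarrow> star y * x * y \<in> cstar_pos"
proof -
  assume "x \<in> cstar_pos"
  then obtain z where "x = star z * z" by (auto simp: cstar_pos_def)
  then have "star y * x * y = star (z * y) * (z * y)" by (simp add: star_mult mult.assoc)
  then show ?thesis using cstar_posI by metis
qed

lemma cstar_pos_zero: "0 \<in> cstar_pos"
  using cstar_posI[of 0] by simp

lemma hermitian_cstar_pos_minus:
  fixes h :: "'m::cstar_algebra_1"
  assumes "hermitian h" "norm h \<le> t"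
  shows "t *\<^sub>R 1 - h \<in> cstar_pos"
proof -
  have "t \<ge> 0" using assms(2) norm_ge_zero order_trans by blast
  moreover have "norm (t *\<^sub>R 1 - (t *\<^sub>R 1 - h)) \<le> t" using assms by simp
  ultimately show ?thesis
    unfolding cstar_pos_iff_norm_pos norm_pos_def
    using assms(1) by (intro conjI exI[of _ t] hermitian_diff hermitian_scaleR hermitian_one) auto
qed

text \<open>For x = h / t the product (1 - x) (1 + x) is positive. With w its root, w + i x is
  unitary, so the norm of x is at most 1. For t = 0 both h and -h are positive, hence h = 0.\<close>

lemma norm_le_of_cstar_pos:
  fixes h :: "'m::cstar_algebra_1"
  assumes h: "hermitian h" and t: "t \<ge> 0"
    and bounds: "t *\<^sub>R 1 - h \<in> cstar_pos" "t *\<^sub>R 1 + h \<in> cstar_pos"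
  shows "norm h \<le> t"
proof (cases "t = 0")
  case True
  then show ?thesis using bounds norm_pos_antisym[of h] by (simp add: cstar_pos_iff_norm_pos)
next
  case False
  with t have t: "t > 0" by simp
  define x where "x = (1 / t) *\<^sub>R h"
  have hx: "hermitian x" unfolding x_def by (rule hermitian_scaleR[OF h])
  have "norm_pos ((1 / t) *\<^sub>R (t *\<^sub>R 1 - h))" "norm_pos ((1 / t) *\<^sub>R (t *\<^sub>R 1 + h))"
    using bounds t by (auto simp: cstar_pos_iff_norm_pos intro!: norm_pos_scaleR)
  then have "norm_pos (1 - x)" "norm_pos (1 + x)"
    using t by (simp_all add: x_def scaleR_diff_right scaleR_add_right)
  then have "norm_pos ((1 - x) * (1 + x))"
    by (rule norm_pos_commuting_mult) (simp add: algebra_simps)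
  then obtain w where w: "norm_pos w" "w * w = (1 - x) * (1 + x)"
    and comm: "\<And>y. (1 - x) * (1 + x) * y = y * ((1 - x) * (1 + x)) \<Longrightarrow> w * y = y * w"
    by (rule norm_pos_sqrt) blast
  have "w * x = x * w" by (rule comm) (simp add: algebra_simps)
  then have "norm x \<le> 1"
    using w hx by (intro norm_le_one_of_unit_circle[of w x]) (auto simp: norm_pos_hermitian algebra_simps)
  then show ?thesis using t by (simp add: x_def field_simps)
qed

section \<open>The multiplier algebra as a C*-algebra\<close>

lemma lmult_add: "lmult m (x + y) = lmult m x + lmult m y"
  and rmult_add: "rmult m (x + y) = rmult m x + rmult m y"
  by (transfer; simp add: is_multiplier_add)+

lemma lmult_scaleC: "lmult m (scaleC c x) = scaleC c (lmult m x)"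
  and rmult_scaleC: "rmult m (scaleC c x) = scaleC c (rmult m x)"
  by (transfer; simp add: is_multiplier_scaleC)+

lemma lmult_scaleR: "lmult m (r *\<^sub>R x) = r *\<^sub>R lmult m x"
  by (simp add: lmult_scaleC flip: scaleC_of_real)

lemma lmult_mult: "lmult m (x * y) = lmult m x * y"
  and rmult_mult: "rmult m (x * y) = x * rmult m y"
  and lmult_rmult: "x * lmult m y = rmult m x * y"
  by (transfer; simp add: is_multiplier_def)+

lemma lmult_simps [simp]:
  "lmult 0 x = 0" "lmult 1 x = x" "lmult (m + n) x = lmult m x + lmult n x"
  "lmult (m - n) x = lmult m x - lmult n x" "lmult (- m) x = - lmult m x"
  "lmult (m * n) x = lmult m (lmult n x)" "lmult (r *\<^sub>R m) x = r *\<^sub>R lmult m x"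
  "lmult (scaleC c m) x = scaleC c (lmult m x)" "lmult (star m) x = star (rmult m (star x))"
  "lmult (mult_emb a) x = a * x"
  by (transfer; simp)+

lemma rmult_simps [simp]:
  "rmult 0 x = 0" "rmult 1 x = x" "rmult (m + n) x = rmult m x + rmult n x"
  "rmult (m - n) x = rmult m x - rmult n x" "rmult (- m) x = - rmult m x"
  "rmult (m * n) x = rmult n (rmult m x)" "rmult (r *\<^sub>R m) x = r *\<^sub>R rmult m x"
  "rmult (scaleC c m) x = scaleC c (rmult m x)" "rmult (star m) x = star (lmult m (star x))"
  "rmult (mult_emb a) x = x * a"
  by (transfer; simp)+

lemma lmult_scaleR_fun: "lmult (r *\<^sub>R m) = (\<lambda>x. r *\<^sub>R lmult m x)"
  by (simp add: fun_eq_iff)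

lemma multiplier_eqI:
  assumes "\<And>x. lmult m x = lmult n x"
  shows "m = n"
proof -
  have "rmult m x = rmult n x" for x
    by (rule cstar_cancel_right) (simp add: assms flip: lmult_rmult)
  with assms show ?thesis
    by transfer (simp add: prod_eq_iff fun_eq_iff)
qed

text \<open>A uniform boundedness argument. For fixed x the map y \<mapsto> x (m y) is bounded,
  because it equals (m x) y with the right component of m. Baire makes the bound uniform for x in a
  ball, and a suitable x in it recovers the norm of m y.\<close>

lemma bounded_linear_lmult: "bounded_linear (lmult m)"
proof -
  define B where "B n = {x. \<forall>y. norm (x * lmult m y) \<le> real n * norm y}" for n
  have "closed (B n)" for n
    unfolding B_def by (intro closed_Collect_all closed_Collect_le continuous_intros)
  moreover have "(\<Union>n. B n) = UNIV"
  proof (intro equalityI subsetI UN_I)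
    fix x :: 'a
    have "norm (x * lmult m y) \<le> real (nat \<lceil>norm (rmult m x)\<rceil>) * norm y" for y
      unfolding lmult_rmult
      by (rule order_trans[OF norm_mult_ineq]) (intro mult_right_mono, linarith, simp)
    then show "x \<in> B (nat \<lceil>norm (rmult m x)\<rceil>)" by (simp add: B_def)
  qed auto
  ultimately obtain n x0 e where e: "e > 0" "ball x0 e \<subseteq> B n" by (rule Baire_ball)
  have "norm (lmult m y) \<le> norm y * (4 * real n / e)" for y
  proof (cases "lmult m y = 0")
    case True
    then show ?thesis using e by simp
  next
    case False
    \<comment> \<open>The adjoint of m y attains the norm of the product, by the C*-identity. The
      length e / 2 keeps x0 + x inside the ball, and the two bounds of size n at x0 and x0 + x then
      give 2 n / (e / 2) = 4 n / e.\<close>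
    define x where "x = (e / (2 * norm (lmult m y))) *\<^sub>R star (lmult m y)"
    have nx: "norm x = e / 2" using False e by (simp add: x_def)
    have "x0 \<in> B n" "x0 + x \<in> B n" using e nx by (auto simp: subset_eq dist_norm)
    then have "norm ((x0 + x) * lmult m y) \<le> real n * norm y" "norm (x0 * lmult m y) \<le> real n * norm y"
      by (auto simp: B_def)
    moreover have "x * lmult m y = (x0 + x) * lmult m y - x0 * lmult m y"
      by (simp add: algebra_simps)
    ultimately have "norm (x * lmult m y) \<le> 2 * real n * norm y"
      using norm_triangle_ineq4[of "(x0 + x) * lmult m y" "x0 * lmult m y"] by simp
    moreover have "norm (x * lmult m y) = e / 2 * norm (lmult m y)"
      using False e by (simp add: x_def norm_star_mult_self power2_eq_square)
    ultimately show ?thesis using e by (simp add: field_simps)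
  qed
  then show ?thesis
    by (rule bounded_linear_intro[OF lmult_add lmult_scaleR])
qed

lemma norm_lmult: "norm (lmult m x) \<le> norm_MC m * norm x"
  unfolding norm_MC_def by (rule onorm[OF bounded_linear_lmult])

lemma norm_MC_bound: "0 \<le> b \<Longrightarrow> (\<And>x. norm (lmult m x) \<le> b * norm x) \<Longrightarrow> norm_MC m \<le> b"
  unfolding norm_MC_def by (rule onorm_bound)

lemma norm_MC_nonneg: "norm_MC m \<ge> 0"
  unfolding norm_MC_def by (rule onorm_pos_le[OF bounded_linear_lmult])

instantiation multiplier :: (cstar_algebra) real_normed_vector
begin

definition norm_multiplier :: "'a multiplier \<Rightarrow> real" where
  "norm_multiplier = norm_MC"

definition dist_multiplier :: "'a multiplier \<Rightarrow> 'a multiplier \<Rightarrow> real" where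
  "dist_multiplier m n = norm (m - n)"

definition sgn_multiplier :: "'a multiplier \<Rightarrow> 'a multiplier" where
  "sgn_multiplier m = m /\<^sub>R norm m"

definition uniformity_multiplier :: "('a multiplier \<times> 'a multiplier) filter" where
  "uniformity_multiplier = (INF e\<in>{0 <..}. principal {(x, y). dist x y < e})"

definition open_multiplier :: "'a multiplier set \<Rightarrow> bool" where
  "open_multiplier U \<longleftrightarrow> (\<forall>x\<in>U. \<forall>\<^sub>F (x', y) in uniformity. x' = x \<longrightarrow> y \<in> U)"

instance
proof
  fix m n :: "'a multiplier" and r :: real
  show "norm m = 0 \<longleftrightarrow> m = 0"
  proof
    assume "norm m = 0"
    then have "norm (lmult m x) \<le> 0" for x
      using norm_lmult[of m x] by (simp add: norm_multiplier_def)
    then show "m = 0" by (intro multiplier_eqI) simp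
  next
    assume "m = 0"
    then show "norm m = 0"
      using norm_MC_bound[of 0 m] norm_MC_nonneg[of m] by (simp add: norm_multiplier_def)
  qed
  show "norm (m + n) \<le> norm m + norm n"
    unfolding norm_multiplier_def
  proof (rule norm_MC_bound)
    fix x
    have "norm (lmult (m + n) x) \<le> norm (lmult m x) + norm (lmult n x)" by (simp add: norm_triangle_ineq)
    also have "\<dots> \<le> (norm_MC m + norm_MC n) * norm x"
      using norm_lmult[of m x] norm_lmult[of n x] by (simp add: algebra_simps)
    finally show "norm (lmult (m + n) x) \<le> (norm_MC m + norm_MC n) * norm x" .
  qed (simp add: norm_MC_nonneg)
  show "norm (r *\<^sub>R m) = \<bar>r\<bar> * norm m"
    using onorm_scaleR[OF bounded_linear_lmult[of m], of r]
    by (simp add: norm_multiplier_def norm_MC_def lmult_scaleR_fun)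
qed (simp_all add: dist_multiplier_def sgn_multiplier_def uniformity_multiplier_def open_multiplier_def)

end

lemma norm_lmult_le: "norm (lmult m x) \<le> norm m * norm x"
  unfolding norm_multiplier_def by (rule norm_lmult)

lemma norm_multiplier_bound: "0 \<le> b \<Longrightarrow> (\<And>x. norm (lmult m x) \<le> b * norm x) \<Longrightarrow> norm m \<le> b"
  unfolding norm_multiplier_def by (rule norm_MC_bound)

lemma norm_multiplier_mult: "norm (m * n) \<le> norm m * norm (n :: 'c::cstar_algebra multiplier)"
proof (rule norm_multiplier_bound)
  fix x
  have "norm (lmult (m * n) x) \<le> norm m * norm (lmult n x)" by (simp add: norm_lmult_le)
  also have "\<dots> \<le> norm m * (norm n * norm x)" by (intro mult_left_mono norm_lmult_le) simp
  finally show "norm (lmult (m * n) x) \<le> norm m * norm n * norm x" by (simp add: mult.assoc)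
qed simp

lemma star_star_multiplier: "star (star m) = (m :: 'c::cstar_algebra multiplier)"
  by (rule multiplier_eqI) (simp add: star_star)

text \<open>The norm of k x squared is the norm of \<open>star x * lmult (star k * k) x\<close>,
  which gives one inequality. It also yields that star is isometric, after cancelling a factor
  \<open>norm k\<close>, and submultiplicativity then gives the other inequality.\<close>

lemma norm_multiplier_star_mult: "norm (star m * m) = (norm (m :: 'c::cstar_algebra multiplier))\<^sup>2"
proof -
  have le: "norm k * norm k \<le> norm (star k * k)" for k :: "'c multiplier"
  proof -
    have "norm k \<le> sqrt (norm (star k * k))"
    proof (rule norm_multiplier_bound)
      fix x
      have "(norm (lmult k x))\<^sup>2 = norm (star (lmult k x) * lmult k x)" by (simp add: norm_star_mult_self)
      also have "star (lmult k x) * lmult k x = star x * lmult (star k * k) x"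
        unfolding lmult_simps(6) lmult_rmult[of "star x"] by (simp add: star_star)
      also have "norm \<dots> \<le> norm x * norm (lmult (star k * k) x)"
        by (rule order_trans[OF norm_mult_ineq]) simp
      also have "\<dots> \<le> norm x * (norm (star k * k) * norm x)"
        by (intro mult_left_mono norm_lmult_le) simp
      also have "\<dots> = (sqrt (norm (star k * k)) * norm x)\<^sup>2"
        by (simp add: power2_eq_square mult_ac)
      finally show "norm (lmult k x) \<le> sqrt (norm (star k * k)) * norm x"
        by (rule power2_le_imp_le) simp
    qed simp
    then have "norm k * norm k \<le> sqrt (norm (star k * k)) * sqrt (norm (star k * k))"
      by (intro mult_mono) auto
    then show ?thesis by simp
  qed
  have star_le: "norm k \<le> norm (star k)" for k :: "'c multiplier"
  proof (cases "k = 0")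
    case False
    have "norm k * norm k \<le> norm (star k) * norm k"
      using le[of k] norm_multiplier_mult[of "star k" k] by linarith
    then show ?thesis using False by simp
  qed simp
  have "norm (star m) = norm m"
    using star_le[of m] star_le[of "star m"] by (simp add: star_star_multiplier)
  then show ?thesis
    using le[of m] norm_multiplier_mult[of "star m" m] by (simp add: power2_eq_square)
qed

text \<open>Multiplying by the adjoint of the value moves the multiplier to its left component,
  whose operator norm defines the norm. Completeness of M(C) needs the limits of both
  components.\<close>

lemma norm_rmult_le: "norm (rmult m x) \<le> norm m * norm (x :: 'c::cstar_algebra)"
proof (cases "rmult m x = 0")
    case False
    have "norm (rmult m x) * norm (rmult m x) = norm (rmult m x * star (rmult m x))"
      by (simp add: norm_mult_star power2_eq_square)
    also have "\<dots> = norm (x * lmult m (star (rmult m x)))" by (simp add: lmult_rmult)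
    also have "\<dots> \<le> norm x * norm (lmult m (star (rmult m x)))" by (rule norm_mult_ineq)
    also have "\<dots> \<le> norm x * (norm m * norm (star (rmult m x)))"
      by (intro mult_left_mono norm_lmult_le) simp
    finally show ?thesis using False by (simp add: mult_ac)
qed simp

lemma Cauchy_lmult: "Cauchy X \<Longrightarrow> Cauchy (\<lambda>n. lmult (X n) x)"
  and Cauchy_rmult: "Cauchy X \<Longrightarrow> Cauchy (\<lambda>n. rmult (X n) (x :: 'c::cstar_algebra))"
proof -
  have "bounded_linear (\<lambda>m. lmult m x)"
    by (rule bounded_linear_intro[where K = "norm x"]) (simp_all add: norm_lmult_le)
  then show "Cauchy X \<Longrightarrow> Cauchy (\<lambda>n. lmult (X n) x)" by (rule bounded_linear.Cauchy)
  have "bounded_linear (\<lambda>m. rmult m x)"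
    by (rule bounded_linear_intro[where K = "norm x"]) (simp_all add: norm_rmult_le)
  then show "Cauchy X \<Longrightarrow> Cauchy (\<lambda>n. rmult (X n) x)" by (rule bounded_linear.Cauchy)
qed

instance multiplier :: (cstar_algebra) real_normed_algebra
proof
  fix k m :: "'a multiplier" and r :: real
  show "r *\<^sub>R k * m = r *\<^sub>R (k * m)" by (rule multiplier_eqI) simp
  show "k * r *\<^sub>R m = r *\<^sub>R (k * m)" by (rule multiplier_eqI) (simp add: lmult_scaleR)
  show "norm (k * m) \<le> norm k * norm m" by (rule norm_multiplier_mult)
qed

instance multiplier :: (cstar_algebra) banach
proof
  fix X :: "nat \<Rightarrow> 'a multiplier"
  assume X: "Cauchy X"
  define l where "l x = lim (\<lambda>n. lmult (X n) x)" for x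
  define r where "r x = lim (\<lambda>n. rmult (X n) x)" for x
  have l: "(\<lambda>n. lmult (X n) x) \<longlonglongrightarrow> l x" and r: "(\<lambda>n. rmult (X n) x) \<longlonglongrightarrow> r x" for x
    unfolding l_def r_def
    using Cauchy_lmult[OF X] Cauchy_rmult[OF X] by (simp_all add: Cauchy_convergent convergent_LIMSEQ_iff[symmetric])
  have "is_multiplier (l, r)"
    unfolding is_multiplier_def fst_conv snd_conv
  proof (intro conjI allI)
    fix x y
    show "l (x * y) = l x * y"
    proof (rule LIMSEQ_unique[OF l])
      show "(\<lambda>n. lmult (X n) (x * y)) \<longlonglongrightarrow> l x * y"
        unfolding lmult_mult by (intro tendsto_intros l)
    qed
    show "r (x * y) = x * r y"
    proof (rule LIMSEQ_unique[OF r])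
      show "(\<lambda>n. rmult (X n) (x * y)) \<longlonglongrightarrow> x * r y"
        unfolding rmult_mult by (intro tendsto_intros r)
    qed
    show "x * l y = r x * y"
    proof (rule LIMSEQ_unique)
      show "(\<lambda>n. x * lmult (X n) y) \<longlonglongrightarrow> x * l y" by (intro tendsto_intros l)
      show "(\<lambda>n. x * lmult (X n) y) \<longlonglongrightarrow> r x * y"
        unfolding lmult_rmult by (intro tendsto_intros r)
    qed
  qed
  then obtain m where m: "lmult m = l"
    by (metis Abs_multiplier_inverse fst_conv lmult.rep_eq mem_Collect_eq)
  have "X \<longlonglongrightarrow> m"
  proof (rule LIMSEQ_I)
    fix e :: real assume e: "e > 0"
    obtain N where N: "\<And>i j. i \<ge> N \<Longrightarrow> j \<ge> N \<Longrightarrow> norm (X i - X j) < e / 2"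
      using CauchyD[OF X, of "e / 2"] e by auto
    have "norm (X i - m) < e" if i: "i \<ge> N" for i
    proof -
      have "norm (X i - m) \<le> e / 2"
      proof (rule norm_multiplier_bound)
        fix x
        show "norm (lmult (X i - m) x) \<le> e / 2 * norm x"
        proof (rule tendsto_upperbound)
          show "(\<lambda>j. norm (lmult (X i - X j) x)) \<longlonglongrightarrow> norm (lmult (X i - m) x)"
            by (simp add: m) (intro tendsto_intros l)
          show "\<forall>\<^sub>F j in sequentially. norm (lmult (X i - X j) x) \<le> e / 2 * norm x"
          proof (rule eventually_sequentiallyI)
            fix j assume "j \<ge> N"
            then have "norm (X i - X j) * norm x \<le> e / 2 * norm x"
              using N[OF i, of j] by (intro mult_right_mono) auto
            then show "norm (lmult (X i - X j) x) \<le> e / 2 * norm x"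
              using norm_lmult_le[of "X i - X j" x] by linarith
          qed
        qed simp
      qed (use e in simp)
      then show ?thesis using e by simp
    qed
    then show "\<exists>N. \<forall>i\<ge>N. norm (X i - m) < e" by blast
  qed
  then show "convergent X" by (auto simp: convergent_def)
qed

instance multiplier :: (cstar_algebra) complex_banach_algebra
proof
  fix c :: complex and m :: "'a multiplier"
  show "norm (scaleC c m) = cmod c * norm m"
  proof -
    have le: "norm (scaleC d k) \<le> cmod d * norm k" for d and k :: "'a multiplier"
    proof (rule norm_multiplier_bound)
      fix x
      have "cmod d * norm (lmult k x) \<le> cmod d * (norm k * norm x)"
        by (intro mult_left_mono norm_lmult_le) simp
      then show "norm (lmult (scaleC d k) x) \<le> cmod d * norm k * norm x"
        by (simp add: norm_scaleC mult.assoc)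
    qed simp
    show ?thesis
    proof (cases "c = 0")
      case False
      have "m = scaleC (1 / c) (scaleC c m)"
        using False by (simp add: scaleC_scaleC scaleC_one)
      then have "norm m \<le> cmod (1 / c) * norm (scaleC c m)" using le by metis
      then have "cmod c * norm m \<le> norm (scaleC c m)"
        using False by (simp add: norm_divide field_simps)
      with le[of c m] show ?thesis by simp
    next
      case True
      then show ?thesis using le[of c m] by simp
    qed
  qed
qed

instance multiplier :: (cstar_algebra) cstar_algebra
proof
  fix k m :: "'a multiplier" and c :: complex
  show "star (star k) = k" by (rule star_star_multiplier)
  show "star (k + m) = star k + star m" by (rule multiplier_eqI) (simp add: star_add)
  show "star (scaleC c k) = scaleC (cnj c) (star k)" by (rule multiplier_eqI) (simp add: star_scaleC)
  show "star (k * m) = star m * star k" by (rule multiplier_eqI) (simp add: star_star)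
  show "norm (star k * k) = (norm k)\<^sup>2" by (rule norm_multiplier_star_mult)
qed

instance multiplier :: (cstar_algebra) cstar_algebra_1 ..

section \<open>The embedding of C into M(C)\<close>

lemma mult_emb_simps:
  "mult_emb (x + y) = mult_emb x + mult_emb y" "mult_emb (x - y) = mult_emb x - mult_emb y"
  "mult_emb (- x) = - mult_emb x" "mult_emb 0 = 0" "mult_emb (x * y) = mult_emb x * mult_emb y"
  "mult_emb (r *\<^sub>R x) = r *\<^sub>R mult_emb x" "mult_emb (scaleC c x) = scaleC c (mult_emb x)"
  "mult_emb (star x) = star (mult_emb x)"
  by (rule multiplier_eqI; simp add: algebra_simps mult_scaleC_left star_mult star_star)+

lemma mult_emb_lmult: "m * mult_emb c = mult_emb (lmult m c)"
  by (rule multiplier_eqI) (simp add: lmult_mult)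

lemma norm_mult_emb [simp]: "norm (mult_emb c) = norm c"
proof (rule antisym)
  show "norm (mult_emb c) \<le> norm c"
    by (rule norm_multiplier_bound) (simp_all add: norm_mult_ineq)
  have "norm c * norm c \<le> norm (mult_emb c) * norm c"
    using norm_lmult_le[of "mult_emb c" "star c"] by (simp add: norm_mult_star power2_eq_square)
  then show "norm c \<le> norm (mult_emb c)"
    by (cases "c = 0") auto
qed

lemma mult_emb_eq_iff [simp]: "mult_emb x = mult_emb y \<longleftrightarrow> x = y"
proof
  assume "mult_emb x = mult_emb y"
  then have "norm (mult_emb (x - y)) = 0" by (simp add: mult_emb_simps del: norm_mult_emb)
  then show "x = y" by simp
qed simp

lemma hermitian_mult_emb [simp]: "hermitian (mult_emb x) \<longleftrightarrow> hermitian x"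
  by (simp add: hermitian_def flip: mult_emb_simps)

lemma bounded_linear_mult_emb: "bounded_linear mult_emb"
  by (rule bounded_linear_intro[where K = 1]) (simp_all add: mult_emb_simps)

lemma closed_range_mult_emb: "closed (range (mult_emb :: 'c::cstar_algebra \<Rightarrow> _))"
proof (unfold closed_sequential_limits, intro allI impI, elim conjE)
  fix X and m :: "'c multiplier"
  assume X: "\<forall>n. X n \<in> range mult_emb" and lim: "X \<longlonglongrightarrow> m"
  have "\<forall>n. \<exists>y. X n = mult_emb y" using X by blast
  then obtain Y where Y: "\<And>n. X n = mult_emb (Y n)" by metis
  have "Cauchy X" using lim by (rule LIMSEQ_imp_Cauchy)
  then have "Cauchy Y"
    unfolding Cauchy_def dist_norm Y by (simp flip: mult_emb_simps)
  then obtain y where "Y \<longlonglongrightarrow> y" using Cauchy_convergent convergent_def by blast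
  then have "X \<longlonglongrightarrow> mult_emb y"
    using bounded_linear.tendsto[OF bounded_linear_mult_emb] by (simp add: Y[abs_def])
  then show "m \<in> range mult_emb" using LIMSEQ_unique lim by blast
qed

text \<open>Individual terms of the series may lie outside C because of the unit. But for x = 1 - c
  / t every x ^ n - 1 lies in the ideal C, and \<open>sqrt_one_minus_in_closed\<close> disposes of
  the constant terms.\<close>

lemma sqrt_at_mult_emb:
  assumes "t > 0" "norm (t *\<^sub>R 1 - mult_emb c) \<le> t"
  shows "sqrt_at t (mult_emb c) \<in> range mult_emb"
proof -
  let ?x = "1 - (1 / t) *\<^sub>R mult_emb c"
  have add: "y + z \<in> range mult_emb" if "y \<in> range mult_emb" "z \<in> range mult_emb" for y z :: "'a multiplier"
    using that by (auto simp flip: mult_emb_simps)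
  have sc: "r *\<^sub>R y \<in> range mult_emb" if "y \<in> range mult_emb" for r and y :: "'a multiplier"
    using that by (auto simp flip: mult_emb_simps)
  have "?x ^ n - 1 \<in> range mult_emb" for n
  proof (induction n)
    case 0
    then show ?case by (auto intro: range_eqI[of _ _ 0] simp: mult_emb_simps)
  next
    case (Suc n)
    have "?x ^ Suc n - 1 = ?x * (?x ^ n - 1) + mult_emb (- ((1 / t) *\<^sub>R c))"
      by (simp add: algebra_simps mult_emb_simps)
    moreover have "?x * (?x ^ n - 1) \<in> range mult_emb"
      using Suc by (auto simp: mult_emb_lmult)
    ultimately show ?case using add by auto
  qed
  then have "sqrt_one_minus ?x \<in> range mult_emb"
    using assms add sc
    by (intro sqrt_one_minus_in_closed norm_one_minus_scale closed_range_mult_emb)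
      (auto intro: range_eqI[of _ _ 0] simp: mult_emb_simps(4))
  then show ?thesis unfolding sqrt_at_def by (rule sc)
qed

lemma mult_emb_norm_pos_sqrt:
  assumes "norm_pos (mult_emb c)"
  obtains y where "norm_pos (mult_emb y)" "y * y = c"
proof -
  obtain t where t: "t > 0" "norm (t *\<^sub>R 1 - mult_emb c) \<le> t" by (rule norm_pos_E[OF assms])
  obtain y where y: "sqrt_at t (mult_emb c) = mult_emb y" using sqrt_at_mult_emb[OF t] by blast
  show thesis
  proof (rule that)
    show "norm_pos (mult_emb y)"
      using norm_pos_sqrt_at[OF t norm_pos_hermitian[OF assms]] by (simp add: y)
    show "y * y = c"
      using sqrt_at_square[OF t] by (simp add: y flip: mult_emb_simps)
  qed
qed

text \<open>The positive root of c formed in M(C) lies in C. Hence positivity is the same in both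
  algebras, and the cone properties of the unital case pass to C.\<close>

lemma cstar_pos_mult_emb: "mult_emb c \<in> cstar_pos \<longleftrightarrow> c \<in> cstar_pos"
proof
  assume "mult_emb c \<in> cstar_pos"
  then obtain y where "norm_pos (mult_emb y)" "y * y = c"
    using mult_emb_norm_pos_sqrt by (metis cstar_pos_iff_norm_pos)
  then show "c \<in> cstar_pos" using cstar_pos_square norm_pos_hermitian hermitian_mult_emb by metis
next
  assume "c \<in> cstar_pos"
  then show "mult_emb c \<in> cstar_pos" by (auto simp: cstar_pos_def mult_emb_simps)
qed

section \<open>Positive elements of a C*-algebra\<close>

lemma cstar_pos_norm_pos: "c \<in> cstar_pos \<longleftrightarrow> norm_pos (mult_emb c)"
  by (simp add: cstar_pos_iff_norm_pos flip: cstar_pos_mult_emb)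

lemma cstar_pos_add: "x \<in> cstar_pos \<Longrightarrow> y \<in> cstar_pos \<Longrightarrow> x + y \<in> cstar_pos"
  by (simp add: cstar_pos_norm_pos mult_emb_simps norm_pos_add)

lemma cstar_pos_scaleR: "x \<in> cstar_pos \<Longrightarrow> r \<ge> 0 \<Longrightarrow> r *\<^sub>R x \<in> cstar_pos"
  by (simp add: cstar_pos_norm_pos mult_emb_simps norm_pos_scaleR)

lemma cstar_pos_antisym: "x \<in> cstar_pos \<Longrightarrow> - x \<in> cstar_pos \<Longrightarrow> x = 0"
  using norm_pos_antisym[of "mult_emb x"] mult_emb_eq_iff[of x 0]
  by (simp add: cstar_pos_norm_pos mult_emb_simps del: mult_emb_eq_iff)

lemma closed_cstar_pos: "closed (cstar_pos :: 'c::cstar_algebra set)"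
proof -
  have *: "(cstar_pos :: 'c set) = mult_emb -` {p. norm_pos p}"
    by (intro set_eqI) (simp only: cstar_pos_norm_pos vimage_eq mem_Collect_eq)
  show ?thesis unfolding *
    by (intro closed_vimage closed_norm_pos linear_continuous_on bounded_linear_mult_emb)
qed

lemma pos_sqrt:
  assumes "c \<in> cstar_pos"
  shows "pos_sqrt c \<in> cstar_pos" and "pos_sqrt c * pos_sqrt c = c"
proof -
  obtain y where y: "norm_pos (mult_emb y)" "y * y = c"
    by (rule mult_emb_norm_pos_sqrt[OF assms[unfolded cstar_pos_norm_pos]])
  have "z = y" if "z \<in> cstar_pos \<and> z * z = c" for z
  proof -
    have "mult_emb z = mult_emb y"
    proof (rule norm_pos_sqrt_unique)
      show "norm_pos (mult_emb z)" using that by (simp only: cstar_pos_norm_pos)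
      show "mult_emb z * mult_emb z = mult_emb y * mult_emb y"
        using that y by (simp flip: mult_emb_simps)
    qed (rule y)
    then show ?thesis by simp
  qed
  moreover have "y \<in> cstar_pos" unfolding cstar_pos_norm_pos by (rule y)
  ultimately have "pos_sqrt c = y" unfolding pos_sqrt_def using y(2) by (intro the_equality) blast+
  then show "pos_sqrt c \<in> cstar_pos" "pos_sqrt c * pos_sqrt c = c"
    using y(2) \<open>y \<in> cstar_pos\<close> by blast+
qed

text \<open>The positive and negative parts are taken in M(C). The formula for p involves only c and
  the root of c c, so p and n lie in C, and so do their roots x and y.\<close>

lemma hermitian_eq_diff_squares:
  assumes c: "hermitian (c :: 'c::cstar_algebra)"
  obtains x y where "c = x * x - y * y"
proof -
  let ?h = "mult_emb c"
  define t where "t = max 1 (norm (?h * ?h))"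
  have t: "t > 0" "norm (?h * ?h) \<le> t" by (simp_all add: t_def)
  have h: "hermitian ?h" using c by simp
  obtain p n where pn: "norm_pos p" "norm_pos n" "?h = p - n"
    and parts: "p * n = 0" "n * p = 0"
      "\<And>t. t > 0 \<Longrightarrow> norm (?h * ?h) \<le> t \<Longrightarrow> p = (1/2) *\<^sub>R (sqrt_at t (?h * ?h) + ?h)"
    by (rule norm_pos_parts[OF h]) (rule that)
  have p: "p = (1/2) *\<^sub>R (sqrt_at t (?h * ?h) + ?h)" by (rule parts(3)[OF t])
  have "norm (t *\<^sub>R 1 - mult_emb (c * c)) \<le> t"
    using norm_scale_minus_square[OF h t(2)] by (simp add: mult_emb_simps)
  then have "sqrt_at t (mult_emb (c * c)) \<in> range mult_emb" by (rule sqrt_at_mult_emb[OF t(1)])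
  then obtain a where a: "sqrt_at t (?h * ?h) = mult_emb a" by (auto simp: mult_emb_simps)
  have pe: "p = mult_emb ((1/2) *\<^sub>R (a + c))" unfolding p a by (simp add: mult_emb_simps)
  then have ne: "n = mult_emb ((1/2) *\<^sub>R (a + c) - c)" using pn(3) by (simp add: mult_emb_simps)
  obtain x where x: "x * x = (1/2) *\<^sub>R (a + c)"
    by (rule mult_emb_norm_pos_sqrt[OF pn(1)[unfolded pe]])
  obtain y where y: "y * y = (1/2) *\<^sub>R (a + c) - c"
    by (rule mult_emb_norm_pos_sqrt[OF pn(2)[unfolded ne]])
  show thesis by (rule that[of x y]) (simp add: x y)
qed

text \<open>The hypothesis is tested on vectors n c, where n is the negative part of m. There the
  form equals - \<open>star (k c) * k c\<close>, with k the root of the cube of n. So k vanishes,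
  hence the fourth power of n, hence n.\<close>

lemma multiplier_cstar_posI:
  fixes m :: "'c::cstar_algebra multiplier"
  assumes m: "hermitian m" and pos: "\<And>c. star c * lmult m c \<in> cstar_pos"
  shows "m \<in> cstar_pos"
proof -
  obtain p n where pn: "norm_pos p" "norm_pos n" "m = p - n" "p * n = 0" "n * p = 0"
    using norm_pos_parts[OF m] by blast
  have hn: "hermitian n" by (rule norm_pos_hermitian[OF pn(2)])
  have "norm_pos (n * (n * n))"
    using pn(2) hn by (intro norm_pos_commuting_mult norm_pos_square) (simp_all add: mult.assoc)
  then obtain k where k: "norm_pos k" "k * k = n * (n * n)" using norm_pos_sqrt by metis
  have hk: "hermitian k" by (rule norm_pos_hermitian[OF k(1)])
  have "k = 0"
  proof (rule multiplier_eqI)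
    fix c
    define d where "d = lmult n c"
    have d: "mult_emb d = n * mult_emb c" by (simp only: d_def mult_emb_lmult)
    have "mult_emb (star d * lmult m d) = star (mult_emb d) * (m * mult_emb d)"
      by (simp only: mult_emb_lmult[of m d] mult_emb_simps)
    also have "\<dots> = star (mult_emb c) * (n * m * n) * mult_emb c"
      using hn unfolding d by (simp add: star_mult hermitian_def mult.assoc)
    also have "n * m * n = - (k * k)"
      unfolding pn(3) k(2) using pn(4,5) by (simp add: algebra_simps)
    also have "star (mult_emb c) * - (k * k) * mult_emb c = - (star (k * mult_emb c) * (k * mult_emb c))"
      using hk by (simp add: star_mult hermitian_def mult.assoc)
    also have "\<dots> = mult_emb (- (star (lmult k c) * lmult k c))"
      by (simp only: mult_emb_lmult[of k c] mult_emb_simps)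
    finally have "star d * lmult m d = - (star (lmult k c) * lmult k c)" by simp
    then have "- (star (lmult k c) * lmult k c) \<in> cstar_pos" using pos[of d] by simp
    then have "star (lmult k c) * lmult k c = 0" using cstar_posI cstar_pos_antisym by blast
    then show "lmult k c = lmult 0 c" by simp
  qed
  then have "(n * n) * (n * n) = 0" using k(2) by (simp add: mult.assoc)
  then have "n * n = 0" by (rule hermitian_square_eq_0[OF hermitian_mult[OF hn hn refl]])
  then have "n = 0" by (rule hermitian_square_eq_0[OF hn])
  then show ?thesis using pn by (simp add: cstar_pos_iff_norm_pos)
qed

section \<open>Strictly positive elements\<close>

lemma cstar_pos_norm_mono:
  fixes p q :: "'m::cstar_algebra_1"
  assumes p: "p \<in> cstar_pos" and pq: "q - p \<in> cstar_pos"
  shows "norm p \<le> norm q"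
proof (rule norm_le_of_cstar_pos)
  have "q - p + p \<in> cstar_pos" using pq p by (rule cstar_pos_add)
  then have "norm q *\<^sub>R 1 - q \<in> cstar_pos"
    by (intro hermitian_cstar_pos_minus) (simp_all add: cstar_pos_hermitian)
  from cstar_pos_add[OF this pq] show "norm q *\<^sub>R 1 - p \<in> cstar_pos" by simp
  have "norm q *\<^sub>R (1 :: 'm) \<in> cstar_pos" by (simp add: cstar_pos_iff_norm_pos norm_pos_one_scale)
  from cstar_pos_add[OF this p] show "norm q *\<^sub>R 1 + p \<in> cstar_pos" .
qed (use p in \<open>simp_all add: cstar_pos_hermitian\<close>)

text \<open>The positive elements (1 - w) w ^ j decrease in j. Thus Suc n times the last one is at
  most the sum over j \<le> n, which telescopes to 1 - w ^ Suc n and is at most 1.\<close>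

lemma norm_one_minus_times_power:
  fixes w :: "'m::cstar_algebra_1"
  assumes w: "norm_pos w" "norm_pos (1 - w)"
  shows "norm ((1 - w) * w ^ n) \<le> 1 / real (Suc n)"
proof -
  have comm: "(1 - w) * w ^ j = w ^ j * (1 - w)" for j
    by (simp add: algebra_simps power_commutes)
  have pow: "norm_pos (w ^ j)" for j
  proof (induction j)
    case 0
    show ?case using norm_pos_one_scale[of 1] by simp
  next
    case (Suc j)
    then show ?case using norm_pos_commuting_mult[OF w(1) Suc] by (simp add: power_commutes)
  qed
  have pos: "norm_pos ((1 - w) * w ^ j)" for j
    by (rule norm_pos_commuting_mult[OF w(2) pow comm])
  have step: "norm_pos ((1 - w) * w ^ j - (1 - w) * w ^ Suc j)" for j
  proof -
    have "norm_pos ((1 - w) * ((1 - w) * w ^ j))"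
      by (rule norm_pos_commuting_mult[OF w(2) pos]) (metis comm mult.assoc)
    then show ?thesis by (simp add: algebra_simps)
  qed
  have anti: "norm_pos ((1 - w) * w ^ j - (1 - w) * w ^ n)" if "j \<le> n" for j
    using that
  proof (induction rule: inc_induct)
    case base
    show ?case using norm_pos_0 by simp
  next
    case (step m)
    from norm_pos_add[OF \<open>\<And>j. norm_pos ((1 - w) * w ^ j - (1 - w) * w ^ Suc j)\<close>[of m] step.IH]
    show ?case by simp
  qed
  have telescope: "(\<Sum>j<m. (1 - w) * w ^ j) = 1 - w ^ m" for m
    by (induction m) (simp_all add: algebra_simps)
  have sum_pos: "norm_pos (\<Sum>j<m. (1 - w) * w ^ j - (1 - w) * w ^ n)" if "m \<le> Suc n" for m
    using that by (induction m) (auto simp: norm_pos_0 intro!: norm_pos_add anti)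
  have "norm_pos (1 - w ^ Suc n - real (Suc n) *\<^sub>R ((1 - w) * w ^ n))"
    using sum_pos[of "Suc n"] by (simp only: sum_subtractf telescope sum_constant_scaleR card_lessThan order_refl)
  from norm_pos_add[OF this pow[of "Suc n"]]
  have "norm (real (Suc n) *\<^sub>R ((1 - w) * w ^ n)) \<le> norm (1 :: 'm)"
    using pos[of n] norm_pos_scaleR[OF pos[of n], of "real (Suc n)"]
    by (intro cstar_pos_norm_mono) (simp_all add: cstar_pos_iff_norm_pos del: of_nat_Suc)
  also have "\<dots> \<le> 1" by (rule norm_one_le)
  finally have "real (Suc n) * norm ((1 - w) * w ^ n) \<le> 1" by (simp del: of_nat_Suc)
  then show ?thesis by (simp add: pos_le_divide_eq mult.commute del: of_nat_Suc)
qed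

text \<open>Once p vanishes on the positive part of A, each positive a in A lies below t + n u with
  t arbitrarily small. For s in A take a = \<open>s * star s\<close> and g = w ^ N with w = 1 - u /
  \<tau>: then g a g is at most t g g + n g u g, and the last term tends to 0 by
  \<open>norm_one_minus_times_power\<close>. So g s is small, while it differs from s by an element
  of uC.\<close>

lemma strictly_positive_dense:
  fixes \<iota> :: "'a::complex_banach_algebra \<Rightarrow> 'c::cstar_algebra"
  assumes segal: "cstar_segal \<iota>" and u: "strictly_positive \<iota> u"
  shows "closure (range (\<lambda>c. \<iota> u * c)) = UNIV"
proof -
  have lin: "\<iota> (a + b) = \<iota> a + \<iota> b" "\<iota> (scaleC k a) = scaleC k (\<iota> a)" for a b k
    using segal by (auto simp: cstar_segal_def Vector_Spaces.linear_iff)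
  have u_pos: "\<iota> u \<in> cstar_pos" using u by (simp add: strictly_positive_def segal_pos_def)
  let ?U = "mult_emb (\<iota> u)"
  have U_pos: "?U \<in> cstar_pos" using u_pos by (simp add: cstar_pos_mult_emb)
  \<comment> \<open>The real part makes p a functional on all of C, and t multiplies the unit of
    M(C). With t \<ge> 0 the functional p is nonnegative; it vanishes at u and at negatives of
    positive elements, so a linear f below p is positive with f u \<le> 0.\<close>
  define S where "S c = {t. t \<ge> 0 \<and>
    (\<exists>n\<ge>0. t *\<^sub>R 1 + n *\<^sub>R ?U - mult_emb (re_part c) \<in> cstar_pos)}" for c
  define p where "p c = Inf (S c)" for c
  have bdd: "bdd_below (S c)" for c by (rule bdd_belowI[of _ 0]) (simp add: S_def)
  have S_ne: "S c \<noteq> {}" for c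
  proof -
    have "norm (re_part c) *\<^sub>R 1 - mult_emb (re_part c) \<in> cstar_pos"
      by (rule hermitian_cstar_pos_minus) (simp_all add: hermitian_re_part)
    then have "norm (re_part c) \<in> S c"
      unfolding S_def mem_Collect_eq by (intro conjI exI[of _ 0]) simp_all
    then show ?thesis by blast
  qed
  have p_le: "p c \<le> t" if "t \<in> S c" for c t
    unfolding p_def by (rule cInf_lower[OF that bdd])
  have p_ge: "r \<le> p c" if "\<And>t. t \<in> S c \<Longrightarrow> r \<le> t" for c r
    unfolding p_def by (rule cInf_greatest[OF S_ne that])
  have p_nonneg: "p c \<ge> 0" for c by (rule p_ge) (simp add: S_def)
  have zero_S: "p c \<le> 0" if "n \<ge> 0" "n *\<^sub>R \<iota> u - re_part c \<in> cstar_pos" for c n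
  proof (rule p_le)
    have "0 *\<^sub>R 1 + n *\<^sub>R ?U - mult_emb (re_part c) = mult_emb (n *\<^sub>R \<iota> u - re_part c)"
      by (simp add: mult_emb_simps)
    then have "0 *\<^sub>R 1 + n *\<^sub>R ?U - mult_emb (re_part c) \<in> cstar_pos"
      using that(2) by (simp only: cstar_pos_mult_emb)
    then show "0 \<in> S c" unfolding S_def using that(1) by blast
  qed
  have "sublinear p"
  proof (rule sublinearI)
    fix x y
    have sum_le: "p (x + y) \<le> t + s" if t: "t \<in> S x" and s: "s \<in> S y" for t s
    proof (rule p_le)
      obtain m where m: "m \<ge> 0" "t *\<^sub>R 1 + m *\<^sub>R ?U - mult_emb (re_part x) \<in> cstar_pos"
        using t by (auto simp: S_def)
      obtain n where n: "n \<ge> 0" "s *\<^sub>R 1 + n *\<^sub>R ?U - mult_emb (re_part y) \<in> cstar_pos"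
        using s by (auto simp: S_def)
      have "(t *\<^sub>R 1 + m *\<^sub>R ?U - mult_emb (re_part x)) + (s *\<^sub>R 1 + n *\<^sub>R ?U - mult_emb (re_part y))
          = (t + s) *\<^sub>R 1 + (m + n) *\<^sub>R ?U - mult_emb (re_part (x + y))"
        by (simp add: re_part_def mult_emb_simps star_add algebra_simps)
      then show "t + s \<in> S (x + y)"
        using cstar_pos_add[OF m(2) n(2)] m(1) n(1) s t unfolding S_def by (auto intro!: exI[of _ "m + n"])
    qed
    have "p (x + y) - t \<le> p y" if "t \<in> S x" for t
    proof (rule p_ge)
      show "p (x + y) - t \<le> s" if "s \<in> S y" for s
        using sum_le[OF \<open>t \<in> S x\<close> that] by simp
    qed
    then have "p (x + y) - p y \<le> p x"
      by (intro p_ge) (simp add: algebra_simps)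
    then show "p (x + y) \<le> p x + p y" by simp
  next
    show "p 0 = 0"
      using zero_S[of 0 0] p_nonneg[of 0] by (simp add: re_part_def cstar_pos_zero)
  next
    fix r :: real and x assume r: "r > 0"
    have "p (r *\<^sub>R x) / r \<le> p x"
    proof (rule p_ge)
      fix t assume t: "t \<in> S x"
      then obtain m where m: "m \<ge> 0" "t *\<^sub>R 1 + m *\<^sub>R ?U - mult_emb (re_part x) \<in> cstar_pos"
        by (auto simp: S_def)
      have "r *\<^sub>R (t *\<^sub>R 1 + m *\<^sub>R ?U - mult_emb (re_part x))
          = (r * t) *\<^sub>R 1 + (r * m) *\<^sub>R ?U - mult_emb (re_part (r *\<^sub>R x))"
        by (simp add: re_part_def mult_emb_simps star_scaleR algebra_simps)
      then have "r * t \<in> S (r *\<^sub>R x)"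
        using cstar_pos_scaleR[OF m(2), of r] m(1) r t unfolding S_def
        by (auto intro!: exI[of _ "r * m"])
      then show "p (r *\<^sub>R x) / r \<le> t" using p_le r by (simp add: field_simps)
    qed
    then show "p (r *\<^sub>R x) \<le> r * p x" using r by (simp add: field_simps)
  qed
  have re_herm: "re_part h = h" if "hermitian h" for h :: 'c
    using that by (simp add: re_part_def hermitian_def flip: scaleR_2)
  have re_ih: "re_part (scaleC \<i> h) = 0" if "hermitian h" for h :: 'c
    using that by (simp add: re_part_def hermitian_def star_scaleC scaleC_minus_left)
  have p_zero: "p (\<iota> a) = 0" if a: "\<iota> a \<in> cstar_pos" for a
  proof (rule ccontr)
    assume "p (\<iota> a) \<noteq> 0"
    obtain f where f: "linear f" "\<And>x. f x \<le> p x" "f (\<iota> a) = p (\<iota> a)"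
      using Hahn_Banach_sublinear[OF \<open>sublinear p\<close>] by blast
    \<comment> \<open>The complex functional with real part f, restricted to A. As p sees only real
      parts, f vanishes at i h for hermitian h, so \<omega> is real on positive elements.\<close>
    define \<omega> where "\<omega> b = Complex (f (\<iota> b)) (- f (scaleC \<i> (\<iota> b)))" for b
    have f_add: "f (x + y) = f x + f y" and f_sc: "f (r *\<^sub>R x) = r * f x" for x y r
      using f(1) by (simp_all add: linear_add linear_scale)
    have f_neg: "f (- x) = - f x" for x using f_sc[of "-1" x] by simp
    have scale: "scaleC k x = Re k *\<^sub>R x + Im k *\<^sub>R scaleC \<i> x" for k and x :: 'c
    proof -
      have "scaleC k x = scaleC (complex_of_real (Re k) + complex_of_real (Im k) * \<i>) x"
        by (subst mult.commute) (simp flip: complex_eq)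
      then show ?thesis by (simp add: scaleC_add_left scaleC_of_real flip: scaleC_scaleC)
    qed
    have ii: "scaleC \<i> (scaleC \<i> x) = - x" for x :: 'c by (simp add: scaleC_scaleC scaleC_minus1)
    have "Vector_Spaces.linear scaleC (*) \<omega>"
      unfolding Vector_Spaces.linear_iff
    proof (intro conjI allI)
      show "vector_space (scaleC :: complex \<Rightarrow> 'a \<Rightarrow> 'a)"
        by unfold_locales (simp_all add: scaleC_add_right scaleC_add_left scaleC_scaleC scaleC_one)
      show "vector_space ((*) :: complex \<Rightarrow> complex \<Rightarrow> complex)"
        by unfold_locales (simp_all add: algebra_simps)
      show "\<omega> (x + y) = \<omega> x + \<omega> y" for x y
        by (simp add: \<omega>_def lin scaleC_add_right f_add complex_eq_iff)
      show "\<omega> (scaleC k x) = k * \<omega> x" for k x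
      proof (rule complex_eqI)
        show "Re (\<omega> (scaleC k x)) = Re (k * \<omega> x)"
          using scale[of k "\<iota> x"] by (simp add: \<omega>_def lin f_add f_sc)
        have "scaleC \<i> (scaleC k (\<iota> x)) = Re k *\<^sub>R scaleC \<i> (\<iota> x) - Im k *\<^sub>R \<iota> x"
          unfolding scale[of k] by (simp add: scaleC_add_right scaleC_scaleR ii)
        then have "f (scaleC \<i> (scaleC k (\<iota> x))) = Re k * f (scaleC \<i> (\<iota> x)) - Im k * f (\<iota> x)"
          using f_add[of _ "- (Im k *\<^sub>R \<iota> x)"] by (simp add: f_sc f_neg)
        then show "Im (\<omega> (scaleC k x)) = Im (k * \<omega> x)"
          by (simp add: \<omega>_def lin)
      qed
    qed
    moreover have "\<omega> b \<in> \<real>\<^sub>\<ge>\<^sub>0" if "b \<in> segal_pos \<iota>" for b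
    proof -
      have b: "\<iota> b \<in> cstar_pos" using that by (simp add: segal_pos_def)
      have hb: "hermitian (\<iota> b)" by (rule cstar_pos_hermitian[OF b])
      have "f (- \<iota> b) \<le> 0"
        using f(2)[of "- \<iota> b"] zero_S[of 0 "- \<iota> b"] b re_herm[OF hermitian_minus[OF hb]] by simp
      moreover have "f (scaleC \<i> (\<iota> b)) \<le> 0"
        using f(2)[of "scaleC \<i> (\<iota> b)"] zero_S[of 0 "scaleC \<i> (\<iota> b)"] re_ih[OF hb]
        by (simp add: cstar_pos_zero)
      moreover have "f (- scaleC \<i> (\<iota> b)) \<le> 0"
        using f(2)[of "scaleC \<i> (- \<iota> b)"] zero_S[of 0 "scaleC \<i> (- \<iota> b)"] re_ih[OF hermitian_minus[OF hb]]
        by (simp add: cstar_pos_zero scaleC_minus_right)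
      ultimately show ?thesis
        by (simp add: \<omega>_def f_neg complex_nonneg_Reals_iff)
    qed
    ultimately have "positive_functional \<iota> \<omega>" by (simp add: positive_functional_def)
    moreover have "\<omega> a \<noteq> 0"
      using \<open>p (\<iota> a) \<noteq> 0\<close> f(3) by (auto simp: \<omega>_def complex_eq_iff)
    ultimately have "Re (\<omega> u) > 0" using u unfolding strictly_positive_def by blast
    moreover have "f (\<iota> u) \<le> 0"
      using f(2)[of "\<iota> u"] zero_S[of 1 "\<iota> u"] re_herm[OF cstar_pos_hermitian[OF u_pos]]
      by (simp add: cstar_pos_zero)
    ultimately show False by (simp add: \<omega>_def)
  qed
  have "\<iota> b \<in> closure (range (\<lambda>c. \<iota> u * c))" for b
  proof -
    define s where "s = \<iota> b"
    obtain a where a: "\<iota> a = s * star s" using segal unfolding cstar_segal_def s_def by (metis rangeE)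
    have a_pos: "\<iota> a \<in> cstar_pos" using cstar_posI[of "star s"] by (simp add: a star_star)
    \<comment> \<open>The summand 1 keeps \<tau> positive even for u = 0. As u lies between 0 and
      \<tau>, both w and 1 - w are positive.\<close>
    define \<tau> where "\<tau> = norm (\<iota> u) + 1"
    have \<tau>: "\<tau> > 0" by (simp add: \<tau>_def add_nonneg_pos)
    define w where "w = 1 - (1 / \<tau>) *\<^sub>R ?U"
    have one_w: "1 - w = (1 / \<tau>) *\<^sub>R ?U" by (simp add: w_def)
    have w1: "norm_pos (1 - w)"
      unfolding one_w using U_pos \<tau> by (intro norm_pos_scaleR) (simp_all add: cstar_pos_iff_norm_pos)
    have "norm_pos ((1 / \<tau>) *\<^sub>R (\<tau> *\<^sub>R 1 - ?U))"
      using \<tau> hermitian_cstar_pos_minus[OF cstar_pos_hermitian[OF U_pos], of \<tau>]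
      by (intro norm_pos_scaleR) (simp_all add: \<tau>_def flip: cstar_pos_iff_norm_pos)
    then have w0: "norm_pos w" using \<tau> by (simp add: w_def scaleR_diff_right)
    have hw: "hermitian (w ^ n)" for n
    proof (induction n)
      case (Suc n)
      then have "hermitian (w * w ^ n)"
        by (intro hermitian_mult norm_pos_hermitian[OF w0]) (simp_all add: power_commutes)
      then show ?case by simp
    qed (simp add: hermitian_one)
    have "norm w \<le> 1"
      using cstar_pos_norm_mono[of w 1] w0 w1 norm_one_le[where 'm = "'c multiplier"]
      by (simp add: cstar_pos_iff_norm_pos)
    have in_range: "\<exists>c. lmult (w ^ n) s = s + \<iota> u * c" for n
    proof (induction n)
      case 0
      show ?case by (intro exI[of _ 0]) simp
    next
      case (Suc n)
      then obtain c where c: "lmult (w ^ n) s = s + \<iota> u * c" by blast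
      have "lmult (w ^ Suc n) s = (s + \<iota> u * c) - (1 / \<tau>) *\<^sub>R (\<iota> u * (s + \<iota> u * c))"
        by (simp add: c) (simp add: w_def)
      also have "\<dots> = s + \<iota> u * (c - (1 / \<tau>) *\<^sub>R (s + \<iota> u * c))"
        by (simp add: algebra_simps)
      finally show ?case by blast
    qed
    show ?thesis
      unfolding closure_approachable
    proof (intro allI impI)
      fix e :: real assume e: "e > 0"
      then have "p (\<iota> a) < e\<^sup>2 / 2" using p_zero[OF a_pos] by simp
      then obtain t where t: "t \<in> S (\<iota> a)" "t < e\<^sup>2 / 2"
        unfolding p_def using cInf_lessD[OF S_ne] by blast
      then obtain n where n: "n \<ge> 0" "t *\<^sub>R 1 + n *\<^sub>R ?U - mult_emb (\<iota> a) \<in> cstar_pos"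
        and "t \<ge> 0"
        using re_herm[OF cstar_pos_hermitian[OF a_pos]] by (auto simp: S_def)
      obtain N where N: "n * \<tau> / (e\<^sup>2 / 2) < real N" using reals_Archimedean2 by blast
      define g where "g = w ^ N"
      have hg: "hermitian g" unfolding g_def by (rule hw)
      have "norm g \<le> 1" unfolding g_def by (rule norm_power_le_one[OF \<open>norm w \<le> 1\<close>])
      define X where "X = g * mult_emb s"
      have XX: "X * star X = g * mult_emb (\<iota> a) * g"
        using hg by (simp add: X_def a star_mult hermitian_def mult_emb_simps mult.assoc)
      have gUg: "g * ?U * g = \<tau> *\<^sub>R ((1 - w) * w ^ (N + N))"
      proof -
        have "g * ?U = ?U * g"
        proof -
          have "w * ?U = ?U * w" by (simp add: w_def algebra_simps)
          then have "w ^ k * ?U = ?U * w ^ k" for k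
            by (induction k) (simp_all add: mult.assoc, metis mult.assoc)
          then show ?thesis by (simp add: g_def)
        qed
        then show ?thesis
          using \<tau> by (simp add: one_w g_def power_add mult.assoc)
      qed
      have "norm (g * ?U * g) \<le> \<tau> * (1 / real (Suc (N + N)))"
        using mult_left_mono[OF norm_one_minus_times_power[OF w0 w1, of "N + N"], of \<tau>] \<tau>
        by (simp del: of_nat_Suc add: gUg)
      then have "n * norm (g * ?U * g) \<le> n * (\<tau> * (1 / real (Suc (N + N))))"
        using n(1) by (intro mult_left_mono)
      also have "\<dots> < e\<^sup>2 / 2"
      proof -
        have "n * \<tau> < e\<^sup>2 / 2 * real N" using N e by (simp add: field_simps)
        also have "\<dots> \<le> e\<^sup>2 / 2 * real (Suc (N + N))" by (intro mult_left_mono) auto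
        finally show ?thesis by (simp add: field_simps)
      qed
      finally have small: "n * norm (g * ?U * g) < e\<^sup>2 / 2" .
      have "star g * (t *\<^sub>R 1 + n *\<^sub>R ?U - mult_emb (\<iota> a)) * g \<in> cstar_pos"
        by (rule cstar_pos_conj[OF n(2)])
      then have "t *\<^sub>R (g * g) + n *\<^sub>R (g * ?U * g) - X * star X \<in> cstar_pos"
        using hg by (simp add: XX hermitian_def algebra_simps)
      moreover have "X * star X \<in> cstar_pos" using cstar_posI[of "star X"] by (simp add: star_star)
      ultimately have "norm (X * star X) \<le> norm (t *\<^sub>R (g * g) + n *\<^sub>R (g * ?U * g))"
        by (intro cstar_pos_norm_mono)
      also have "\<dots> \<le> t * norm (g * g) + n * norm (g * ?U * g)"
        using norm_triangle_ineq[of "t *\<^sub>R (g * g)" "n *\<^sub>R (g * ?U * g)"] n(1) \<open>t \<ge> 0\<close> by simp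
      also have "t * norm (g * g) \<le> t * 1"
        using norm_mult_ineq[of g g] mult_mono[OF \<open>norm g \<le> 1\<close> \<open>norm g \<le> 1\<close>] \<open>t \<ge> 0\<close>
        by (intro mult_left_mono) auto
      finally have "(norm X)\<^sup>2 < e\<^sup>2"
        using t(2) small by (simp add: norm_mult_star)
      then have "norm X < e" by (rule power2_less_imp_less) (use e in simp)
      then have "norm (lmult g s) < e" by (simp add: X_def mult_emb_lmult)
      moreover obtain c where "lmult g s = s + \<iota> u * c" using in_range g_def by metis
      ultimately have "dist (\<iota> u * (- c)) (\<iota> b) < e"
        by (simp add: dist_norm s_def norm_minus_commute)
      then show "\<exists>y\<in>range (\<lambda>c. \<iota> u * c). dist y (\<iota> b) < e" by blast
    qed
  qed
  then have "closure (range \<iota>) \<subseteq> closure (range (\<lambda>c. \<iota> u * c))"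
    by (intro closure_minimal) auto
  then show ?thesis using segal by (auto simp: cstar_segal_def)
qed

text \<open>Facts about v that do not involve A: density of vC makes v cancellable, and identities
  or positivity of multipliers can be checked on vC.\<close>

locale dense_positive =
  fixes v :: "'c::cstar_algebra"
  assumes v_pos: "v \<in> cstar_pos" and v_dense: "closure (range (\<lambda>c. v * c)) = UNIV"
begin

lemma star_v [simp]: "star v = v"
  using cstar_pos_hermitian[OF v_pos] by (simp add: hermitian_def)

lemma dense_induct:
  assumes "closed {c. P c}" "\<And>c. P (v * c)"
  shows "P c"
proof -
  have "closure (range (\<lambda>c. v * c)) \<subseteq> {c. P c}"
    using assms by (intro closure_minimal) auto
  then show ?thesis by (auto simp: v_dense)
qed

lemma cancel_left: "v * x = v * y \<longleftrightarrow> x = y"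
proof
  assume "v * x = v * y"
  then have "v * (x - y) = 0" by (simp add: right_diff_distrib)
  then have "star (x - y) * v = 0" by (metis star_mult star_v star_zero)
  then have "star (x - y) * (v * c) = 0" for c by (simp flip: mult.assoc)
  moreover have "closed {c. star (x - y) * c = 0}"
    by (intro closed_Collect_eq continuous_intros)
  ultimately have "star (x - y) * (x - y) = 0"
    using dense_induct[where P = "\<lambda>c. star (x - y) * c = 0"] by blast
  then show "x = y" by simp
qed simp

lemma cancel_right: "x * v = y * v \<longleftrightarrow> x = y"
proof
  assume "x * v = y * v"
  then have "v * star x = v * star y" by (metis star_mult star_v)
  then show "x = y" by (metis cancel_left star_star)
qed simp

lemma multiplier_cancel:
  assumes "mult_emb v * m * mult_emb v = mult_emb v * n * mult_emb v"
  shows "m = n"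
proof (rule multiplier_eqI)
  fix x
  have "lmult (mult_emb v * m * mult_emb v) c = lmult (mult_emb v * n * mult_emb v) c" for c
    using assms by simp
  then have "lmult m (v * c) = lmult n (v * c)" for c
    by (simp add: cancel_left)
  then show "lmult m x = lmult n x"
    by (rule dense_induct[rotated])
      (intro closed_Collect_eq linear_continuous_on bounded_linear_lmult)
qed

text \<open>By \<open>multiplier_cstar_posI\<close> it is enough to test m on vectors v c, which are
  dense; there the form is v m v conjugated by c.\<close>

lemma cstar_pos_of_conj:
  assumes m: "hermitian m" and pos: "mult_emb v * m * mult_emb v \<in> cstar_pos"
  shows "m \<in> cstar_pos"
proof (rule multiplier_cstar_posI[OF m])
  fix c
  show "star c * lmult m c \<in> cstar_pos"
  proof (rule dense_induct[where P = "\<lambda>c. star c * lmult m c \<in> cstar_pos"])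
    have "continuous_on UNIV (\<lambda>c. star c * lmult m c)"
      by (intro continuous_on_mult linear_continuous_on bounded_linear_lmult bounded_linear_star)
    from closed_vimage[OF closed_cstar_pos this]
    show "closed {c. star c * lmult m c \<in> cstar_pos}" by (simp add: vimage_def)
    fix c
    have "mult_emb (star (v * c) * lmult m (v * c))
        = star (mult_emb c) * (mult_emb v * m * mult_emb v) * mult_emb c"
    proof -
      have "mult_emb (lmult m (v * c)) = m * (mult_emb v * mult_emb c)"
        by (simp only: mult_emb_lmult[of m "v * c", symmetric] mult_emb_simps(5))
      moreover have "mult_emb (star (v * c)) = star (mult_emb c) * mult_emb v"
        by (simp only: star_mult star_v mult_emb_simps)
      ultimately show ?thesis by (simp only: mult_emb_simps(5) mult.assoc)
    qed
    then show "star (v * c) * lmult m (v * c) \<in> cstar_pos"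
      using cstar_pos_conj[OF pos, of "mult_emb c"] cstar_pos_mult_emb by metis
  qed
qed

end

section \<open>Order unit C*-Segal algebras\<close>

text \<open>For x = 0 the infimum is not attained, because l > 0 is required; hence the
  epsilon.\<close>

lemma Inf_positive_upper_bounds:
  assumes "(x :: real) \<ge> 0"
  shows "Inf {l. l > 0 \<and> x \<le> l} = x"
proof (rule antisym)
  show "x \<le> Inf {l. l > 0 \<and> x \<le> l}"
    by (rule cInf_greatest) (use assms in \<open>auto intro: exI[of _ "x + 1"]\<close>)
  show "Inf {l. l > 0 \<and> x \<le> l} \<le> x"
  proof (rule field_le_epsilon)
    fix e :: real assume "e > 0"
    then show "Inf {l. l > 0 \<and> x \<le> l} \<le> x + e"
      using assms by (intro cInf_lower bdd_belowI[of _ 0]) auto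
  qed
qed

section \<open>The order norm of v d v, and the passage from the bimodule to the order unit\<close>

locale segal_square =
  fixes \<iota> :: "'a::complex_banach_algebra \<Rightarrow> 'c::cstar_algebra" and u :: 'a and v :: 'c
  assumes segal: "cstar_segal \<iota>" and u: "strictly_positive \<iota> u" and v: "v = pos_sqrt (\<iota> u)"
begin

lemma u_pos: "\<iota> u \<in> cstar_pos"
  using u by (simp add: strictly_positive_def segal_pos_def)

lemma v_square: "v * v = \<iota> u"
  unfolding v by (rule pos_sqrt[OF u_pos])

sublocale dense_positive v
proof
  show "v \<in> cstar_pos" unfolding v by (rule pos_sqrt[OF u_pos])
  have "range (\<lambda>c. \<iota> u * c) \<subseteq> range (\<lambda>c. v * c)"
    by (auto simp: mult.assoc simp flip: v_square)
  then show "closure (range (\<lambda>c. v * c)) = UNIV"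
    using strictly_positive_dense[OF segal u] closure_mono by blast
qed

lemma emb_add: "\<iota> (a + b) = \<iota> a + \<iota> b"
  and emb_scaleC: "\<iota> (scaleC k a) = scaleC k (\<iota> a)"
  and emb_mult: "\<iota> (a * b) = \<iota> a * \<iota> b"
  and emb_eq_iff: "\<iota> a = \<iota> b \<longleftrightarrow> a = b"
  and ideal_right: "\<iota> a * c \<in> range \<iota>"
  and ideal_left: "c * \<iota> a \<in> range \<iota>"
  using segal by (auto simp: cstar_segal_def Vector_Spaces.linear_iff inj_def)

lemma emb_scaleR: "\<iota> (r *\<^sub>R a) = r *\<^sub>R \<iota> a"
  by (simp add: emb_scaleC flip: scaleC_of_real)

lemma emb_minus: "\<iota> (- a) = - \<iota> a"
  using emb_scaleR[of "-1" a] by simp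

lemma emb_diff: "\<iota> (a - b) = \<iota> a - \<iota> b"
  using emb_add[of a "- b"] by (simp add: emb_minus)

lemmas emb_simps = emb_add emb_diff emb_minus emb_scaleR emb_scaleC emb_mult

lemma hermitian_of_conj:
  assumes "hermitian c" "mult_emb c = mult_emb v * d * mult_emb v"
  shows "hermitian d"
proof -
  have "mult_emb v * star d * mult_emb v = star (mult_emb c)"
    unfolding assms(2) by (simp add: star_mult mult.assoc flip: mult_emb_simps(8))
  also have "\<dots> = mult_emb c" using assms(1) by (simp add: hermitian_def flip: mult_emb_simps(8))
  finally show ?thesis
    unfolding hermitian_def assms(2) by (rule multiplier_cancel)
qed

text \<open>The elements l u + a and l u - a are l + d and l - d conjugated by v. Cancelling v by
  \<open>cstar_pos_of_conj\<close> leaves the order description of the norm in M(C).\<close>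

lemma between_iff_norm:
  assumes d: "hermitian d" and a: "mult_emb (\<iota> a) = mult_emb v * d * mult_emb v" and "l > 0"
  shows "segal_le \<iota> (- (l *\<^sub>R u)) a \<and> segal_le \<iota> a (l *\<^sub>R u) \<longleftrightarrow> norm d \<le> l"
proof -
  have l: "hermitian (l *\<^sub>R 1 :: 'c multiplier)" by (simp add: hermitian_scaleR hermitian_one)
  have iff: "mult_emb v * m * mult_emb v \<in> cstar_pos \<longleftrightarrow> m \<in> cstar_pos" if "hermitian m" for m
    using cstar_pos_of_conj[OF that] cstar_pos_conj[of m "mult_emb v"]
    by (auto simp flip: mult_emb_simps(8))
  have uu: "mult_emb (\<iota> u) = mult_emb v * mult_emb v" by (simp add: mult_emb_simps flip: v_square)
  have "mult_emb v * (l *\<^sub>R 1 + d) * mult_emb v = mult_emb (\<iota> (a - - (l *\<^sub>R u)))"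
    by (simp add: emb_simps mult_emb_simps a uu algebra_simps)
  then have 1: "segal_le \<iota> (- (l *\<^sub>R u)) a \<longleftrightarrow> l *\<^sub>R 1 + d \<in> cstar_pos"
    using iff[OF hermitian_add[OF l d]] cstar_pos_mult_emb[of "\<iota> (a - - (l *\<^sub>R u))"]
    unfolding segal_le_def segal_pos_def mem_Collect_eq by metis
  have "mult_emb v * (l *\<^sub>R 1 - d) * mult_emb v = mult_emb (\<iota> (l *\<^sub>R u - a))"
    by (simp add: emb_simps mult_emb_simps a uu algebra_simps)
  then have 2: "segal_le \<iota> a (l *\<^sub>R u) \<longleftrightarrow> l *\<^sub>R 1 - d \<in> cstar_pos"
    using iff[OF hermitian_diff[OF l d]] cstar_pos_mult_emb[of "\<iota> (l *\<^sub>R u - a)"]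
    unfolding segal_le_def segal_pos_def mem_Collect_eq by metis
  have "norm d \<le> l \<longleftrightarrow> l *\<^sub>R 1 + d \<in> cstar_pos \<and> l *\<^sub>R 1 - d \<in> cstar_pos"
    using norm_le_of_cstar_pos[OF d, of l] hermitian_cstar_pos_minus[OF d, of l]
      hermitian_cstar_pos_minus[OF hermitian_minus[OF d], of l] \<open>l > 0\<close> by auto
  then show ?thesis using 1 2 by blast
qed

lemma order_norm_conj:
  assumes "hermitian d" "mult_emb (\<iota> a) = mult_emb v * d * mult_emb v"
  shows "Inf {l. l > 0 \<and> segal_le \<iota> (- (l *\<^sub>R u)) a \<and> segal_le \<iota> a (l *\<^sub>R u)} = norm d"
proof -
  have "{l. l > 0 \<and> segal_le \<iota> (- (l *\<^sub>R u)) a \<and> segal_le \<iota> a (l *\<^sub>R u)} = {l. l > 0 \<and> norm d \<le> l}"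
    using between_iff_norm[OF assms] by blast
  then show ?thesis by (simp add: Inf_positive_upper_bounds)
qed

lemma order_unit_of_bimodule:
  fixes D :: "'c multiplier set"
  assumes star: "star ` D = D"
    and A: "mult_emb ` range \<iota> = {mult_emb v * d * mult_emb v | d. d \<in> D}"
    and norm_D: "\<forall>d\<in>D. hermitian d \<longrightarrow>
      (\<forall>a. mult_emb (\<iota> a) = mult_emb v * d * mult_emb v \<longrightarrow> norm a = norm_MC d)"
  shows "order_unit_cstar_segal \<iota> u"
proof -
  have A': "\<exists>d\<in>D. mult_emb (\<iota> a) = mult_emb v * d * mult_emb v" for a
    using A by blast
  show ?thesis
    unfolding order_unit_cstar_segal_def
  proof (intro conjI allI impI)
    show "segal_self_adjoint \<iota>"
      unfolding segal_self_adjoint_def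
    proof (clarify)
      fix a
      obtain d where d: "d \<in> D" "mult_emb (\<iota> a) = mult_emb v * d * mult_emb v" using A' by blast
      have "mult_emb (star (\<iota> a)) = mult_emb v * star d * mult_emb v"
        unfolding mult_emb_simps(8) d(2)
        by (simp add: star_mult mult.assoc flip: mult_emb_simps(8))
      moreover have "star d \<in> D" using d(1) star by blast
      ultimately have "mult_emb (star (\<iota> a)) \<in> mult_emb ` range \<iota>" unfolding A by blast
      then show "star (\<iota> a) \<in> range \<iota>" by auto
    qed
    show "order_unit \<iota> u"
      unfolding order_unit_def
    proof (intro conjI allI impI)
      show "u \<in> segal_pos \<iota>" using u by (simp add: strictly_positive_def)
      fix x assume x: "hermitian (\<iota> x)"
      obtain d where d: "d \<in> D" "mult_emb (\<iota> x) = mult_emb v * d * mult_emb v" using A' by blast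
      \<comment> \<open>The definition of an order unit asks for l > 0, which \<open>norm d\<close>
        alone does not give when d = 0.\<close>
      have "norm d + 1 > 0" by (simp add: add_nonneg_pos)
      then show "\<exists>l>0. segal_le \<iota> x (l *\<^sub>R u)"
        using between_iff_norm[OF hermitian_of_conj[OF x d(2)] d(2), of "norm d + 1"] by force
    qed
    fix a assume a: "hermitian (\<iota> a)"
    obtain d where d: "d \<in> D" "mult_emb (\<iota> a) = mult_emb v * d * mult_emb v" using A' by blast
    have hd: "hermitian d" by (rule hermitian_of_conj[OF a d(2)])
    show "norm a = Inf {l. l > 0 \<and> segal_le \<iota> (- (l *\<^sub>R u)) a \<and> segal_le \<iota> a (l *\<^sub>R u)}"
      using order_norm_conj[OF hd d(2)] norm_D d hd by (simp add: norm_multiplier_def)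
  qed (rule segal)
qed

end

section \<open>Bounded multiplication of C on A under an order unit\<close>

locale order_unit_segal = segal_square \<iota> u v
  for \<iota> :: "'a::complex_banach_algebra \<Rightarrow> 'c::cstar_algebra" and u :: 'a and v :: 'c +
  assumes iso: "star_isometric \<iota>" and unit: "order_unit_cstar_segal \<iota> u"
begin

lemma star_range: "\<exists>b. \<iota> b = star (\<iota> a) \<and> norm b = norm a"
proof -
  have "star (\<iota> a) \<in> range \<iota>"
    using unit unfolding order_unit_cstar_segal_def segal_self_adjoint_def by blast
  then obtain b where "\<iota> b = star (\<iota> a)" by (metis rangeE)
  with iso show ?thesis unfolding star_isometric_def by blast
qed

text \<open>Here the convention that star is isometric on A enters: it keeps the norm of the real
  part below that of a.\<close>

lemma re_part_range: "\<exists>b. \<iota> b = re_part (\<iota> a) \<and> norm b \<le> norm a"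
proof -
  obtain c where c: "\<iota> c = star (\<iota> a)" "norm c = norm a" using star_range by blast
  have "\<iota> ((1/2) *\<^sub>R (a + c)) = re_part (\<iota> a)" by (simp add: emb_simps c re_part_def)
  moreover have "norm ((1/2) *\<^sub>R (a + c)) \<le> norm a"
    using norm_triangle_ineq[of a c] c(2) by simp
  ultimately show ?thesis by blast
qed

lemma im_part_range: "\<exists>b. \<iota> b = im_part (\<iota> a) \<and> norm b \<le> norm a"
  using re_part_range[of "scaleC (- \<i>) a"] by (simp add: im_part_def emb_scaleC norm_scaleC)

lemma norm_eq_Inf:
  "hermitian (\<iota> a) \<Longrightarrow>
    norm a = Inf {l. l > 0 \<and> segal_le \<iota> (- (l *\<^sub>R u)) a \<and> segal_le \<iota> a (l *\<^sub>R u)}"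
  using unit unfolding order_unit_cstar_segal_def by blast

lemma order_unit_bound:
  assumes "hermitian (\<iota> a)"
  obtains l where "l > 0" "l *\<^sub>R \<iota> u - \<iota> a \<in> cstar_pos"
proof -
  have "order_unit \<iota> u" using unit by (simp add: order_unit_cstar_segal_def)
  then obtain l where "l > 0" "segal_le \<iota> a (l *\<^sub>R u)"
    using assms unfolding order_unit_def by blast
  then show thesis
    by (intro that[of l]) (simp_all add: segal_le_def segal_pos_def emb_simps)
qed

lemma norm_le_of_between:
  assumes "hermitian (\<iota> a)" "l > 0" "l *\<^sub>R \<iota> u - \<iota> a \<in> cstar_pos" "l *\<^sub>R \<iota> u + \<iota> a \<in> cstar_pos"
  shows "norm a \<le> l"
  unfolding norm_eq_Inf[OF assms(1)]
  by (rule cInf_lower) (use assms in \<open>auto intro!: bdd_belowI[of _ 0]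
    simp: segal_le_def segal_pos_def emb_simps add.commute\<close>)

lemma u_mono: "l *\<^sub>R \<iota> u + c \<in> cstar_pos \<Longrightarrow> l \<le> k \<Longrightarrow> k *\<^sub>R \<iota> u + c \<in> cstar_pos"
  using cstar_pos_add[OF cstar_pos_scaleR[OF u_pos, of "k - l"], of "l *\<^sub>R \<iota> u + c"]
  by (simp add: algebra_simps)

text \<open>The inequality for l is strict because only the infimum is known, not that it is
  attained. One-sided bounds for a and -a show that the set is nonempty.\<close>

lemma between_norm:
  assumes a: "hermitian (\<iota> a)" and "norm a < l"
  shows "l *\<^sub>R \<iota> u - \<iota> a \<in> cstar_pos" "l *\<^sub>R \<iota> u + \<iota> a \<in> cstar_pos"
proof -
  let ?S = "{l. l > 0 \<and> segal_le \<iota> (- (l *\<^sub>R u)) a \<and> segal_le \<iota> a (l *\<^sub>R u)}"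
  obtain l1 where l1: "l1 > 0" "l1 *\<^sub>R \<iota> u - \<iota> a \<in> cstar_pos" by (rule order_unit_bound[OF a])
  have "hermitian (\<iota> (- a))" using a by (simp add: emb_minus hermitian_minus)
  then obtain l2 where l2: "l2 > 0" "l2 *\<^sub>R \<iota> u - \<iota> (- a) \<in> cstar_pos" by (rule order_unit_bound)
  have "max l1 l2 *\<^sub>R \<iota> u + - \<iota> a \<in> cstar_pos" by (rule u_mono[of l1]) (use l1 in auto)
  moreover have "max l1 l2 *\<^sub>R \<iota> u + \<iota> a \<in> cstar_pos"
    by (rule u_mono[of l2]) (use l2 in \<open>auto simp: emb_minus\<close>)
  ultimately have "max l1 l2 \<in> ?S"
    using l1(1) by (simp add: segal_le_def segal_pos_def emb_simps add.commute)
  then have "?S \<noteq> {}" by blast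
  moreover have "Inf ?S < l" using norm_eq_Inf[OF a] assms(2) by simp
  ultimately obtain k where k: "k \<in> ?S" "k < l" by (meson cInf_lessD)
  then have "k *\<^sub>R \<iota> u + - \<iota> a \<in> cstar_pos" "k *\<^sub>R \<iota> u + \<iota> a \<in> cstar_pos"
    by (simp_all add: segal_le_def segal_pos_def emb_simps add.commute)
  then show "l *\<^sub>R \<iota> u - \<iota> a \<in> cstar_pos" "l *\<^sub>R \<iota> u + \<iota> a \<in> cstar_pos"
    using u_mono[of k "- \<iota> a" l] u_mono[of k "\<iota> a" l] k(2) by simp_all
qed

lemma conj_u_bound: "\<exists>K>0. \<forall>c. norm c \<le> 1 \<longrightarrow> K *\<^sub>R \<iota> u - c * \<iota> u * star c \<in> cstar_pos"
proof -
  define B where "B n = {c. real n *\<^sub>R \<iota> u - c * \<iota> u * star c \<in> cstar_pos}" for n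
  have "closed (B n)" for n
  proof -
    have "continuous_on UNIV (\<lambda>c. real n *\<^sub>R \<iota> u - c * \<iota> u * star c)"
      by (intro continuous_intros linear_continuous_on bounded_linear_star)
    from closed_vimage[OF closed_cstar_pos this] show ?thesis by (simp add: B_def vimage_def)
  qed
  moreover have "(\<Union>n. B n) = UNIV"
  proof (intro equalityI subsetI)
    fix c :: 'c
    obtain b where b: "\<iota> b = c * \<iota> u" using ideal_left by (metis rangeE)
    obtain a where a: "\<iota> a = c * \<iota> u * star c" using ideal_right[of b "star c"] b by (metis rangeE)
    have "hermitian (\<iota> a)"
      using hermitian_conj[OF cstar_pos_hermitian[OF u_pos], of "star c"] by (simp add: a star_star)
    then obtain l where l: "l > 0" "l *\<^sub>R \<iota> u - \<iota> a \<in> cstar_pos" by (rule order_unit_bound)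
    have "real (nat \<lceil>l\<rceil>) *\<^sub>R \<iota> u + - \<iota> a \<in> cstar_pos"
      by (rule u_mono[of l]) (use l in \<open>auto simp: real_nat_ceiling_ge\<close>)
    then have "c \<in> B (nat \<lceil>l\<rceil>)" by (simp add: B_def a)
    then show "c \<in> (\<Union>n. B n)" by blast
  qed simp
  ultimately obtain n x0 e where e: "e > 0" "ball x0 e \<subseteq> B n" by (rule Baire_ball)
  have small: "(4 * real n) *\<^sub>R \<iota> u - x * \<iota> u * star x \<in> cstar_pos" if "norm x < e" for x
  proof -
    have "x0 \<in> B n" "x0 + x \<in> B n" using e that by (auto simp: subset_eq dist_norm)
    then have 1: "real n *\<^sub>R \<iota> u - (x0 + x) * \<iota> u * star (x0 + x) \<in> cstar_pos"
      and 2: "real n *\<^sub>R \<iota> u - x0 * \<iota> u * star x0 \<in> cstar_pos" by (auto simp: B_def)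
    \<comment> \<open>The parallelogram law for x = (x0 + x) - x0 and the sum y of these two points:
      dropping the positive y term leaves x u \<open>star x\<close> \<le> 2 n u + 2 n u.\<close>
    define y where "y = x0 + x + x0"
    have 3: "y * \<iota> u * star y \<in> cstar_pos"
      using cstar_pos_conj[OF u_pos, of "star y"] by (simp add: star_star)
    have "(4 * real n) *\<^sub>R \<iota> u - x * \<iota> u * star x
        = 2 *\<^sub>R (real n *\<^sub>R \<iota> u - (x0 + x) * \<iota> u * star (x0 + x))
          + 2 *\<^sub>R (real n *\<^sub>R \<iota> u - x0 * \<iota> u * star x0) + y * \<iota> u * star y"
    proof -
      have "2 *\<^sub>R (real n *\<^sub>R \<iota> u - (x0 + x) * \<iota> u * star (x0 + x))
          + 2 *\<^sub>R (real n *\<^sub>R \<iota> u - x0 * \<iota> u * star x0)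
        = (4 * real n) *\<^sub>R \<iota> u - 2 *\<^sub>R ((x0 + x) * \<iota> u * star (x0 + x)) - 2 *\<^sub>R (x0 * \<iota> u * star x0)"
        by (simp add: scaleR_diff_right flip: scaleR_left.add)
      moreover have "y * \<iota> u * star y
        = 2 *\<^sub>R ((x0 + x) * \<iota> u * star (x0 + x)) + 2 *\<^sub>R (x0 * \<iota> u * star x0) - x * \<iota> u * star x"
        by (simp add: y_def star_add algebra_simps scaleR_2)
      ultimately show ?thesis by simp
    qed
    then show ?thesis
      using cstar_pos_add[OF cstar_pos_add[OF cstar_pos_scaleR[OF 1, of 2] cstar_pos_scaleR[OF 2, of 2]] 3]
      by simp
  qed
  \<comment> \<open>Scaling c by e / 2 puts it into the ball; undoing this multiplies 4 n by 4 /
    e^2. The 1 makes K positive when n = 0.\<close>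
  define K where "K = 16 * real n / e\<^sup>2 + 1"
  have "K *\<^sub>R \<iota> u - c * \<iota> u * star c \<in> cstar_pos" if "norm c \<le> 1" for c
  proof -
    have "norm ((e / 2) *\<^sub>R c) \<le> e / 2 * 1" unfolding norm_scaleR using that e by (intro mult_mono) auto
    also have "\<dots> < e" using e by simp
    finally have "(4 * real n) *\<^sub>R \<iota> u - ((e / 2) *\<^sub>R c) * \<iota> u * star ((e / 2) *\<^sub>R c) \<in> cstar_pos"
      by (rule small)
    from cstar_pos_scaleR[OF this, of "4 / e\<^sup>2"] e
    have "(16 * real n / e\<^sup>2) *\<^sub>R \<iota> u + - (c * \<iota> u * star c) \<in> cstar_pos"
      by (simp add: scaleR_diff_right star_scaleR power2_eq_square)
    from u_mono[OF this, of K] show ?thesis by (simp add: K_def)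
  qed
  moreover have "K > 0" using e by (simp add: K_def add_nonneg_pos)
  ultimately show ?thesis by blast
qed

text \<open>\<open>\<plusminus>(c p + p c\<^sup>*) \<le> p + c p c\<^sup>*\<close>, as \<open>p = q\<^sup>2\<close> and \<open>(q \<plusminus> c q) (q \<plusminus> c q)\<^sup>* \<ge> 0\<close>.\<close>

lemma mult_add_star_bound:
  assumes K: "K *\<^sub>R \<iota> u - c * \<iota> u * star c \<in> cstar_pos"
    and p: "p \<in> cstar_pos" "r *\<^sub>R \<iota> u - p \<in> cstar_pos" and "r \<ge> 0"
  shows "(r * (1 + K)) *\<^sub>R \<iota> u - (c * p + p * star c) \<in> cstar_pos"
    and "(r * (1 + K)) *\<^sub>R \<iota> u + (c * p + p * star c) \<in> cstar_pos"
proof -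
  define q where "q = pos_sqrt p"
  have q: "q * q = p" "star q = q"
    using pos_sqrt[OF p(1)] cstar_pos_hermitian unfolding q_def hermitian_def by blast+
  have plus: "(q + c * q) * star (q + c * q) \<in> cstar_pos"
    and minus: "(q - c * q) * star (q - c * q) \<in> cstar_pos"
    using cstar_posI[of "star (q + c * q)"] cstar_posI[of "star (q - c * q)"] by (simp_all add: star_star)
  have qq: "(q + c * q) * star (q + c * q) = p + (c * p + p * star c) + c * p * star c"
    "(q - c * q) * star (q - c * q) = p - (c * p + p * star c) + c * p * star c"
    by (simp_all add: star_add star_diff star_mult q(2) algebra_simps flip: q(1))
  have "c * (r *\<^sub>R \<iota> u - p) * star c \<in> cstar_pos"
    using cstar_pos_conj[OF p(2), of "star c"] by (simp add: star_star)
  from cstar_pos_add[OF cstar_pos_add[OF this cstar_pos_scaleR[OF K \<open>r \<ge> 0\<close>]] p(2)]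
  have rest: "(r * (1 + K)) *\<^sub>R \<iota> u - p - c * p * star c \<in> cstar_pos"
    by (simp add: algebra_simps)
  show "(r * (1 + K)) *\<^sub>R \<iota> u + (c * p + p * star c) \<in> cstar_pos"
    using cstar_pos_add[OF rest plus] unfolding qq by (simp add: algebra_simps)
  show "(r * (1 + K)) *\<^sub>R \<iota> u - (c * p + p * star c) \<in> cstar_pos"
    using cstar_pos_add[OF rest minus] unfolding qq by (simp add: algebra_simps)
qed

text \<open>The order unit formula measures hermitian elements only, so the symmetrized product c b
  + b \<open>star c\<close> is treated first, for hermitian b. Then c b is recovered from the
  symmetrized products for c and i c, and general b from its real and imaginary parts.\<close>

lemma mult_left_bounded: "\<exists>M\<ge>0. \<forall>c b x. \<iota> x = c * \<iota> b \<longrightarrow> norm x \<le> M * norm c * norm b"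
proof -
  obtain K where "K > 0" and K: "\<And>c. norm c \<le> 1 \<Longrightarrow> K *\<^sub>R \<iota> u - c * \<iota> u * star c \<in> cstar_pos"
    using conj_u_bound by blast
  \<comment> \<open>The sum of 4 (1 + K), from p \<le> 4 u, and 2 (1 + K), from 2 u, in the
    splitting b = p - 2 u.\<close>
  define M where "M = 6 * (1 + K)"
  have "M > 0" using \<open>K > 0\<close> by (simp add: M_def)
  have sym: "norm x \<le> M"
    if c: "norm c \<le> 1" and b: "hermitian (\<iota> b)" "norm b \<le> 1"
      and x: "\<iota> x = c * \<iota> b + \<iota> b * star c" for c b x
  proof (rule norm_le_of_between)
    \<comment> \<open>Shifting b by 2 u makes it positive, as \<open>mult_add_star_bound\<close>
      wants. The shift by 2 rather than 1 is due to the strict inequality in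
      \<open>between_norm\<close>.\<close>
    define p where "p = 2 *\<^sub>R \<iota> u + \<iota> b"
    have p: "p \<in> cstar_pos" and "2 *\<^sub>R \<iota> u - \<iota> b \<in> cstar_pos"
      using between_norm[OF b(1), of 2] b(2) by (simp_all add: p_def)
    then have p4: "4 *\<^sub>R \<iota> u - p \<in> cstar_pos"
      by (simp add: p_def diff_diff_eq[symmetric] flip: scaleR_left_diff_distrib)
    have u2: "2 *\<^sub>R \<iota> u \<in> cstar_pos" "2 *\<^sub>R \<iota> u - 2 *\<^sub>R \<iota> u \<in> cstar_pos"
      using cstar_pos_scaleR[OF u_pos] by (simp_all add: cstar_pos_zero)
    have split: "c * \<iota> b + \<iota> b * star c
        = (c * p + p * star c) - (c * (2 *\<^sub>R \<iota> u) + (2 *\<^sub>R \<iota> u) * star c)"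
      by (simp add: p_def algebra_simps)
    have M: "M *\<^sub>R \<iota> u = (4 * (1 + K)) *\<^sub>R \<iota> u + (2 * (1 + K)) *\<^sub>R \<iota> u"
      by (simp add: M_def flip: scaleR_left.add)
    show "M *\<^sub>R \<iota> u - \<iota> x \<in> cstar_pos"
      using cstar_pos_add[OF mult_add_star_bound(1)[OF K[OF c] p p4] mult_add_star_bound(2)[OF K[OF c] u2]]
      unfolding x split M by (simp add: algebra_simps)
    show "M *\<^sub>R \<iota> u + \<iota> x \<in> cstar_pos"
      using cstar_pos_add[OF mult_add_star_bound(2)[OF K[OF c] p p4] mult_add_star_bound(1)[OF K[OF c] u2]]
      unfolding x split M by (simp add: algebra_simps)
    show "hermitian (\<iota> x)"
      using b(1) by (simp add: x hermitian_def star_add star_mult star_star add.commute)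
  qed fact
  have herm: "norm x \<le> M"
    if c: "norm c \<le> 1" and b: "hermitian (\<iota> b)" "norm b \<le> 1" and x: "\<iota> x = c * \<iota> b" for c b x
  proof -
    have range: "\<exists>y. \<iota> y = d * \<iota> b + \<iota> b * star d" for d
    proof -
      obtain y z where "\<iota> y = d * \<iota> b" "\<iota> z = \<iota> b * star d"
        using ideal_left ideal_right by (metis rangeE)
      then have "\<iota> (y + z) = d * \<iota> b + \<iota> b * star d" by (simp add: emb_add)
      then show ?thesis by blast
    qed
    obtain y where y: "\<iota> y = c * \<iota> b + \<iota> b * star c" using range by blast
    obtain z where z: "\<iota> z = scaleC \<i> c * \<iota> b + \<iota> b * star (scaleC \<i> c)" using range by blast
    have "norm y \<le> M" by (rule sym[OF c b y])
    have "norm z \<le> M" by (rule sym[OF _ b z]) (simp add: norm_scaleC c)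
    have "\<iota> ((1/2) *\<^sub>R (y + scaleC (- \<i>) z)) = (1/2) *\<^sub>R (2 *\<^sub>R \<iota> x)"
      by (simp add: emb_simps y z x star_scaleC mult_scaleC_left mult_scaleC_right scaleC_add_right
          scaleC_diff_right scaleC_scaleC scaleC_minus_left scaleC_one scaleC_minus_right scaleR_2
          del: scaleR_half_double)
    then have "x = (1/2) *\<^sub>R (y + scaleC (- \<i>) z)" by (simp add: emb_eq_iff)
    then have "norm x \<le> (norm y + norm z) / 2"
      using norm_triangle_ineq[of y "scaleC (- \<i>) z"] by (simp add: norm_scaleC)
    then show ?thesis using \<open>norm y \<le> M\<close> \<open>norm z \<le> M\<close> by simp
  qed
  have unit: "norm x \<le> 2 * M" if c: "norm c \<le> 1" and b: "norm b \<le> 1" and x: "\<iota> x = c * \<iota> b" for c b x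
  proof -
    obtain b1 where b1: "\<iota> b1 = re_part (\<iota> b)" "norm b1 \<le> norm b" using re_part_range by blast
    obtain b2 where b2: "\<iota> b2 = im_part (\<iota> b)" "norm b2 \<le> norm b" using im_part_range by blast
    obtain x1 x2 where x1: "\<iota> x1 = c * \<iota> b1" and x2: "\<iota> x2 = c * \<iota> b2"
      using ideal_left by (metis rangeE)
    have "norm x1 \<le> M" by (rule herm[OF c _ _ x1]) (use b1 b in \<open>simp_all add: hermitian_re_part\<close>)
    moreover have "norm x2 \<le> M" by (rule herm[OF c _ _ x2]) (use b2 b in \<open>simp_all add: hermitian_im_part\<close>)
    moreover have "\<iota> x = \<iota> (x1 + scaleC \<i> x2)"
      using re_im_decomp[of "\<iota> b"]
      by (metis b1(1) b2(1) distrib_left emb_add emb_scaleC mult_scaleC_right x x1 x2)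
    ultimately show ?thesis
      using norm_triangle_ineq[of x1 "scaleC \<i> x2"] by (simp add: emb_eq_iff norm_scaleC)
  qed
  have "norm x \<le> 2 * M * norm c * norm b" if x: "\<iota> x = c * \<iota> b" for c b x
  proof (cases "c = 0 \<or> b = 0")
    case True
    moreover have "\<iota> 0 = 0" using emb_scaleR[of 0 0] by simp
    ultimately have "x = 0" using x emb_eq_iff[of x 0] by auto
    then show ?thesis using \<open>M > 0\<close> by simp
  next
    case False
    have "\<iota> ((1 / (norm c * norm b)) *\<^sub>R x) = ((1 / norm c) *\<^sub>R c) * \<iota> ((1 / norm b) *\<^sub>R b)"
      by (simp add: emb_scaleR x)
    from unit[OF _ _ this] False have "norm ((1 / (norm c * norm b)) *\<^sub>R x) \<le> 2 * M" by simp
    then show ?thesis using False by (simp add: field_simps)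
  qed
  then show ?thesis using \<open>M > 0\<close> by (intro exI[of _ "2 * M"]) auto
qed

definition bnd :: real where
  "bnd = (SOME M. M \<ge> 0 \<and> (\<forall>c b x. \<iota> x = c * \<iota> b \<longrightarrow> norm x \<le> M * norm c * norm b))"

lemma bnd_nonneg: "bnd \<ge> 0" and mult_left_bound: "\<iota> x = c * \<iota> b \<Longrightarrow> norm x \<le> bnd * norm c * norm b"
  using someI_ex[OF mult_left_bounded] unfolding bnd_def by blast+

lemma mult_right_bound:
  assumes "\<iota> x = \<iota> b * c"
  shows "norm x \<le> bnd * norm c * norm b"
proof -
  obtain y where y: "\<iota> y = star (\<iota> x)" "norm y = norm x" using star_range by blast
  obtain d where d: "\<iota> d = star (\<iota> b)" "norm d = norm b" using star_range by blast
  have "\<iota> y = star c * \<iota> d" by (simp add: y d assms star_mult)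
  from mult_left_bound[OF this] show ?thesis by (simp add: y d)
qed

section \<open>The set vCv and its closedness\<close>

definition V :: "'c set" where "V = {v * c * v | c. c \<in> UNIV}"

lemma VI: "v * c * v \<in> V" by (auto simp: V_def)

lemma V_add: "x \<in> V \<Longrightarrow> y \<in> V \<Longrightarrow> x + y \<in> V"
proof -
  assume "x \<in> V" "y \<in> V"
  then obtain c d where "x = v * c * v" "y = v * d * v" by (auto simp: V_def)
  then have "x + y = v * (c + d) * v" by (simp add: algebra_simps)
  then show ?thesis by (simp add: VI)
qed

lemma V_scaleC: "x \<in> V \<Longrightarrow> scaleC k x \<in> V"
proof -
  assume "x \<in> V"
  then obtain c where "x = v * c * v" by (auto simp: V_def)
  then have "scaleC k x = v * scaleC k c * v" by (simp add: mult_scaleC_left mult_scaleC_right)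
  then show ?thesis by (simp add: VI)
qed

lemma V_star: "x \<in> V \<Longrightarrow> star x \<in> V"
proof -
  assume "x \<in> V"
  then obtain c where "x = v * c * v" by (auto simp: V_def)
  then have "star x = v * star c * v" by (simp add: star_mult mult.assoc)
  then show ?thesis by (simp add: VI)
qed

lemma norm_conj_hermitian:
  assumes "hermitian d" "mult_emb (\<iota> a) = mult_emb v * d * mult_emb v"
  shows "norm a = norm d"
proof -
  have "star (mult_emb (\<iota> a)) = mult_emb (\<iota> a)"
    using assms by (simp add: star_mult hermitian_def mult.assoc flip: mult_emb_simps(8))
  then have "hermitian (\<iota> a)" by (simp add: hermitian_def flip: mult_emb_simps(8))
  then show ?thesis using norm_eq_Inf order_norm_conj[OF assms] by simp
qed

text \<open>For hermitian e the two norms agree by \<open>norm_conj_hermitian\<close>; the factor 2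
  comes from adding real and imaginary parts. This estimate is what allows division by v in the
  limit.\<close>

lemma norm_le_norm_conj:
  assumes x: "\<iota> x = v * e * v"
  shows "norm e \<le> 2 * norm x"
proof -
  have part: "norm (re_part d) \<le> norm y" if y: "\<iota> y = v * d * v" for y d
  proof -
    obtain z where z: "\<iota> z = re_part (\<iota> y)" "norm z \<le> norm y" using re_part_range by blast
    have "\<iota> z = v * re_part d * v"
      by (simp add: z y re_part_def star_mult algebra_simps)
    then have "norm z = norm (mult_emb (re_part d))"
      by (intro norm_conj_hermitian) (simp_all add: hermitian_re_part mult_emb_simps)
    with z(2) show ?thesis by simp
  qed
  have "\<iota> (scaleC (- \<i>) x) = v * scaleC (- \<i>) e * v"
    by (simp add: emb_scaleC x mult_scaleC_left mult_scaleC_right)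
  from part[OF this] have "norm (im_part e) \<le> norm x" by (simp add: im_part_def norm_scaleC)
  moreover have "norm (re_part e) \<le> norm x" by (rule part[OF x])
  moreover have "norm e \<le> norm (re_part e) + norm (scaleC \<i> (im_part e))"
    using norm_triangle_ineq re_im_decomp[of e] by metis
  ultimately show ?thesis by (simp add: norm_scaleC)
qed

text \<open>The sequence is Cauchy in the norm of A, its limit is taken in that of C. By
  \<open>norm_le_norm_conj\<close> the middle factors are Cauchy in C, and their limit is the middle
  factor of z.\<close>

lemma V_limit:
  assumes X: "Cauchy X" and V: "\<And>n. \<iota> (X n) \<in> V" and lim: "(\<lambda>n. \<iota> (X n)) \<longlonglongrightarrow> z"
  shows "z \<in> V"
proof -
  have "\<forall>n. \<exists>e. \<iota> (X n) = v * e * v" using V by (auto simp: V_def)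
  then obtain E where E: "\<And>n. \<iota> (X n) = v * E n * v" by metis
  have le: "norm (E m - E n) \<le> 2 * norm (X m - X n)" for m n
    by (rule norm_le_norm_conj) (simp add: emb_diff E algebra_simps)
  have "Cauchy E"
  proof (rule CauchyI)
    fix e :: real assume "e > 0"
    then obtain N where N: "\<And>m n. m \<ge> N \<Longrightarrow> n \<ge> N \<Longrightarrow> norm (X m - X n) < e / 2"
      using CauchyD[OF X, of "e / 2"] by auto
    then have "norm (E m - E n) < e" if "m \<ge> N" "n \<ge> N" for m n
      using le[of m n] N[OF that] by linarith
    then show "\<exists>N. \<forall>m\<ge>N. \<forall>n\<ge>N. norm (E m - E n) < e" by blast
  qed
  then obtain c where c: "E \<longlonglongrightarrow> c" using Cauchy_convergent convergent_def by blast
  have "(\<lambda>n. v * E n * v) \<longlonglongrightarrow> v * c * v" by (intro tendsto_intros c)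
  then have "z = v * c * v" using lim LIMSEQ_unique unfolding E by blast
  then show ?thesis by (simp add: VI)
qed

text \<open>Convergence of Y n in C makes Y n a Cauchy in the stronger norm of A, by
  \<open>mult_left_bound\<close>, so \<open>V_limit\<close> applies.\<close>

lemma mult_left_V:
  assumes Y: "Y \<longlonglongrightarrow> c" and V: "\<And>n. Y n * \<iota> a \<in> V"
  shows "c * \<iota> a \<in> V"
proof -
  have "\<forall>n. \<exists>x. \<iota> x = Y n * \<iota> a" using ideal_left by (metis rangeE)
  then obtain X where X: "\<And>n. \<iota> (X n) = Y n * \<iota> a" by metis
  have bound: "norm (X m - X n) \<le> (bnd * norm a) * norm (Y m - Y n)" for m n
    using mult_left_bound[of "X m - X n" "Y m - Y n" a] by (simp add: emb_diff X algebra_simps)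
  have "Cauchy X"
  proof (rule CauchyI)
    fix e :: real assume e: "e > 0"
    have pos: "bnd * norm a + 1 > 0" using bnd_nonneg by (simp add: add_nonneg_pos)
    then obtain N where N: "\<And>m n. m \<ge> N \<Longrightarrow> n \<ge> N \<Longrightarrow> norm (Y m - Y n) < e / (bnd * norm a + 1)"
      using CauchyD[OF LIMSEQ_imp_Cauchy[OF Y], of "e / (bnd * norm a + 1)"] e by auto
    have "norm (X m - X n) < e" if "m \<ge> N" "n \<ge> N" for m n
    proof -
      have "norm (X m - X n) \<le> (bnd * norm a + 1) * norm (Y m - Y n)"
        using bound[of m n] norm_ge_zero[of "Y m - Y n"] unfolding distrib_right mult_1 by linarith
      also have "\<dots> < (bnd * norm a + 1) * (e / (bnd * norm a + 1))"
        using N[OF that] pos by (intro mult_strict_left_mono)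
      also have "\<dots> = e" using pos by simp
      finally show ?thesis .
    qed
    then show "\<exists>N. \<forall>m\<ge>N. \<forall>n\<ge>N. norm (X m - X n) < e" by blast
  qed
  then show ?thesis
  proof (rule V_limit)
    show "\<iota> (X n) \<in> V" for n unfolding X by (rule V)
    show "(\<lambda>n. \<iota> (X n)) \<longlonglongrightarrow> c * \<iota> a" unfolding X by (intro tendsto_intros Y)
  qed
qed

section \<open>Commutation of v with C, and the products CA and AC\<close>

lemma dense_sequence:
  assumes "closure (range f) = (UNIV :: 'c set)"
  obtains Y where "(\<lambda>n. f (Y n)) \<longlonglongrightarrow> c"
proof -
  have "c \<in> closure (range f)" using assms by simp
  then obtain Z where Z: "\<forall>n. Z n \<in> range f" "Z \<longlonglongrightarrow> c" unfolding closure_sequential by blast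
  then have "\<forall>n. \<exists>y. Z n = f y" by blast
  then obtain Y where "\<And>n. Z n = f (Y n)" by metis
  then have "(\<lambda>n. f (Y n)) = Z" by auto
  with Z(2) show thesis by (intro that[of Y]) simp
qed

text \<open>For c = v y the product c u = v (y v) v lies in vCv. By density and
  \<open>mult_left_V\<close> the same holds for every c, and one factor v on the right is cancelled
  from c u = v e v.\<close>

lemma commute_right: "\<exists>e. c * v = v * e"
proof -
  obtain Y where Y: "(\<lambda>n. v * Y n) \<longlonglongrightarrow> c" by (rule dense_sequence[OF v_dense])
  have "v * Y n * \<iota> u \<in> V" for n
    using VI[of "Y n * v"] by (simp add: mult.assoc flip: v_square)
  from mult_left_V[OF Y this] obtain e where "c * \<iota> u = v * e * v" by (auto simp: V_def)
  then have "(c * v) * v = (v * e) * v" by (simp add: mult.assoc flip: v_square)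
  then show ?thesis by (auto simp: cancel_right)
qed

lemma commute_left: "\<exists>e. v * c = e * v"
proof -
  obtain e where "star c * v = v * e" using commute_right by blast
  then have "v * c = star e * v" by (metis star_mult star_star star_v)
  then show ?thesis by blast
qed

text \<open>Elements y u are dense in C. Writing y u a as (y v) (v a), one factor v can be moved to
  the far left and the other to the far right.\<close>

lemma left_mult_V: "c * \<iota> a \<in> V"
proof -
  obtain Y where Y: "(\<lambda>n. \<iota> u * Y n) \<longlonglongrightarrow> star c"
    by (rule dense_sequence[OF strictly_positive_dense[OF segal u]])
  have "star (\<iota> u) = \<iota> u" using cstar_pos_hermitian[OF u_pos] by (simp add: hermitian_def)
  then have lim: "(\<lambda>n. star (Y n) * \<iota> u) \<longlonglongrightarrow> c"
    using tendsto_star[OF Y] by (simp add: star_mult star_star)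
  have "star (Y n) * \<iota> u * \<iota> a \<in> V" for n
  proof -
    obtain e where e: "v * \<iota> a = e * v" using commute_left by blast
    obtain d where d: "star (Y n) * v = v * d" using commute_right by blast
    have "star (Y n) * \<iota> u * \<iota> a = (star (Y n) * v) * (v * \<iota> a)" by (simp add: mult.assoc flip: v_square)
    also have "\<dots> = v * (d * e) * v" unfolding d e by (simp add: mult.assoc)
    finally show ?thesis by (simp add: VI)
  qed
  with lim show ?thesis by (rule mult_left_V)
qed

lemma right_mult_V: "\<iota> a * c \<in> V"
proof -
  obtain b where "\<iota> b = star (\<iota> a)" using star_range by blast
  then have "\<iota> a * c = star (star c * \<iota> b)" by (simp add: star_mult star_star)
  then show ?thesis using V_star[OF left_mult_V] by simp
qed

text \<open>Moving the left factor v across c exhibits v c v as e u, a multiple of an element of the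
  ideal A.\<close>

lemma V_range: "x \<in> V \<Longrightarrow> x \<in> range \<iota>"
proof -
  assume "x \<in> V"
  then obtain c where c: "x = v * c * v" by (auto simp: V_def)
  obtain e where "v * c = e * v" using commute_left by blast
  then have "x = e * \<iota> u" by (simp add: c mult.assoc flip: v_square)
  then show ?thesis using ideal_left by simp
qed

text \<open>As squares span \<open>C\<close>, the identity \<open>m (x x) = m x x\<close> brings the image of \<open>m\<close> into \<open>A C\<close>.\<close>

lemma C_multiplier_V:
  assumes m: "m \<in> C_multipliers \<iota>"
  shows "lmult m c \<in> V" and "rmult m c \<in> V"
proof -
  have l: "\<exists>a. lmult m c = \<iota> a" and r: "\<exists>a. rmult m c = \<iota> a" for c
    using m unfolding C_multipliers_def by blast+
  have sq: "lmult m (x * x) \<in> V" "rmult m (x * x) \<in> V" for x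
    using l[of x] r[of x] right_mult_V left_mult_V by (auto simp: lmult_mult rmult_mult)
  have "lmult m c \<in> V \<and> rmult m c \<in> V" if "hermitian c" for c
  proof -
    obtain x y where c: "c = x * x + scaleC (- 1) (y * y)"
      using hermitian_eq_diff_squares[OF \<open>hermitian c\<close>] by (metis add_uminus_conv_diff scaleC_minus1)
    show ?thesis
      unfolding c lmult_add rmult_add lmult_scaleC rmult_scaleC by (intro conjI V_add V_scaleC sq)
  qed
  note herm = this
  have "lmult m c = lmult m (re_part c) + scaleC \<i> (lmult m (im_part c))"
    "rmult m c = rmult m (re_part c) + scaleC \<i> (rmult m (im_part c))"
    using re_im_decomp[of c] by (metis lmult_add lmult_scaleC, metis rmult_add rmult_scaleC)
  then show "lmult m c \<in> V" "rmult m c \<in> V"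
    using herm[OF hermitian_re_part[of c]] herm[OF hermitian_im_part[of c]]
    by (simp_all add: V_add V_scaleC)
qed

section \<open>Division by v in M(C), and the bimodule\<close>

lemma C_multipliers_eq: "C_multipliers \<iota> = {mult_emb v * m * mult_emb v | m. m \<in> UNIV}"
proof (intro equalityI subsetI)
  fix m assume "m \<in> {mult_emb v * m * mult_emb v | m. m \<in> UNIV}"
  then obtain n where m: "m = mult_emb v * n * mult_emb v" by blast
  have "lmult m c \<in> range \<iota>" for c
  proof -
    obtain e where "v * c = e * v" using commute_left by blast
    then have "lmult m c = v * lmult n e * v" by (simp add: m lmult_mult mult.assoc)
    then show ?thesis using V_range VI by metis
  qed
  moreover have "rmult m c \<in> range \<iota>" for c
  proof -
    obtain e where "c * v = v * e" using commute_right by blast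
    then have "rmult m c = v * rmult n e * v" by (simp add: m rmult_mult mult.assoc)
    then show ?thesis using V_range VI by metis
  qed
  ultimately show "m \<in> C_multipliers \<iota>" by (auto simp: C_multipliers_def)
next
  fix m assume m: "m \<in> C_multipliers \<iota>"
  \<comment> \<open>Formally R conjugates c to v^-1 c v, and L on the next line does the opposite.
    Cancellation of v makes both maps multiplicative.\<close>
  obtain R where R: "\<And>c. c * v = v * R c" using commute_right by metis
  obtain L where L: "\<And>c. v * c = L c * v" using commute_left by metis
  have R_mult: "R (x * y) = R x * R y" for x y
    by (metis R cancel_left mult.assoc)
  have L_mult: "L (x * y) = L x * L y" for x y
    by (metis L cancel_right mult.assoc)
  \<comment> \<open>If m = v d v, then m (R c) = v d v (R c) = v (d c) v, so the middle factor here
    must be d c; L plays the same role on the right.\<close>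
  have "\<exists>d. lmult m (R c) = v * d * v" "\<exists>d. rmult m (L c) = v * d * v" for c
    using C_multiplier_V[OF m] by (auto simp: V_def)
  then obtain dl dr where dl: "\<And>c. lmult m (R c) = v * dl c * v" and dr: "\<And>c. rmult m (L c) = v * dr c * v"
    by metis
  have cancel: "x = y" if "v * x * v = v * y * v" for x y
    using that by (simp add: cancel_left cancel_right mult.assoc)
  have "is_multiplier (dl, dr)"
    unfolding is_multiplier_def fst_conv snd_conv
  proof (intro conjI allI)
    fix x y
    have "v * dl (x * y) * v = v * dl x * (v * R y)"
      unfolding dl[symmetric] R_mult lmult_mult unfolding dl by (simp add: mult.assoc)
    then have "v * dl (x * y) * v = v * (dl x * y) * v" by (simp add: mult.assoc flip: R)
    then show "dl (x * y) = dl x * y" by (rule cancel)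
    have "v * dr (x * y) * v = (L x * v) * dr y * v"
      unfolding dr[symmetric] L_mult rmult_mult unfolding dr by (simp add: mult.assoc)
    then have "v * dr (x * y) * v = v * (x * dr y) * v" by (simp add: mult.assoc flip: L)
    then show "dr (x * y) = x * dr y" by (rule cancel)
    have "v * (x * dl y) * v = (v * x) * dl y * v" by (simp add: mult.assoc)
    also have "\<dots> = L x * lmult m (R y)" unfolding L[of x] dl by (simp add: mult.assoc)
    also have "\<dots> = rmult m (L x) * R y" by (rule lmult_rmult)
    also have "\<dots> = v * dr x * (v * R y)" unfolding dr by (simp add: mult.assoc)
    also have "\<dots> = v * (dr x * y) * v" unfolding R[symmetric] by (simp add: mult.assoc)
    finally show "x * dl y = dr x * y" by (rule cancel)
  qed
  then obtain d where d: "lmult d = dl"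
    by (metis Abs_multiplier_inverse fst_conv lmult.rep_eq mem_Collect_eq)
  have "m = mult_emb v * d * mult_emb v"
  proof (rule multiplier_eqI)
    fix c
    have "R (v * c) = c * v" using R[of "v * c"] by (simp add: mult.assoc cancel_left)
    then have "lmult m c * v = v * dl (v * c) * v"
      using dl[of "v * c"] by (simp add: lmult_mult)
    then show "lmult m c = lmult (mult_emb v * d * mult_emb v) c"
      by (simp add: cancel_right d)
  qed
  then show "m \<in> {mult_emb v * m * mult_emb v | m. m \<in> UNIV}" by blast
qed

lemma bimodule_exists:
  "\<exists>D :: 'c multiplier set.
    C_subbimodule D \<and> star ` D = D \<and> range mult_emb \<subseteq> D \<and> 1 \<in> D \<and>
    mult_emb ` range \<iota> = {mult_emb v * d * mult_emb v | d. d \<in> D} \<and>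
    (\<forall>d\<in>D. hermitian d \<longrightarrow>
       (\<forall>a. mult_emb (\<iota> a) = mult_emb v * d * mult_emb v \<longrightarrow> norm a = norm_MC d))"
proof -
  \<comment> \<open>The only possible choice: since v cancels on both sides, A = vDv determines
    D.\<close>
  define D where "D = {d. mult_emb v * d * mult_emb v \<in> mult_emb ` range \<iota>}"
  have DI: "d \<in> D" if "mult_emb v * d * mult_emb v = mult_emb (\<iota> a)" for d a
    using that by (auto simp: D_def)
  have DE: "\<exists>a. mult_emb v * d * mult_emb v = mult_emb (\<iota> a)" if "d \<in> D" for d
    using that by (auto simp: D_def)
  have star_D: "star d \<in> D" if "d \<in> D" for d
  proof -
    obtain a where a: "mult_emb v * d * mult_emb v = mult_emb (\<iota> a)" using DE[OF \<open>d \<in> D\<close>] by blast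
    obtain b where b: "\<iota> b = star (\<iota> a)" using star_range by blast
    have "mult_emb v * star d * mult_emb v = star (mult_emb v * d * mult_emb v)"
      by (simp add: star_mult mult.assoc flip: mult_emb_simps(8))
    also have "\<dots> = mult_emb (\<iota> b)" unfolding a b by (simp only: mult_emb_simps)
    finally show ?thesis by (rule DI)
  qed
  have "module (scaleC :: complex \<Rightarrow> 'c multiplier \<Rightarrow> 'c multiplier)"
    by unfold_locales (simp_all add: scaleC_add_right scaleC_add_left scaleC_scaleC scaleC_one)
  then interpret module "scaleC :: complex \<Rightarrow> 'c multiplier \<Rightarrow> 'c multiplier" .
  have "subspace D"
  proof (rule subspaceI)
    show "0 \<in> D" by (rule DI[of 0 0]) (use emb_scaleR[of 0 0] in \<open>simp add: mult_emb_simps\<close>)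
    fix x y k assume x: "x \<in> D"
    then obtain a where a: "mult_emb v * x * mult_emb v = mult_emb (\<iota> a)" using DE by blast
    show "scaleC k x \<in> D"
      by (rule DI[of _ "scaleC k a"])
        (simp add: mult_scaleC_left mult_scaleC_right a emb_scaleC mult_emb_simps)
    assume "y \<in> D"
    then obtain b where b: "mult_emb v * y * mult_emb v = mult_emb (\<iota> b)" using DE by blast
    show "x + y \<in> D"
      by (rule DI[of _ "a + b"]) (simp add: distrib_left distrib_right a b emb_add mult_emb_simps)
  qed
  moreover have "mult_emb c * d \<in> D" "d * mult_emb c \<in> D" if "d \<in> D" for c d
  proof -
    obtain a where a: "mult_emb v * d * mult_emb v = mult_emb (\<iota> a)" using DE[OF \<open>d \<in> D\<close>] by blast
    obtain e where e: "v * c = e * v" using commute_left by blast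
    obtain b where b: "\<iota> b = e * \<iota> a" using ideal_left by (metis rangeE)
    have "mult_emb v * (mult_emb c * d) * mult_emb v = mult_emb (v * c) * d * mult_emb v"
      by (simp only: mult_emb_simps mult.assoc)
    also have "\<dots> = mult_emb e * (mult_emb v * d * mult_emb v)"
      unfolding e by (simp only: mult_emb_simps mult.assoc)
    also have "\<dots> = mult_emb (\<iota> b)" unfolding a b by (simp only: mult_emb_simps)
    finally show "mult_emb c * d \<in> D" by (rule DI)
    obtain f where f: "c * v = v * f" using commute_right by blast
    obtain g where g: "\<iota> g = \<iota> a * f" using ideal_right by (metis rangeE)
    have "mult_emb v * (d * mult_emb c) * mult_emb v = mult_emb v * d * mult_emb (c * v)"
      by (simp only: mult_emb_simps mult.assoc)
    also have "\<dots> = (mult_emb v * d * mult_emb v) * mult_emb f"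
      unfolding f by (simp only: mult_emb_simps mult.assoc)
    also have "\<dots> = mult_emb (\<iota> g)" unfolding a g by (simp only: mult_emb_simps)
    finally show "d * mult_emb c \<in> D" by (rule DI)
  qed
  ultimately have "C_subbimodule D" unfolding C_subbimodule_def by blast
  moreover have "star ` D = D"
  proof (intro equalityI subsetI)
    fix d assume "d \<in> D"
    then have "star (star d) \<in> star ` D" using star_D by blast
    then show "d \<in> star ` D" by (simp add: star_star)
  qed (use star_D in blast)
  moreover have "range mult_emb \<subseteq> D"
  proof clarify
    fix c
    obtain a where "\<iota> a = v * c * v" using V_range[OF VI] by (metis rangeE)
    then show "mult_emb c \<in> D" by (intro DI[of _ a]) (simp add: mult_emb_simps)
  qed
  moreover have "1 \<in> D" by (rule DI[of _ u]) (simp add: mult_emb_simps flip: v_square)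
  moreover have "mult_emb ` range \<iota> = {mult_emb v * d * mult_emb v | d. d \<in> D}"
  proof (intro equalityI subsetI)
    fix m assume m: "m \<in> mult_emb ` range \<iota>"
    then obtain a where a: "m = mult_emb (\<iota> a)" by blast
    \<comment> \<open>Multiplication by an element of the ideal A sends C into A from both sides, so
      \<open>C_multipliers_eq\<close> provides the middle factor in M(C).\<close>
    have "m \<in> C_multipliers \<iota>" unfolding a using ideal_left ideal_right by (auto simp: C_multipliers_def)
    then obtain d where "m = mult_emb v * d * mult_emb v" unfolding C_multipliers_eq by blast
    with m show "m \<in> {mult_emb v * d * mult_emb v | d. d \<in> D}" by (auto simp: D_def)
  qed (auto simp: D_def)
  moreover have "norm a = norm_MC d"
    if "hermitian d" "mult_emb (\<iota> a) = mult_emb v * d * mult_emb v" for a d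
    using norm_conj_hermitian[OF that] by (simp add: norm_multiplier_def)
  ultimately show ?thesis by blast
qed

section \<open>The multiplier norm and the approximate ideal\<close>

lemma norm_M_bdd: "bdd_above ((\<lambda>b. max (norm (x * b)) (norm (b * x))) ` {b. norm b \<le> 1})"
  for x :: 'a
proof (rule bdd_aboveI2)
  fix b :: 'a assume "b \<in> {b. norm b \<le> 1}"
  then have "norm x * norm b \<le> norm x" by (simp add: mult_left_le)
  then show "max (norm (x * b)) (norm (b * x)) \<le> norm x"
    using norm_mult_ineq[of x b] norm_mult_ineq[of b x] by (simp add: mult.commute)
qed

lemma norm_M_le: "norm_M x \<le> bnd * norm (\<iota> x)"
  unfolding norm_M_def
proof (rule cSUP_least)
  show "{b :: 'a. norm b \<le> 1} \<noteq> {}" by (auto intro: exI[of _ 0])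
  fix b :: 'a assume "b \<in> {b. norm b \<le> 1}"
  then have "bnd * norm (\<iota> x) * norm b \<le> bnd * norm (\<iota> x)"
    using bnd_nonneg by (intro mult_left_le) auto
  then show "max (norm (x * b)) (norm (b * x)) \<le> bnd * norm (\<iota> x)"
    using mult_left_bound[of "x * b" "\<iota> x" b] mult_right_bound[of "b * x" b "\<iota> x"]
    by (simp add: emb_mult)
qed

lemma norm_mult_le_norm_M: "norm (x * b) \<le> norm_M x * norm b" for x b :: 'a
proof (cases "b = 0")
  case False
  have "norm (x * ((1 / norm b) *\<^sub>R b)) \<le> norm_M x"
    unfolding norm_M_def
    by (rule cSUP_upper2[OF norm_M_bdd, of "(1 / norm b) *\<^sub>R b"]) (use False in auto)
  then show ?thesis using False by (simp add: field_simps)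
qed simp

text \<open>The action of x on the single element u suffices. If x v = v e, then x u = v e v, so e
  is bounded by the norm of x u. Conversely e bounds x, because \<open>star e\<close> u = v
  \<open>star x\<close> v.\<close>

lemma norm_le_norm_M: "\<exists>M\<ge>0. \<forall>x. norm (\<iota> x) \<le> M * norm_M x"
proof -
  have comm: "norm c \<le> (2 * bnd * norm u) * norm e" if "c * v = v * e" for c e
  proof -
    have "v * star c = star e * v" using that by (metis star_mult star_v)
    then have eq: "star e * \<iota> u = v * star c * v" by (simp add: mult.assoc flip: v_square)
    obtain y where y: "\<iota> y = star e * \<iota> u" using ideal_left by (metis rangeE)
    have "norm (star c) \<le> 2 * norm y" by (rule norm_le_norm_conj) (simp add: y eq)
    also have "\<dots> \<le> 2 * (bnd * norm (star e) * norm u)" using mult_left_bound[OF y] by simp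
    finally show ?thesis by (simp add: mult_ac)
  qed
  have "norm (\<iota> x) \<le> (4 * bnd * norm u * norm u) * norm_M x" for x
  proof -
    obtain e where e: "\<iota> x * v = v * e" using commute_right by blast
    have "norm e \<le> 2 * norm (x * u)"
      using arg_cong[OF e, of "\<lambda>z. z * v"]
      by (intro norm_le_norm_conj) (simp add: emb_mult mult.assoc flip: v_square)
    also have "\<dots> \<le> 2 * (norm_M x * norm u)" using norm_mult_le_norm_M[of x u] by simp
    finally have "(2 * bnd * norm u) * norm e \<le> (2 * bnd * norm u) * (2 * (norm_M x * norm u))"
      using bnd_nonneg by (intro mult_left_mono) auto
    with comm[OF e] show ?thesis by (simp add: mult_ac)
  qed
  then show ?thesis using bnd_nonneg by (intro exI[of _ "4 * bnd * norm u * norm u"]) auto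
qed

text \<open>The comparison of norms turns \<open>norm_M\<close>-Cauchy sequences in A into
  convergent sequences in C and back. So an element of the approximate ideal is a product a c with c
  in C, which lies in vCv by \<open>right_mult_V\<close>.\<close>

lemma approximate_ideal_eq: "\<iota> ` approximate_ideal = V"
proof (intro equalityI subsetI)
  fix z assume "z \<in> \<iota> ` approximate_ideal"
  then obtain y a X where z: "z = \<iota> y" and X: "mult_Cauchy X"
    and lim: "(\<lambda>n. norm_M (a * X n - y)) \<longlonglongrightarrow> 0"
    by (auto simp: approximate_ideal_def)
  obtain M where M: "M \<ge> 0" "\<And>x. norm (\<iota> x) \<le> M * norm_M x" using norm_le_norm_M by blast
  have "Cauchy (\<lambda>n. \<iota> (X n))"
  proof (rule CauchyI)
    fix e :: real assume e: "e > 0"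
    then have "e / (M + 1) > 0" using M(1) by simp
    then obtain N where N: "\<And>m n. m \<ge> N \<Longrightarrow> n \<ge> N \<Longrightarrow> norm_M (X m - X n) < e / (M + 1)"
      using X unfolding mult_Cauchy_def by blast
    have "norm (\<iota> (X m) - \<iota> (X n)) < e" if "m \<ge> N" "n \<ge> N" for m n
    proof -
      have "norm (\<iota> (X m) - \<iota> (X n)) \<le> M * norm_M (X m - X n)"
        using M(2)[of "X m - X n"] by (simp add: emb_diff)
      also have "\<dots> \<le> M * (e / (M + 1))" using M(1) N[OF that] by (intro mult_left_mono) auto
      also have "\<dots> < e" using M(1) e by (simp add: field_simps)
      finally show ?thesis .
    qed
    then show "\<exists>N. \<forall>m\<ge>N. \<forall>n\<ge>N. norm (\<iota> (X m) - \<iota> (X n)) < e" by blast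
  qed
  then obtain c where c: "(\<lambda>n. \<iota> (X n)) \<longlonglongrightarrow> c" using Cauchy_convergent convergent_def by blast
  have "(\<lambda>n. M * norm_M (a * X n - y)) \<longlonglongrightarrow> M * 0" by (intro tendsto_intros lim)
  then have "(\<lambda>n. \<iota> (a * X n - y)) \<longlonglongrightarrow> 0"
    unfolding mult_zero_right
    by (rule Lim_null_comparison[rotated]) (intro always_eventually allI M(2))
  then have "(\<lambda>n. \<iota> a * \<iota> (X n) - \<iota> y) \<longlonglongrightarrow> 0" unfolding emb_simps .
  from tendsto_add[OF this tendsto_const[of "\<iota> y"]]
  have "(\<lambda>n. \<iota> a * \<iota> (X n)) \<longlonglongrightarrow> \<iota> y" by simp
  moreover have "(\<lambda>n. \<iota> a * \<iota> (X n)) \<longlonglongrightarrow> \<iota> a * c" by (intro tendsto_intros c)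
  ultimately have "z = \<iota> a * c" unfolding z by (rule LIMSEQ_unique)
  then show "z \<in> V" by (simp add: right_mult_V)
next
  fix z assume zV: "z \<in> V"
  then obtain c where c: "z = v * c * v" by (auto simp: V_def)
  \<comment> \<open>Moving v to the left turns v c v into u e, so the one factor a = u serves for
    all of vCv.\<close>
  obtain e where "c * v = v * e" using commute_right by blast
  then have z: "z = \<iota> u * e" by (simp add: c mult.assoc flip: v_square)
  obtain y where y: "z = \<iota> y" using V_range[OF zV] by blast
  obtain X where X: "(\<lambda>n. \<iota> (X n)) \<longlonglongrightarrow> e"
    by (rule dense_sequence[of \<iota> e]) (use segal in \<open>simp add: cstar_segal_def\<close>)
  have "mult_Cauchy X"
    unfolding mult_Cauchy_def
  proof (intro allI impI)
    fix r :: real assume r: "r > 0"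
    have pos: "bnd + 1 > 0" using bnd_nonneg by simp
    then obtain N where N: "\<And>m n. m \<ge> N \<Longrightarrow> n \<ge> N \<Longrightarrow> norm (\<iota> (X m) - \<iota> (X n)) < r / (bnd + 1)"
      using CauchyD[OF LIMSEQ_imp_Cauchy[OF X], of "r / (bnd + 1)"] r by auto
    have "norm_M (X m - X n) < r" if "m \<ge> N" "n \<ge> N" for m n
    proof -
      have "norm_M (X m - X n) \<le> bnd * norm (\<iota> (X m) - \<iota> (X n))"
        using norm_M_le[of "X m - X n"] by (simp add: emb_diff)
      also have "\<dots> \<le> bnd * (r / (bnd + 1))" using bnd_nonneg N[OF that] by (intro mult_left_mono) auto
      also have "\<dots> < r" using pos r by (simp add: field_simps)
      finally show ?thesis .
    qed
    then show "\<exists>N. \<forall>m\<ge>N. \<forall>n\<ge>N. norm_M (X m - X n) < r" by blast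
  qed
  moreover have "(\<lambda>n. norm_M (u * X n - y)) \<longlonglongrightarrow> 0"
  proof (rule Lim_null_comparison)
    have "(\<lambda>n. bnd * norm (\<iota> u * \<iota> (X n) - \<iota> y)) \<longlonglongrightarrow> bnd * norm (\<iota> u * e - \<iota> y)"
      by (intro tendsto_intros X)
    then show "(\<lambda>n. bnd * norm (\<iota> (u * X n - y))) \<longlonglongrightarrow> 0"
      using y z by (simp add: emb_simps)
    have "norm (norm_M x) \<le> bnd * norm (\<iota> x)" for x
    proof -
      have "norm (x * 0) \<le> norm_M x"
        unfolding norm_M_def by (rule cSUP_upper2[OF norm_M_bdd, of 0]) auto
      then show ?thesis using norm_M_le[of x] by simp
    qed
    then show "\<forall>\<^sub>F n in sequentially. norm (norm_M (u * X n - y)) \<le> bnd * norm (\<iota> (u * X n - y))"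
      by simp
  qed
  ultimately have "y \<in> approximate_ideal" unfolding approximate_ideal_def by blast
  then show "z \<in> \<iota> ` approximate_ideal" unfolding y by blast
qed

end

theorem theorem3p12:
  fixes \<iota> :: "'a::complex_banach_algebra \<Rightarrow> 'c::cstar_algebra" and u :: 'a and v :: 'c
  assumes "cstar_segal \<iota>"
    and "segal_self_adjoint \<iota> \<Longrightarrow> star_isometric \<iota>"
    and "strictly_positive \<iota> u"
    and "v = pos_sqrt (\<iota> u)"
  shows "(order_unit_cstar_segal \<iota> u \<longleftrightarrow>
           (\<exists>D :: 'c multiplier set.
              C_subbimodule D \<and> star ` D = D \<and> range mult_emb \<subseteq> D \<and> 1 \<in> D \<and>
              mult_emb ` range \<iota> = {mult_emb v * d * mult_emb v | d. d \<in> D} \<and>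
              (\<forall>d\<in>D. hermitian d \<longrightarrow>
                 (\<forall>a. mult_emb (\<iota> a) = mult_emb v * d * mult_emb v \<longrightarrow> norm a = norm_MC d))))
       \<and> (order_unit_cstar_segal \<iota> u \<longrightarrow>
            \<iota> ` approximate_ideal = {v * c * v | c. c \<in> UNIV} \<and>
            C_multipliers \<iota> = {mult_emb v * m * mult_emb v | m. m \<in> UNIV})"
proof -
  interpret segal_square \<iota> u v
    by unfold_locales (fact assms)+
  \<comment> \<open>Condition (a) contains self-adjointness, which makes the convention on the
    isometric star available.\<close>
  have ou: "order_unit_segal \<iota> u v" if "order_unit_cstar_segal \<iota> u"
    using that assms(2) by unfold_locales (auto simp: order_unit_cstar_segal_def)
  show ?thesis
  proof (intro conjI iffI impI)
    assume "order_unit_cstar_segal \<iota> u"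
    then interpret order_unit_segal \<iota> u v by (rule ou)
    show "\<exists>D :: 'c multiplier set.
        C_subbimodule D \<and> star ` D = D \<and> range mult_emb \<subseteq> D \<and> 1 \<in> D \<and>
        mult_emb ` range \<iota> = {mult_emb v * d * mult_emb v | d. d \<in> D} \<and>
        (\<forall>d\<in>D. hermitian d \<longrightarrow>
           (\<forall>a. mult_emb (\<iota> a) = mult_emb v * d * mult_emb v \<longrightarrow> norm a = norm_MC d))"
      by (rule bimodule_exists)
  next
    assume "\<exists>D :: 'c multiplier set.
        C_subbimodule D \<and> star ` D = D \<and> range mult_emb \<subseteq> D \<and> 1 \<in> D \<and>
        mult_emb ` range \<iota> = {mult_emb v * d * mult_emb v | d. d \<in> D} \<and>
        (\<forall>d\<in>D. hermitian d \<longrightarrow>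
           (\<forall>a. mult_emb (\<iota> a) = mult_emb v * d * mult_emb v \<longrightarrow> norm a = norm_MC d))"
    then show "order_unit_cstar_segal \<iota> u" by (elim exE conjE) (rule order_unit_of_bimodule)
  next
    assume "order_unit_cstar_segal \<iota> u"
    then interpret order_unit_segal \<iota> u v by (rule ou)
    show "\<iota> ` approximate_ideal = {v * c * v | c. c \<in> UNIV}"
      using approximate_ideal_eq by (simp add: V_def)
  next
    assume "order_unit_cstar_segal \<iota> u"
    then interpret order_unit_segal \<iota> u v by (rule ou)
    show "C_multipliers \<iota> = {mult_emb v * m * mult_emb v | m. m \<in> UNIV}"
      by (rule C_multipliers_eq)
  qed
qed

end
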